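(* The following decision problem belongs to the class NP: given a skew-symmetrizable integer matrix $B$, decide whether $B$ has a positive quasi-Cartan companion.
   Context: All matrices are square with integer entries, except diagonal matrices $D$, which are real. A matrix $B$ is skew-symmetrizable if there is a diagonal matrix $D$ with positive diagonal entries such that $D\times B$ is skew-symmetric. A matrix $C$ is symmetrizable if there is a diagonal matrix $D$ with positive diagonal entries such that $D\times C$ is symmetric; such a $D$ is called a symmetrizer of $C$. A quasi-Cartan matrix is a symmetrizable matrix all of whose diagonal entries equal $2$. A quasi-Cartan companion of a skew-symmetrizable matrix $B$ is a quasi-Cartan matrix $C$ with $|c_{ij}|=|b_{ij}|$ for all $i\neq j$. A quasi-Cartan matrix $C$ is positive if the symmetric matrix $D\times C$ is positive definite, where $D$ is a symmetrizer of $C$. *)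

theory Defs
  imports
    "Jordan_Normal_Form.Matrix"
    "HOL-Computational_Algebra.Polynomial"
begin

section \<open>Quasi-Cartan companions\<close>

definition symmetric_mat :: "real mat \<Rightarrow> bool" where
  "symmetric_mat A \<longleftrightarrow> transpose_mat A = A"

definition skew_symmetric_mat :: "real mat \<Rightarrow> bool" where
  "skew_symmetric_mat A \<longleftrightarrow> transpose_mat A = - A"

definition positive_definite_mat :: "real mat \<Rightarrow> bool" where
  "positive_definite_mat A \<longleftrightarrow> symmetric_mat A \<and>
     (\<forall>x \<in> carrier_vec (dim_row A). x \<noteq> 0\<^sub>v (dim_row A) \<longrightarrow> x \<bullet> (A *\<^sub>v x) > 0)"

definition positive_diagonal_mat :: "nat \<Rightarrow> real mat \<Rightarrow> bool" where
  "positive_diagonal_mat n D \<longleftrightarrow>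
     D \<in> carrier_mat n n \<and> diagonal_mat D \<and> (\<forall>i<n. D $$ (i,i) > 0)"

definition skew_symmetrizable :: "int mat \<Rightarrow> bool" where
  "skew_symmetrizable B \<longleftrightarrow> square_mat B \<and>
     (\<exists>D. positive_diagonal_mat (dim_row B) D \<and> skew_symmetric_mat (D * map_mat real_of_int B))"

definition symmetrizer :: "real mat \<Rightarrow> int mat \<Rightarrow> bool" where
  "symmetrizer D C \<longleftrightarrow>
     positive_diagonal_mat (dim_row C) D \<and> symmetric_mat (D * map_mat real_of_int C)"

definition symmetrizable :: "int mat \<Rightarrow> bool" where
  "symmetrizable C \<longleftrightarrow> square_mat C \<and> (\<exists>D. symmetrizer D C)"

definition quasi_Cartan :: "int mat \<Rightarrow> bool" where
  "quasi_Cartan C \<longleftrightarrow> symmetrizable C \<and> (\<forall>i<dim_row C. C $$ (i,i) = 2)"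

definition quasi_Cartan_companion :: "int mat \<Rightarrow> int mat \<Rightarrow> bool" where
  "quasi_Cartan_companion C B \<longleftrightarrow>
     quasi_Cartan C \<and> dim_row C = dim_row B \<and>
     (\<forall>i<dim_row B. \<forall>j<dim_row B. i \<noteq> j \<longrightarrow> \<bar>C $$ (i,j)\<bar> = \<bar>B $$ (i,j)\<bar>)"

definition positive_quasi_Cartan :: "int mat \<Rightarrow> bool" where
  "positive_quasi_Cartan C \<longleftrightarrow>
     quasi_Cartan C \<and> (\<exists>D. symmetrizer D C \<and> positive_definite_mat (D * map_mat real_of_int C))"

section \<open>Multi-tape Turing machines\<close>

text \<open>
  Symbols and states are natural numbers below the bounds \<open>tm_symbols\<close> and \<open>tm_states\<close>;
  symbol 0 is the blank, and the bits False and True are written as the symbols 1 and 2.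
  Tapes are infinite in both directions; a tape is paired with the position of its head.
\<close>

datatype direction = Left | Stay | Right

record turing_machine =
  tm_tapes :: nat
  tm_symbols :: nat
  tm_states :: nat
  tm_start :: nat
  tm_accept :: nat
  tm_reject :: nat
  tm_delta :: "nat \<Rightarrow> nat list \<Rightarrow> nat \<times> (nat \<times> direction) list"

definition wf_tm :: "turing_machine \<Rightarrow> bool" where
  "wf_tm M \<longleftrightarrow>
     tm_tapes M \<ge> 2 \<and> tm_symbols M \<ge> 3 \<and>
     tm_start M < tm_states M \<and> tm_accept M < tm_states M \<and> tm_reject M < tm_states M \<and>
     tm_accept M \<noteq> tm_reject M \<and>
     (\<forall>q < tm_states M. \<forall>ss. length ss = tm_tapes M \<and> set ss \<subseteq> {..<tm_symbols M} \<longrightarrow>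
        (case tm_delta M q ss of (q', acts) \<Rightarrow>
           q' < tm_states M \<and> length acts = tm_tapes M \<and> fst ` set acts \<subseteq> {..<tm_symbols M}))"

type_synonym tape = "(int \<Rightarrow> nat) \<times> int"

type_synonym configuration = "nat \<times> tape list"

fun read_tape :: "tape \<Rightarrow> nat" where
  "read_tape (t, h) = t h"

fun move_head :: "direction \<Rightarrow> int \<Rightarrow> int" where
  "move_head Left h = h - 1"
| "move_head Stay h = h"
| "move_head Right h = h + 1"

fun act_tape :: "nat \<times> direction \<Rightarrow> tape \<Rightarrow> tape" where
  "act_tape (s, d) (t, h) = (t(h := s), move_head d h)"

definition halted :: "turing_machine \<Rightarrow> configuration \<Rightarrow> bool" where
  "halted M c \<longleftrightarrow> fst c = tm_accept M \<or> fst c = tm_reject M"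

definition tm_step :: "turing_machine \<Rightarrow> configuration \<Rightarrow> configuration" where
  "tm_step M c =
     (if halted M c then c
      else case tm_delta M (fst c) (map read_tape (snd c)) of
        (q', acts) \<Rightarrow> (q', map2 act_tape acts (snd c)))"

definition word_tape :: "bool list \<Rightarrow> tape" where
  "word_tape w =
     ((\<lambda>p. if 0 \<le> p \<and> p < int (length w) then (if w ! nat p then 2 else 1) else 0), 0)"

text \<open>A machine is started on a pair of words, written on its first two tapes.\<close>

definition tm_init :: "turing_machine \<Rightarrow> bool list \<Rightarrow> bool list \<Rightarrow> configuration" where
  "tm_init M x u =
     (tm_start M, word_tape x # word_tape u # replicate (tm_tapes M - 2) (word_tape []))"

definition tm_run :: "turing_machine \<Rightarrow> bool list \<Rightarrow> bool list \<Rightarrow> nat \<Rightarrow> configuration" where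
  "tm_run M x u t = (tm_step M ^^ t) (tm_init M x u)"

definition tm_accepts :: "turing_machine \<Rightarrow> bool list \<Rightarrow> bool list \<Rightarrow> bool" where
  "tm_accepts M x u \<longleftrightarrow> (\<exists>t. fst (tm_run M x u t) = tm_accept M)"

definition polynomial_time :: "turing_machine \<Rightarrow> bool" where
  "polynomial_time M \<longleftrightarrow>
     (\<exists>p :: nat poly. \<forall>x u. halted M (tm_run M x u (poly p (length x + length u))))"

section \<open>The class NP\<close>

text \<open>The second argument of the verifier \<open>M\<close> is the certificate.\<close>

definition NP :: "bool list set set" where
  "NP = {L. \<exists>M (p :: nat poly). wf_tm M \<and> polynomial_time M \<and>
     (\<forall>x. x \<in> L \<longleftrightarrow> (\<exists>u. length u \<le> poly p (length x) \<and> tm_accepts M x u))}"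

section \<open>Binary encoding of integer matrices\<close>

text \<open>Binary digits, least significant first, without leading zeros.\<close>

fun nat_bits :: "nat \<Rightarrow> bool list" where
  "nat_bits n = (if n = 0 then [] else odd n # nat_bits (n div 2))"

declare nat_bits.simps [simp del]

text \<open>
  A sign bit, then the digits of the absolute value, each preceded by True, then False as
  the end marker; this makes the code prefix-free.
\<close>

definition encode_int :: "int \<Rightarrow> bool list" where
  "encode_int z = (z < 0) # concat (map (\<lambda>b. [True, b]) (nat_bits (nat \<bar>z\<bar>))) @ [False]"

text \<open>
  The dimension in unary, then the entries row by row. The unary dimension does not change
  the order of magnitude of the input length, as there are \<open>n\<^sup>2\<close> entries.
\<close>

definition encode_mat :: "int mat \<Rightarrow> bool list" where
  "encode_mat A = replicate (dim_row A) True @ [False] @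
     concat [encode_int (A $$ (i,j)). i \<leftarrow> [0..<dim_row A], j \<leftarrow> [0..<dim_col A]]"

text \<open>Distinct square matrices have distinct codes.\<close>

lemma nat_bits_inj: "nat_bits m = nat_bits n \<Longrightarrow> m = n"
proof (induction m arbitrary: n rule: less_induct)
  case (less m)
  show ?case
  proof (cases "m = 0 \<or> n = 0")
    case True
    then show ?thesis using less.prems by (subst (asm) (1 2) nat_bits.simps) (auto split: if_splits)
  next
    case False
    then have "odd m = odd n" "nat_bits (m div 2) = nat_bits (n div 2)"
      using less.prems by (subst (asm) (1 2) nat_bits.simps; simp)+
    moreover from this False have "m div 2 = n div 2" using less.IH[of "m div 2"] by simp
    ultimately show ?thesis by presburger
  qed
qed

lemma marked_bits_prefix_free:
  "concat (map (\<lambda>b. [True, b]) xs) @ False # r = concat (map (\<lambda>b. [True, b]) ys) @ False # s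
    \<longleftrightarrow> xs = ys \<and> r = s"
proof (induction xs arbitrary: ys)
  case Nil
  show ?case by (cases ys) auto
next
  case (Cons a xs)
  then show ?case by (cases ys) auto
qed

lemma encode_int_prefix_free:
  "encode_int y @ r = encode_int z @ s \<longleftrightarrow> y = z \<and> r = s"
  using nat_bits_inj[of "nat \<bar>y\<bar>" "nat \<bar>z\<bar>"]
  by (auto simp: encode_int_def marked_bits_prefix_free)

lemma concat_encode_int_inj:
  assumes "concat (map (\<lambda>k. encode_int (f k)) ks) = concat (map (\<lambda>k. encode_int (g k)) ks)"
  shows "\<forall>k \<in> set ks. f k = g k"
  using assms by (induction ks) (auto simp: encode_int_prefix_free)

lemma unary_prefix_free:
  "replicate m True @ False # r = replicate n True @ False # s \<longleftrightarrow> m = n \<and> r = s"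
proof (induction m arbitrary: n)
  case 0
  show ?case by (cases n) auto
next
  case (Suc m)
  then show ?case by (cases n) auto
qed

lemma encode_mat_entries:
  "concat [encode_int (A $$ (i,j)). i \<leftarrow> is, j \<leftarrow> js] =
   concat (map (\<lambda>k. encode_int (A $$ k)) (List.product is js))"
  by (induction "is") (auto simp: comp_def)

lemma encode_mat_inj:
  assumes "square_mat A" "square_mat B" "encode_mat A = encode_mat B"
  shows "A = B"
proof -
  let ?n = "dim_row A"
  have n: "dim_col A = ?n" "dim_row B = ?n" "dim_col B = ?n"
    using assms by (auto simp: encode_mat_def unary_prefix_free)
  have "\<forall>k \<in> set (List.product [0..<?n] [0..<?n]). A $$ k = B $$ k"
    using assms(3) n
    by (intro concat_encode_int_inj)
       (simp add: encode_mat_def unary_prefix_free encode_mat_entries)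
  with n show ?thesis by (intro eq_matI) auto
qed

section \<open>The decision problem\<close>

text \<open>
  The language of the codes of the yes-instances; in particular, words that are not the code
  of a skew-symmetrizable matrix are not in the language.
\<close>

definition positive_companion_problem :: "bool list set" where
  "positive_companion_problem = encode_mat ` {B. skew_symmetrizable B \<and>
     (\<exists>C. quasi_Cartan_companion C B \<and> positive_quasi_Cartan C)}"

end

(*
  A positive quasi-Cartan companion C satisfies c_ij c_ji < 4, so yes-instances have entries between -3
  and 3. Positivity of C is witnessed by integer vectors u_k supported on the first k + 1 coordinates
  with (C u_k)_j = 0 for j < k and u_kk, (C u_k)_k > 0: they are orthogonal for the form, and Cramer's
  rule bounds their entries by k! 3^k, hence by 2^N for the input length N. The symmetrizer can be taken
  of the form 2^a 3^b with exponents of polynomial size. So a yes-instance x is characterized by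
  finitely many relations on {0..N} that satisfy a first-order formula: the relations record the parsing of x,
  the exponents, and the bit patterns of the u_k and of the partial sums in C u_k with their carries.
  Such properties are in NP: the certificate tabulates the relations, and a Turing machine
  with one unary counter per variable evaluates the formula by nested loops.
*)
theory Submission
  imports Defs "Jordan_Normal_Form.Determinant"
begin

section \<open>Structured programs for multi-tape machines\<close>

text \<open>The detour through logic confines the programming of Turing machines to one generic
  evaluator; everything specific to matrices is a formula and a statement about relations. The
  obstacle is that variables range only over numbers up to the input length \<open>N\<close>, while
  the vectors \<open>u_k\<close> and the sums in \<open>C u_k\<close> have exponential size. They
  therefore enter as bit strings, and the only products needed are those of an entry of size at most
  3 with such a number, so that an adder with carries below 4 suffices and no general multiplication
  is ever expressed. Sums can be negative; the offset \<open>2^N\<close> keeps them natural, and a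
  subtraction is read as an addition with the two sums exchanged. A real symmetrizer
  \<open>d\<close> has no finite description as it stands, but two nonzero entries with
  \<open>|b_ij b_ji| < 4\<close> force the ratio \<open>d_i / d_j\<close> to be 1, 2, 1/2, 3 or 1/3,
  so that two integer potentials replace \<open>d\<close>. The potentials take values up to
  \<open>2 n^2\<close> and the bit positions stay near \<open>n^2 + n\<close>; both fit below
  \<open>N\<close> because each entry contributes at least two symbols to the code.\<close>

datatype prog =
    Skip
  | Move nat direction
  | Write nat nat
  | Seq prog prog (infixr ";;" 65)
  | Branch nat "nat set" prog prog
  | While nat "nat set" prog

text \<open>The number is an upper bound on the machine steps rather than their count: each
  construct pays at least one step for unfolding the continuation, and the strict inequalities leave
  slack. Tape families are indexed by all numbers; \<open>wf_prog\<close> cuts them down to the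
  tapes of the machine.\<close>

inductive exec :: "prog \<Rightarrow> (nat \<Rightarrow> tape) \<Rightarrow> nat \<Rightarrow> (nat \<Rightarrow> tape) \<Rightarrow> bool" where
  Skip: "exec Skip T (Suc t) T"
| Move: "exec (Move i d) T (Suc t) (T(i := (fst (T i), move_head d (snd (T i)))))"
| Write: "exec (Write i s) T (Suc t) (T(i := ((fst (T i))(snd (T i) := s), snd (T i))))"
| Seq: "exec P T t T' \<Longrightarrow> exec Q T' t' T'' \<Longrightarrow> t + t' < n \<Longrightarrow> exec (P ;; Q) T n T''"
| BranchT: "read_tape (T i) \<in> S \<Longrightarrow> exec P T t T' \<Longrightarrow> t < n \<Longrightarrow> exec (Branch i S P Q) T n T'"
| BranchF: "read_tape (T i) \<notin> S \<Longrightarrow> exec Q T t T' \<Longrightarrow> t < n \<Longrightarrow> exec (Branch i S P Q) T n T'"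
| WhileF: "read_tape (T i) \<notin> S \<Longrightarrow> exec (While i S P) T (Suc t) T"
| WhileT: "read_tape (T i) \<in> S \<Longrightarrow> exec P T t T' \<Longrightarrow> exec (While i S P) T' t' T'' \<Longrightarrow> t + t' < n
    \<Longrightarrow> exec (While i S P) T n T''"

fun wf_prog :: "nat \<Rightarrow> prog \<Rightarrow> bool" where
  "wf_prog m Skip \<longleftrightarrow> True"
| "wf_prog m (Move i d) \<longleftrightarrow> i < m"
| "wf_prog m (Write i s) \<longleftrightarrow> i < m \<and> s < 3"
| "wf_prog m (P ;; Q) \<longleftrightarrow> wf_prog m P \<and> wf_prog m Q"
| "wf_prog m (Branch i S P Q) \<longleftrightarrow> i < m \<and> wf_prog m P \<and> wf_prog m Q"
| "wf_prog m (While i S P) \<longleftrightarrow> i < m \<and> wf_prog m P"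

text \<open>
  The control state of a compiled program is its continuation, a list of programs still to be
  run; only finitely many continuations are reachable.
\<close>

fun conts :: "prog \<Rightarrow> prog list \<Rightarrow> prog list set" where
  "conts Skip K = {Skip # K}"
| "conts (Move i d) K = {Move i d # K}"
| "conts (Write i s) K = {Write i s # K}"
| "conts (P ;; Q) K = insert ((P ;; Q) # K) (conts P (Q # K) \<union> conts Q K)"
| "conts (Branch i S P Q) K = insert (Branch i S P Q # K) (conts P K \<union> conts Q K)"
| "conts (While i S P) K = insert (While i S P # K) (conts P (While i S P # K))"

definition idle :: "nat list \<Rightarrow> (nat \<times> direction) list" where
  "idle ss = map (\<lambda>s. (s, Stay)) ss"

fun ctl :: "prog list \<Rightarrow> nat list \<Rightarrow> prog list \<times> (nat \<times> direction) list" where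
  "ctl [] ss = ([], idle ss)"
| "ctl (Skip # K) ss = (K, idle ss)"
| "ctl (Move i d # K) ss = (K, (idle ss)[i := (ss ! i, d)])"
| "ctl (Write i s # K) ss = (K, (idle ss)[i := (s, Stay)])"
| "ctl ((P ;; Q) # K) ss = (P # Q # K, idle ss)"
| "ctl (Branch i S P Q # K) ss = ((if ss ! i \<in> S then P else Q) # K, idle ss)"
| "ctl (While i S P # K) ss = (if ss ! i \<in> S then P # While i S P # K else K, idle ss)"

lemma finite_conts: "finite (conts P K)"
  by (induction P arbitrary: K) auto

lemma Cons_in_conts: "P # K \<in> conts P K"
  by (cases P) auto

text \<open>This closure is what makes a finite state set sufficient. A \<open>While\<close> pushes
  itself below its body, but always on top of the same \<open>K\<close>, so repeated iterations do
  not lengthen the continuation. \<open>K\<close> itself appears because finishing the last piece of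
  \<open>P\<close> pops down to it.\<close>

lemma ctl_in_conts:
  "c \<in> conts P K \<Longrightarrow> fst (ctl c ss) \<in> insert K (conts P K)"
proof (induction P arbitrary: K)
  case (Seq P Q)
  from Seq.prems consider "c = (P ;; Q) # K" | "c \<in> conts P (Q # K)" | "c \<in> conts Q K" by auto
  then show ?case
    using Cons_in_conts[of P "Q # K"] Cons_in_conts[of Q K]
      Seq.IH(1)[of "Q # K"] Seq.IH(2)[of K] by cases auto
next
  case (Branch i S P Q)
  from Branch.prems consider "c = Branch i S P Q # K" | "c \<in> conts P K" | "c \<in> conts Q K" by auto
  then show ?case
    using Cons_in_conts[of P K] Cons_in_conts[of Q K] Branch.IH(1)[of K] Branch.IH(2)[of K]
    by cases auto
next
  case (While i S P)
  from While.prems consider "c = While i S P # K" | "c \<in> conts P (While i S P # K)" by auto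
  then show ?case
    using Cons_in_conts[of P "While i S P # K"] While.IH[of "While i S P # K"]
    by cases auto
qed auto

lemma wf_conts:
  "wf_prog m P \<Longrightarrow> list_all (wf_prog m) K \<Longrightarrow> c \<in> conts P K \<Longrightarrow> list_all (wf_prog m) c"
proof (induction P arbitrary: K)
  case (Seq P Q)
  from Seq.prems(3) consider "c = (P ;; Q) # K" | "c \<in> conts P (Q # K)" | "c \<in> conts Q K" by auto
  then show ?case
  proof cases
    case 1
    then show ?thesis using Seq.prems by simp
  next
    case 2
    then show ?thesis by (rule Seq.IH(1)[rotated 2]) (use Seq.prems in simp_all)
  next
    case 3
    then show ?thesis by (rule Seq.IH(2)[rotated 2]) (use Seq.prems in simp_all)
  qed
next
  case (Branch i S P Q)
  from Branch.prems(3) consider "c = Branch i S P Q # K" | "c \<in> conts P K" | "c \<in> conts Q K" by auto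
  then show ?case
  proof cases
    case 1
    then show ?thesis using Branch.prems by simp
  next
    case 2
    then show ?thesis by (rule Branch.IH(1)[rotated 2]) (use Branch.prems in simp_all)
  next
    case 3
    then show ?thesis by (rule Branch.IH(2)[rotated 2]) (use Branch.prems in simp_all)
  qed
next
  case (While i S P)
  from While.prems(3) consider "c = While i S P # K" | "c \<in> conts P (While i S P # K)" by auto
  then show ?case
  proof cases
    case 1
    then show ?thesis using While.prems by simp
  next
    case 2
    then show ?thesis by (rule While.IH[rotated 2]) (use While.prems in simp_all)
  qed
qed auto

lemma length_idle [simp]: "length (idle ss) = length ss"
  by (simp add: idle_def)

lemma fst_set_idle_update:
  "set ss \<subseteq> A \<Longrightarrow> s \<in> A \<Longrightarrow> fst ` set ((idle ss)[i := (s, d)]) \<subseteq> A"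
  using set_update_subset_insert[of "idle ss" i "(s, d)"] by (fastforce simp: idle_def)

lemma fst_set_idle: "set ss \<subseteq> A \<Longrightarrow> fst ` set (idle ss) \<subseteq> A"
  by (auto simp: idle_def)

lemma length_ctl [simp]: "length (snd (ctl c ss)) = length ss"
  by (cases "(c, ss)" rule: ctl.cases) auto

lemma ctl_symbols:
  assumes "list_all (wf_prog (length ss)) c" "set ss \<subseteq> {..<3}"
  shows "fst ` set (snd (ctl c ss)) \<subseteq> {..<3}"
proof (cases "(c, ss)" rule: ctl.cases)
  case (3 i d K ss')
  with assms have "ss ! i \<in> set ss" by simp
  with assms(2) have "ss ! i \<in> {..<3}" by blast
  then show ?thesis using 3 fst_set_idle_update[OF assms(2)] by simp
next
  case (4 i s K ss')
  then show ?thesis using assms fst_set_idle_update[OF assms(2), of s i Stay] by simp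
qed (use fst_set_idle[OF assms(2)] in auto)

section \<open>The machine of a program and its simulation\<close>

context
  fixes m :: nat and P\<^sub>0 :: prog
begin

definition ctl_states :: "prog list set" where
  "ctl_states = insert [] (conts P\<^sub>0 [])"

definition enc :: "prog list \<Rightarrow> nat" where
  "enc = (SOME f. bij_betw f ctl_states {0..<card ctl_states})"

definition dec :: "nat \<Rightarrow> prog list" where
  "dec = the_inv_into ctl_states enc"

text \<open>When the program ends, tape 2 decides: symbol 2 means acceptance.\<close>

definition machine :: turing_machine where
  "machine = \<lparr> tm_tapes = m, tm_symbols = 3, tm_states = card ctl_states + 2,
     tm_start = enc [P\<^sub>0], tm_accept = card ctl_states, tm_reject = card ctl_states + 1,
     tm_delta = (\<lambda>q ss.
       if q < card ctl_states then
         if dec q = [] then (if ss ! 2 = 2 then card ctl_states else card ctl_states + 1, idle ss)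
         else (enc (fst (ctl (dec q) ss)), snd (ctl (dec q) ss))
       else (q, idle ss)) \<rparr>"

lemma enc_bij: "bij_betw enc ctl_states {0..<card ctl_states}"
  unfolding enc_def
  using someI_ex[OF ex_bij_betw_finite_nat[of ctl_states]]
  by (simp add: ctl_states_def finite_conts)

lemma enc_less: "c \<in> ctl_states \<Longrightarrow> enc c < card ctl_states"
  using enc_bij by (auto simp: bij_betw_def)

lemma dec_enc: "c \<in> ctl_states \<Longrightarrow> dec (enc c) = c"
  unfolding dec_def using enc_bij by (auto simp: bij_betw_def the_inv_into_f_f)

lemma dec_in: "q < card ctl_states \<Longrightarrow> dec q \<in> ctl_states"
  unfolding dec_def using bij_betwE[OF bij_betw_the_inv_into[OF enc_bij]] by auto

lemma ctl_in_states: "c \<in> ctl_states \<Longrightarrow> fst (ctl c ss) \<in> ctl_states"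
  using ctl_in_conts[of c P\<^sub>0 "[]" ss] by (auto simp: ctl_states_def)

lemma start_in_states: "[P\<^sub>0] \<in> ctl_states"
  by (simp add: ctl_states_def Cons_in_conts)

lemma wf_machine:
  assumes m: "m \<ge> 2" and wf: "wf_prog m P\<^sub>0"
  shows "wf_tm machine"
proof -
  have *: "list_all (wf_prog m) c" if "c \<in> ctl_states" for c
    using that wf_conts[OF wf, of "[]" c] by (auto simp: ctl_states_def)
  have d: "list_all (wf_prog m) (dec q)" if "q < card ctl_states" for q
    using * dec_in that by blast
  show ?thesis
    unfolding wf_tm_def
  proof (intro conjI allI impI)
    fix q ss assume q: "q < tm_states machine"
      and ss: "length ss = tm_tapes machine \<and> set ss \<subseteq> {..<tm_symbols machine}"
    have ss': "length ss = m" "set ss \<subseteq> {..<3}" using ss by (auto simp: machine_def)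
    have en: "enc (fst (ctl (dec q) ss)) < card ctl_states + 2" if "q < card ctl_states"
      using enc_less[OF ctl_in_states[OF dec_in[OF that]], of ss] by simp
    have "fst ` set (snd (ctl (dec q) ss)) \<subseteq> {..<3}" if "q < card ctl_states"
      using ctl_symbols[of ss "dec q"] d[OF that] ss' by simp
    with en q ss' fst_set_idle[OF ss'(2)]
    show "case tm_delta machine q ss of (q', acts) \<Rightarrow> q' < tm_states machine \<and>
       length acts = tm_tapes machine \<and> fst ` set acts \<subseteq> {..<tm_symbols machine}"
      by (simp add: machine_def)
  qed (use m enc_less[OF start_in_states] in \<open>auto simp: machine_def\<close>)
qed

abbreviation conf :: "prog list \<Rightarrow> (nat \<Rightarrow> tape) \<Rightarrow> configuration" where
  "conf c T \<equiv> (enc c, map T [0..<m])"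

lemma act_read_Stay [simp]: "act_tape (read_tape t, Stay) t = t"
  by (cases t) simp

lemma act_idle: "map2 act_tape (idle (map read_tape ts)) ts = ts"
  by (intro nth_equalityI) (simp_all add: idle_def)

lemma act_idle_update:
  assumes "i < m"
  shows "map2 act_tape ((idle (map read_tape (map T [0..<m])))[i := a]) (map T [0..<m])
    = map (T(i := act_tape a (T i))) [0..<m]"
  using assms by (intro nth_equalityI) (simp_all add: idle_def nth_list_update)

lemma tm_step_conf:
  assumes "c \<in> ctl_states" "c \<noteq> []"
  shows "tm_step machine (conf c T) =
    (enc (fst (ctl c (map read_tape (map T [0..<m])))),
     map2 act_tape (snd (ctl c (map read_tape (map T [0..<m])))) (map T [0..<m]))"
  using enc_less[OF assms(1)] assms
  by (simp add: tm_step_def halted_def machine_def dec_enc split: prod.split)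

lemma funpow_chain: "f x = y \<Longrightarrow> (f ^^ a) y = z \<Longrightarrow> (f ^^ b) z = w \<Longrightarrow> (f ^^ Suc (b + a)) x = w"
  by (simp add: funpow_Suc_right funpow_add del: funpow.simps)

text \<open>Induction over the execution with an arbitrary continuation \<open>K\<close>: in a
  sequence the first program runs on top of \<open>Q # K\<close>, and in a loop the body runs on top
  of the loop itself. Each compound case is one unfolding step followed by the runs of the
  parts.\<close>

lemma exec_tm:
  assumes "exec P T t T'" "wf_prog m P" "conts P K \<subseteq> ctl_states" "K \<in> ctl_states"
  shows "\<exists>t'\<le>t. (tm_step machine ^^ t') (conf (P # K) T) = conf K T'"
  using assms
proof (induction arbitrary: K rule: exec.induct)
  case (Skip T t)
  have "tm_step machine (conf (prog.Skip # K) T) = conf K T"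
    using Skip by (subst tm_step_conf) (auto simp: act_idle simp del: map_map)
  then show ?case by (intro exI[of _ 1]) auto
next
  case (Move i d T t)
  have "tm_step machine (conf (prog.Move i d # K) T) =
     conf K (T(i := (fst (T i), move_head d (snd (T i)))))"
    using Move act_idle_update[of i T "(read_tape (T i), d)"]
    by (subst tm_step_conf; cases "T i") (auto simp del: map_map)
  then show ?case by (intro exI[of _ 1]) auto
next
  case (Write i s T t)
  have "tm_step machine (conf (prog.Write i s # K) T) =
     conf K (T(i := ((fst (T i))(snd (T i) := s), snd (T i))))"
    using Write act_idle_update[of i T "(s, Stay)"]
    by (subst tm_step_conf; cases "T i") (auto simp del: map_map)
  then show ?case by (intro exI[of _ 1]) auto
next
  case (Seq P T t T' Q t' T'' n)
  have wf: "wf_prog m P" "wf_prog m Q" and PK: "conts P (Q # K) \<subseteq> ctl_states"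
    and QK: "conts Q K \<subseteq> ctl_states" "Q # K \<in> ctl_states"
    using Seq.prems Cons_in_conts[of Q K] by auto
  obtain a where a: "a \<le> t" "(tm_step machine ^^ a) (conf (P # Q # K) T) = conf (Q # K) T'"
    using Seq.IH(1)[OF wf(1) PK QK(2)] by (elim exE conjE)
  obtain b where b: "b \<le> t'" "(tm_step machine ^^ b) (conf (Q # K) T') = conf K T''"
    using Seq.IH(2)[OF wf(2) QK(1) Seq.prems(3)] by (elim exE conjE)
  have s: "tm_step machine (conf ((P ;; Q) # K) T) = conf (P # Q # K) T"
    using Seq.prems by (subst tm_step_conf) (simp_all add: act_idle del: map_map)
  show ?case
    using funpow_chain[OF s a(2) b(2)] a(1) b(1) Seq.hyps(3) by (intro exI[of _ "Suc (b + a)"]) simp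
next
  case (BranchT T i S P t T' n Q)
  have wf: "wf_prog m P" and PK: "conts P K \<subseteq> ctl_states" using BranchT.prems by auto
  obtain a where a: "a \<le> t" "(tm_step machine ^^ a) (conf (P # K) T) = conf K T'"
    using BranchT.IH[OF wf PK BranchT.prems(3)] by (elim exE conjE)
  have s: "tm_step machine (conf (Branch i S P Q # K) T) = conf (P # K) T"
    using BranchT.prems BranchT.hyps(1) by (subst tm_step_conf) (simp_all add: act_idle del: map_map)
  show ?case
    using funpow_chain[OF s a(2) funpow_0] a(1) BranchT.hyps(3) by (intro exI[of _ "Suc (0 + a)"]) simp
next
  case (BranchF T i S Q t T' n P)
  have wf: "wf_prog m Q" and PK: "conts Q K \<subseteq> ctl_states" using BranchF.prems by auto
  obtain a where a: "a \<le> t" "(tm_step machine ^^ a) (conf (Q # K) T) = conf K T'"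
    using BranchF.IH[OF wf PK BranchF.prems(3)] by (elim exE conjE)
  have s: "tm_step machine (conf (Branch i S P Q # K) T) = conf (Q # K) T"
    using BranchF.prems BranchF.hyps(1) by (subst tm_step_conf) (simp_all add: act_idle del: map_map)
  show ?case
    using funpow_chain[OF s a(2) funpow_0] a(1) BranchF.hyps(3) by (intro exI[of _ "Suc (0 + a)"]) simp
next
  case (WhileF T i S P t)
  have "tm_step machine (conf (While i S P # K) T) = conf K T"
    using WhileF by (subst tm_step_conf) (auto simp: act_idle simp del: map_map)
  then show ?case by (intro exI[of _ 1]) auto
next
  case (WhileT T i S P t T' t' T'' n)
  let ?W = "While i S P"
  have wf: "wf_prog m P" and PK: "conts P (?W # K) \<subseteq> ctl_states" and WK: "?W # K \<in> ctl_states"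
    using WhileT.prems by simp_all
  obtain a where a: "a \<le> t" "(tm_step machine ^^ a) (conf (P # ?W # K) T) = conf (?W # K) T'"
    using WhileT.IH(1)[OF wf PK WK] by (elim exE conjE)
  obtain b where b: "b \<le> t'" "(tm_step machine ^^ b) (conf (?W # K) T') = conf K T''"
    using WhileT.IH(2)[OF WhileT.prems] by (elim exE conjE)
  have s: "tm_step machine (conf (?W # K) T) = conf (P # ?W # K) T"
    using WK WhileT.hyps(1) WhileT.prems(1)
    by (subst tm_step_conf) (simp_all add: act_idle del: map_map)
  show ?case
    using funpow_chain[OF s a(2) b(2)] a(1) b(1) WhileT.hyps(4) by (intro exI[of _ "Suc (b + a)"]) simp
qed

lemma tm_step_halted: "halted M c \<Longrightarrow> (tm_step M ^^ t) c = c"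
  by (induction t) (auto simp: tm_step_def)

text \<open>One step beyond the program is needed to inspect tape 2 and enter a halting state, hence
  the strict \<open>n > t\<close>. A halted configuration is a fixed point of
  \<open>tm_step\<close>, so acceptance at some time is the same as acceptance in that final
  state.\<close>

lemma machine_run:
  assumes m: "m \<ge> 3" and wf: "wf_prog m P\<^sub>0"
    and T: "tm_init machine x u = conf [P\<^sub>0] T" and ex: "exec P\<^sub>0 T t T'"
  shows "\<forall>n>t. halted machine (tm_run machine x u n)"
    and "tm_accepts machine x u \<longleftrightarrow> read_tape (T' 2) = 2"
proof -
  obtain a where a: "a \<le> t" "(tm_step machine ^^ a) (conf [P\<^sub>0] T) = conf [] T'"
    using exec_tm[OF ex wf, of "[]"] by (auto simp: ctl_states_def)
  let ?q = "if read_tape (T' 2) = 2 then card ctl_states else card ctl_states + 1"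
  have nil: "[] \<in> ctl_states" by (simp add: ctl_states_def)
  have "tm_step machine (conf [] T') = (?q, map T' [0..<m])"
  proof -
    have "map read_tape (map T' [0..<m]) ! 2 = read_tape (T' 2)" using m by (simp add: numeral_2_eq_2)
    then have "tm_delta machine (enc []) (map read_tape (map T' [0..<m]))
        = (?q, idle (map read_tape (map T' [0..<m])))"
      using enc_less[OF nil] dec_enc[OF nil] by (simp add: machine_def del: map_map)
    moreover have "\<not> halted machine (conf [] T')"
      using enc_less[OF nil] by (simp add: halted_def machine_def)
    ultimately show ?thesis
      by (simp add: tm_step_def act_idle del: map_map)
  qed
  then have fin: "tm_run machine x u (Suc a) = (?q, map T' [0..<m])"
    using a T by (simp add: tm_run_def)
  have hlt: "halted machine (?q, map T' [0..<m])" by (simp add: halted_def machine_def)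
  have later: "tm_run machine x u n = (?q, map T' [0..<m])" if "n > a" for n
  proof -
    have "tm_step machine ^^ n = (tm_step machine ^^ (n - Suc a)) \<circ> (tm_step machine ^^ Suc a)"
      using that by (subst funpow_add[symmetric]) simp
    then have "tm_run machine x u n = (tm_step machine ^^ (n - Suc a)) (tm_run machine x u (Suc a))"
      unfolding tm_run_def by (simp only: comp_apply)
    then show ?thesis using fin tm_step_halted[OF hlt] by simp
  qed
  show "\<forall>n>t. halted machine (tm_run machine x u n)"
  proof (intro allI impI)
    fix n assume "n > t"
    then have "n > a" using a(1) by linarith
    then show "halted machine (tm_run machine x u n)" using hlt by (simp only: later)
  qed
  show "tm_accepts machine x u \<longleftrightarrow> read_tape (T' 2) = 2"
  proof
    assume "read_tape (T' 2) = 2"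
    then show "tm_accepts machine x u"
      unfolding tm_accepts_def using fin by (intro exI[of _ "Suc a"]) (simp add: machine_def)
  next
    assume "tm_accepts machine x u"
    then obtain n where n: "fst (tm_run machine x u n) = tm_accept machine"
      unfolding tm_accepts_def by blast
    then have h: "halted machine (tm_run machine x u n)" by (simp add: halted_def)
    have "tm_run machine x u (Suc a + n) = (tm_step machine ^^ Suc a) (tm_run machine x u n)"
      unfolding tm_run_def by (simp only: funpow_add comp_apply)
    then have "tm_run machine x u (Suc a + n) = tm_run machine x u n"
      using tm_step_halted[OF h] by (simp only:)
    then have "tm_accept machine = ?q" using n later[of "Suc a + n"] by simp
    then show "read_tape (T' 2) = 2" by (auto simp: machine_def split: if_splits)
  qed
qed

end

section \<open>Polynomial time bounds\<close>

definition polyb :: "(nat \<Rightarrow> nat) \<Rightarrow> bool" where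
  "polyb f \<longleftrightarrow> (\<exists>q :: nat poly. \<forall>n. f n = poly q n)"

lemma polyb_const: "polyb (\<lambda>n. c)"
  unfolding polyb_def by (rule exI[of _ "[:c:]"]) simp

lemma polyb_id: "polyb (\<lambda>n. n)"
  unfolding polyb_def by (rule exI[of _ "[:0, 1:]"]) simp

lemma polyb_add: "polyb f \<Longrightarrow> polyb g \<Longrightarrow> polyb (\<lambda>n. f n + g n)"
  unfolding polyb_def by (metis poly_add)

lemma polyb_mult: "polyb f \<Longrightarrow> polyb g \<Longrightarrow> polyb (\<lambda>n. f n * g n)"
  unfolding polyb_def by (metis poly_mult)

lemmas polyb_intros = polyb_const polyb_id polyb_add polyb_mult

text \<open>Needed because \<open>polynomial_time\<close> asks for halting at a polynomial in both
  lengths, while the evaluator is timed by the input length alone.\<close>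

lemma poly_nat_mono: "m \<le> n \<Longrightarrow> poly p m \<le> poly (p :: nat poly) n"
  by (induction p) (auto intro!: add_mono mult_mono)

lemma exec_mono: "exec P T t T' \<Longrightarrow> t \<le> n \<Longrightarrow> exec P T n T'"
proof (induction arbitrary: n rule: exec.induct)
  case (Skip T t)
  then obtain k where "n = Suc k" using Suc_le_D by blast
  then show ?case by (simp only: exec.Skip)
next
  case (Move i d T t)
  then obtain k where "n = Suc k" using Suc_le_D by blast
  then show ?case by (simp only: exec.Move)
next
  case (Write i s T t)
  then obtain k where "n = Suc k" using Suc_le_D by blast
  then show ?case by (simp only: exec.Write)
next
  case (Seq P T t T' Q t' T'' m)
  show ?case by (rule exec.Seq[OF Seq.hyps(1,2)]) (use Seq in simp)
next
  case (BranchT T i S P t T' m Q)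
  show ?case by (rule exec.BranchT[OF BranchT.hyps(1,2)]) (use BranchT in simp)
next
  case (BranchF T i S Q t T' m P)
  show ?case by (rule exec.BranchF[OF BranchF.hyps(1,2)]) (use BranchF in simp)
next
  case (WhileF T i S P t)
  then obtain k where "n = Suc k" using Suc_le_D by blast
  then show ?case using WhileF.hyps by (simp add: exec.WhileF)
next
  case (WhileT T i S P t T' t' T'' m)
  show ?case by (rule exec.WhileT[OF WhileT.hyps(1-3)]) (use WhileT in simp)
qed

lemma exec_Skip: "T' = T \<Longrightarrow> exec Skip T 1 T'"
  using exec.Skip[of T 0] by simp

lemma exec_Move: "T' = T(i := (fst (T i), move_head d (snd (T i)))) \<Longrightarrow> exec (Move i d) T 1 T'"
  using exec.Move[of i d T 0] by simp

lemma exec_Write: "T' = T(i := ((fst (T i))(snd (T i) := s), snd (T i))) \<Longrightarrow> exec (Write i s) T 1 T'"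
  using exec.Write[of i s T 0] by simp

lemma exec_Seq: "exec P T t T' \<Longrightarrow> exec Q T' t' T'' \<Longrightarrow> exec (P ;; Q) T (t + t' + 1) T''"
  by (erule exec.Seq) auto

lemma exec_Branch:
  "(read_tape (T i) \<in> S \<Longrightarrow> exec P T t T') \<Longrightarrow> (read_tape (T i) \<notin> S \<Longrightarrow> exec Q T t T')
   \<Longrightarrow> exec (Branch i S P Q) T (t + 1) T'"
  by (cases "read_tape (T i) \<in> S") (auto intro: exec.intros)

lemma exec_WhileF: "read_tape (T i) \<notin> S \<Longrightarrow> T' = T \<Longrightarrow> exec (While i S P) T 1 T'"
  using exec.WhileF[of T i S P 0] by simp

lemma exec_WhileT:
  "read_tape (T i) \<in> S \<Longrightarrow> exec P T t T' \<Longrightarrow> exec (While i S P) T' t' T''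
   \<Longrightarrow> exec (While i S P) T (t + t' + 1) T''"
  by (erule exec.WhileT) auto

section \<open>Loops over unary counters\<close>

text \<open>A counter with range \<open>{0..N}\<close> and value \<open>v\<close> is kept as the tape content \<open>1\<^sup>v 2\<^bsup>N-v\<^esup>\<close>.\<close>

definition unary :: "nat \<Rightarrow> nat \<Rightarrow> int \<Rightarrow> nat" where
  "unary N v = (\<lambda>p. if 0 \<le> p \<and> p < int N then (if p < int v then 1 else 2) else 0)"

text \<open>The head may stand on the blank just behind the counter, where the loop would stop at
  once. The move in front brings it onto the counter or to the blank at position -1.\<close>

definition go_home :: "nat \<Rightarrow> prog" where
  "go_home i = Move i Left ;; While i {1, 2} (Move i Left) ;; Move i Right"

definition For :: "nat \<Rightarrow> prog \<Rightarrow> prog" where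
  "For i P = While i {1} (P ;; Move i Right) ;; go_home i"

lemma exec_go_home:
  assumes T: "T i = (t, int p)" and t: "\<forall>q. 0 \<le> q \<and> q < int p \<longrightarrow> t q \<in> {1, 2}" and t0: "t (-1) = 0"
  shows "exec (go_home i) T (3 * p + 10) (T(i := (t, 0)))"
proof -
  have loop: "exec (While i {1, 2} (Move i Left)) T (2 * q + 1) (T(i := (t, -1)))"
    if "T i = (t, int q - 1)" "q \<le> p" for T q
    using that
  proof (induction q arbitrary: T)
    case 0
    show ?case by (rule exec_mono, rule exec_WhileF) (use 0 t0 in auto)
  next
    case (Suc q)
    let ?T = "T(i := (t, int q - 1))"
    have "read_tape (T i) \<in> {1, 2}" using Suc.prems t by simp
    moreover have "exec (Move i Left) T 1 ?T" by (rule exec_Move) (use Suc.prems in simp)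
    moreover have "exec (While i {1, 2} (Move i Left)) ?T (2 * q + 1) (?T(i := (t, -1)))"
      by (rule Suc.IH) (use Suc.prems in auto)
    ultimately have "exec (While i {1, 2} (Move i Left)) T (1 + (2 * q + 1) + 1) (?T(i := (t, -1)))"
      by (rule exec_WhileT)
    then show ?case by (simp del: fun_upd_apply)
  qed
  let ?T1 = "T(i := (t, int p - 1))" and ?T2 = "T(i := (t, -1))" and ?T3 = "T(i := (t, 0))"
  have "exec (Move i Left) T 1 ?T1" by (rule exec_Move) (use T in simp)
  moreover have "exec (While i {1, 2} (Move i Left)) ?T1 (2 * p + 1) ?T2"
    using loop[of ?T1 p] by simp
  moreover have "exec (Move i Right) ?T2 1 ?T3" by (rule exec_Move) simp
  ultimately have "exec (go_home i) T (1 + (2 * p + 1 + 1 + 1) + 1) ?T3"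
    unfolding go_home_def by (intro exec_Seq)
  then show ?thesis by (rule exec_mono) simp
qed

definition ready :: "nat \<Rightarrow> (nat \<Rightarrow> nat) \<Rightarrow> nat set \<Rightarrow> (nat \<Rightarrow> tape) \<Rightarrow> bool" where
  "ready N W A T \<longleftrightarrow> (\<forall>j \<in> A. T j = (unary N (W j), 0) \<and> W j \<le> N)"

lemma ready_mono: "ready N W A T \<Longrightarrow> B \<subseteq> A \<Longrightarrow> ready N W B T"
  by (auto simp: ready_def)

lemma ready_upd: "ready N W A T \<Longrightarrow> i \<notin> A \<Longrightarrow> ready N W A (T(i := z))"
  by (auto simp: ready_def)

text \<open>Programs that merely navigate change nothing except the position of one head. Their
  effect is thus a single integer, which adds up under sequencing and is multiplied by the counter
  value under \<open>For\<close>.\<close>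

definition shift :: "nat \<Rightarrow> int \<Rightarrow> (nat \<Rightarrow> tape) \<Rightarrow> (nat \<Rightarrow> tape)" where
  "shift h k T = T(h := (fst (T h), snd (T h) + k))"

text \<open>Head \<open>i\<close> walks over the cells of its own counter while the loop runs, so
  the body may rely only on the tapes in \<open>A\<close>, which excludes \<open>i\<close>;
  \<open>go_home\<close> restores the head at the end.\<close>

lemma exec_For:
  assumes P: "\<And>T. ready N W A T \<Longrightarrow> exec P T B (shift h k T)"
    and T: "ready N W (insert i A) T" and i: "i \<notin> A" "i \<noteq> h" "h \<notin> A"
  shows "exec (For i P) T (N * (B + 6) + 20) (shift h (int (W i) * k) T)"
proof -
  have loop: "exec (While i {1} (P ;; Move i Right)) T (q * (B + 3) + 1)
      (shift h (int q * k) (T(i := (unary N (W i), int (W i)))))"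
    if "ready N W A T" "T i = (unary N (W i), int (W i - q))" "q \<le> W i" for T q
    using that
  proof (induction q arbitrary: T)
    case 0
    show ?case by (rule exec_mono, rule exec_WhileF) (use 0 in \<open>auto simp: unary_def shift_def\<close>)
  next
    case (Suc q)
    have Wi: "W i \<le> N" using T by (auto simp: ready_def)
    have eq: "shift h (int (Suc q) * k) (T(i := (unary N (W i), int (W i))))
      = shift h (int q * k) ((shift h k T)(i := (unary N (W i), int (W i - q)),
          i := (unary N (W i), int (W i))))"
      using i by (auto simp: shift_def algebra_simps fun_eq_iff)
    let ?T = "(shift h k T)(i := (unary N (W i), int (W i - q)))"
    have "read_tape (T i) \<in> {1}" using Suc.prems Wi by (auto simp: unary_def)
    moreover have "exec (P ;; Move i Right) T (B + 1 + 1) ?T"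
      by (rule exec_Seq[OF P[OF Suc.prems(1)] exec_Move])
         (use Suc.prems i in \<open>auto simp: shift_def\<close>)
    moreover have "exec (While i {1} (P ;; Move i Right)) ?T (q * (B + 3) + 1)
        (shift h (int q * k) (?T(i := (unary N (W i), int (W i)))))"
    proof (rule Suc.IH)
      show "ready N W A ?T" unfolding shift_def using i Suc.prems(1) by (intro ready_upd)
    qed (use Suc.prems in auto)
    ultimately have "exec (While i {1} (P ;; Move i Right)) T (B + 1 + 1 + (q * (B + 3) + 1) + 1)
        (shift h (int q * k) (?T(i := (unary N (W i), int (W i)))))"
      by (rule exec_WhileT)
    then show ?case unfolding eq by (rule exec_mono) simp
  qed
  have Ti: "T i = (unary N (W i), 0)" and Wi: "W i \<le> N" using T by (auto simp: ready_def)
  have "exec (While i {1} (P ;; Move i Right)) T (W i * (B + 3) + 1)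
      (shift h (int (W i) * k) (T(i := (unary N (W i), int (W i)))))" (is "exec _ _ _ ?T'")
    by (rule loop) (use T Ti in \<open>auto simp: ready_def\<close>)
  moreover have "exec (go_home i) ?T' (3 * W i + 10) (?T'(i := (unary N (W i), 0)))"
    by (rule exec_go_home) (use Wi i in \<open>auto simp: unary_def shift_def\<close>)
  moreover have "?T'(i := (unary N (W i), 0)) = shift h (int (W i) * k) T"
    using Ti i by (auto simp: shift_def fun_eq_iff)
  ultimately have "exec (For i P) T (W i * (B + 3) + 1 + (3 * W i + 10) + 1) (shift h (int (W i) * k) T)"
    unfolding For_def by (metis exec_Seq)
  then show ?thesis
  proof (rule exec_mono)
    have "W i * (B + 3) + 1 + (3 * W i + 10) + 1 = W i * (B + 6) + 12" by (simp add: algebra_simps)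
    also have "\<dots> \<le> N * (B + 6) + 20" using Wi by (intro add_mono mult_mono) auto
    finally show "W i * (B + 3) + 1 + (3 * W i + 10) + 1 \<le> N * (B + 6) + 20" .
  qed
qed

text \<open>Tapes 3 to 6 hold counters with the constant value \<open>N\<close>.\<close>

definition shifter :: "nat \<Rightarrow> nat set \<Rightarrow> prog \<Rightarrow> (nat \<Rightarrow> (nat \<Rightarrow> nat) \<Rightarrow> int) \<Rightarrow> bool" where
  "shifter h A P k \<longleftrightarrow> (\<exists>f. polyb f \<and> (\<forall>N W T. (\<forall>j \<in> {3..<7}. W j = N) \<longrightarrow> ready N W A T \<longrightarrow>
     exec P T (f N) (shift h (k N W) T)))"

lemma shifter_mono: "shifter h A P k \<Longrightarrow> A \<subseteq> B \<Longrightarrow> shifter h B P k"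
  unfolding shifter_def by (meson ready_mono)

definition sgd :: "direction \<Rightarrow> int" where
  "sgd d = move_head d 0"

lemma move_head_sgd: "move_head d p = p + sgd d"
  by (cases d) (auto simp: sgd_def)

lemma shifter_Move: "shifter h {} (Move h d) (\<lambda>N W. sgd d)"
  unfolding shifter_def shift_def
  by (intro exI[of _ "\<lambda>n. 1"] conjI allI impI polyb_intros exec_Move) (simp add: move_head_sgd)

lemma shifter_Skip: "shifter h {} Skip (\<lambda>N W. 0)"
  unfolding shifter_def shift_def
  by (intro exI[of _ "\<lambda>n. 1"] conjI allI impI polyb_intros exec_Skip) simp

lemma shifter_Seq:
  assumes "shifter h A P k" "shifter h A Q l" "h \<notin> A"
  shows "shifter h A (P ;; Q) (\<lambda>N W. k N W + l N W)"
proof -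
  from assms obtain f g where f: "polyb f" "\<And>N W T. (\<forall>j \<in> {3..<7}. W j = N) \<Longrightarrow> ready N W A T \<Longrightarrow>
     exec P T (f N) (shift h (k N W) T)"
    and g: "polyb g" "\<And>N W T. (\<forall>j \<in> {3..<7}. W j = N) \<Longrightarrow> ready N W A T \<Longrightarrow>
     exec Q T (g N) (shift h (l N W) T)" unfolding shifter_def by metis
  show ?thesis
    unfolding shifter_def
  proof (intro exI[of _ "\<lambda>N. f N + g N + 1"] conjI allI impI)
    show "polyb (\<lambda>N. f N + g N + 1)" by (intro polyb_intros f g)
    fix N W T assume *: "\<forall>j \<in> {3..<7}. W j = N" "ready N W A T"
    have "ready N W A (shift h (k N W) T)"
      unfolding shift_def using * assms(3) by (intro ready_upd)
    then have "exec Q (shift h (k N W) T) (g N) (shift h (l N W) (shift h (k N W) T))"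
      by (rule g(2)[OF *(1)])
    moreover have "shift h (l N W) (shift h (k N W) T) = shift h (k N W + l N W) T"
      by (auto simp: shift_def)
    ultimately show "exec (P ;; Q) T (f N + g N + 1) (shift h (k N W + l N W) T)"
      using f(2)[OF *] exec_Seq by metis
  qed
qed

lemma shifter_For:
  assumes "shifter h A P k" "i \<notin> A" "i \<noteq> h" "h \<notin> A"
  shows "shifter h (insert i A) (For i P) (\<lambda>N W. int (W i) * k N W)"
proof -
  from assms obtain f where f: "polyb f" "\<And>N W T. (\<forall>j \<in> {3..<7}. W j = N) \<Longrightarrow> ready N W A T \<Longrightarrow>
     exec P T (f N) (shift h (k N W) T)" unfolding shifter_def by metis
  show ?thesis
    unfolding shifter_def
  proof (intro exI[of _ "\<lambda>N. N * (f N + 6) + 20"] conjI allI impI)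
    show "polyb (\<lambda>N. N * (f N + 6) + 20)" by (intro polyb_intros f)
    fix N W T assume *: "\<forall>j \<in> {3..<7}. W j = N" "ready N W (insert i A) T"
    show "exec (For i P) T (N * (f N + 6) + 20) (shift h (int (W i) * k N W) T)"
      by (rule exec_For) (use f * assms in auto)
  qed
qed

section \<open>Moving a head to an address in base N + 8\<close>

fun iter :: "nat \<Rightarrow> prog \<Rightarrow> prog" where
  "iter 0 P = Skip"
| "iter (Suc n) P = P ;; iter n P"

lemma shifter_iter:
  assumes "shifter h A P k" "h \<notin> A"
  shows "shifter h A (iter n P) (\<lambda>N W. int n * k N W)"
proof (induction n)
  case 0
  show ?case using shifter_mono[OF shifter_Skip] by simp
next
  case (Suc n)
  then show ?case using shifter_Seq[OF assms(1) Suc assms(2)] by (simp add: algebra_simps)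
qed

text \<open>Each level repeats the program below it \<open>N + 8\<close> times: \<open>N\<close>
  times by a loop over a constant counter and 8 times by unrolling. Nested loops need separate
  counters, hence tape \<open>3 + e\<close>; four of them suffice for an address of five
  digits.\<close>

fun rep :: "nat \<Rightarrow> prog \<Rightarrow> prog" where
  "rep 0 P = P"
| "rep (Suc e) P = For (3 + e) (rep e P) ;; iter 8 (rep e P)"

lemma shifter_cong:
  "shifter h A P k \<Longrightarrow> (\<And>N W. \<forall>j \<in> {3..<7}. W j = N \<Longrightarrow> k N W = l N W) \<Longrightarrow> shifter h A P l"
  unfolding shifter_def by metis

lemma shifter_rep:
  assumes "shifter h V P k" "V \<subseteq> {7..}" "h \<notin> V" "h \<notin> {3..<7}" "e \<le> 4"
  shows "shifter h ({3..<3 + e} \<union> V) (rep e P) (\<lambda>N W. int ((N + 8) ^ e) * k N W)"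
  using assms(5)
proof (induction e)
  case 0
  then show ?case using assms(1) by simp
next
  case (Suc e)
  let ?A = "{3..<3 + e} \<union> V" and ?k = "\<lambda>N W. int ((N + 8) ^ e) * k N W"
  have P: "shifter h ?A (rep e P) ?k" using Suc by simp
  have ins: "{3..<3 + Suc e} \<union> V = insert (3 + e) ?A" by auto
  have h: "h \<notin> insert (3 + e) ?A" using assms Suc.prems by auto
  have "shifter h (insert (3 + e) ?A) (For (3 + e) (rep e P)) (\<lambda>N W. int (W (3 + e)) * ?k N W)"
    by (rule shifter_For[OF P]) (use h assms(2) Suc.prems in auto)
  moreover have "shifter h (insert (3 + e) ?A) (iter 8 (rep e P)) (\<lambda>N W. int 8 * ?k N W)"
    by (rule shifter_iter[OF shifter_mono[OF P] h]) auto
  ultimately have "shifter h (insert (3 + e) ?A) (rep (Suc e) P)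
      (\<lambda>N W. int (W (3 + e)) * ?k N W + int 8 * ?k N W)"
    using shifter_Seq h by simp
  then show ?case
    unfolding ins
    by (rule shifter_cong) (use Suc.prems in \<open>simp add: algebra_simps\<close>)
qed

definition term_prog :: "nat \<Rightarrow> direction \<Rightarrow> nat \<times> nat \<Rightarrow> prog" where
  "term_prog h d = (\<lambda>(v, c). For (7 + v) (Move h d) ;; iter c (Move h d))"

lemma shifter_term_prog:
  assumes "h \<noteq> 7 + v"
  shows "shifter h {7 + v} (term_prog h d (v, c)) (\<lambda>N W. int (W (7 + v) + c) * sgd d)"
proof -
  have "shifter h {7 + v} (For (7 + v) (Move h d)) (\<lambda>N W. int (W (7 + v)) * sgd d)"
    using shifter_For[OF shifter_Move, of "7 + v" h] assms by simp
  moreover have "shifter h {7 + v} (iter c (Move h d)) (\<lambda>N W. int c * sgd d)"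
    using shifter_mono[OF shifter_iter[OF shifter_Move, of h]] by simp
  ultimately have "shifter h {7 + v} (term_prog h d (v, c))
      (\<lambda>N W. int (W (7 + v)) * sgd d + int c * sgd d)"
    unfolding term_prog_def prod.case by (rule shifter_Seq) (use assms in simp)
  then show ?thesis by (rule shifter_cong) (simp add: algebra_simps)
qed

fun address :: "nat \<Rightarrow> nat list \<Rightarrow> nat" where
  "address b [] = 0"
| "address b (a # as) = a * b ^ length as + address b as"

fun address_prog :: "nat \<Rightarrow> direction \<Rightarrow> (nat \<times> nat) list \<Rightarrow> prog" where
  "address_prog h d [] = Skip"
| "address_prog h d (t # ts) = rep (length ts) (term_prog h d t) ;; address_prog h d ts"

lemma shifter_address_prog:
  assumes "length ts \<le> 4" "h < 3"
  shows "shifter h ({3..<7} \<union> (\<lambda>t. 7 + fst t) ` set ts) (address_prog h d ts)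
    (\<lambda>N W. int (address (N + 8) (map (\<lambda>(v, c). W (7 + v) + c) ts)) * sgd d)"
  using assms(1)
proof (induction ts)
  case Nil
  show ?case using shifter_mono[OF shifter_Skip] by simp
next
  case (Cons t ts)
  obtain v c where t: "t = (v, c)" by force
  let ?A = "{3..<7} \<union> (\<lambda>t. 7 + fst t) ` set (t # ts)"
  have "shifter h ?A (rep (length ts) (term_prog h d t))
     (\<lambda>N W. int ((N + 8) ^ length ts) * (int (W (7 + v) + c) * sgd d))"
    by (rule shifter_mono[OF shifter_rep[OF shifter_term_prog[of h v d c, folded t]]])
       (use assms Cons.prems t in auto)
  moreover have "shifter h ?A (address_prog h d ts)
     (\<lambda>N W. int (address (N + 8) (map (\<lambda>(v, c). W (7 + v) + c) ts)) * sgd d)"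
    by (rule shifter_mono[OF Cons.IH]) (use Cons.prems in auto)
  ultimately have "shifter h ?A (address_prog h d (t # ts))
     (\<lambda>N W. int ((N + 8) ^ length ts) * (int (W (7 + v) + c) * sgd d)
       + int (address (N + 8) (map (\<lambda>(v, c). W (7 + v) + c) ts)) * sgd d)"
    unfolding address_prog.simps by (rule shifter_Seq) (use assms(2) in auto)
  then show ?case by (rule shifter_cong) (simp add: t algebra_simps)
qed

section \<open>Existential second-order definability implies membership in NP\<close>

text \<open>
  First-order formulas over the domain \<open>{0..length x}\<close>. The atom \<open>FSym s v c\<close> says that cell
  \<open>v + c\<close> of the input tape holds the tape symbol \<open>s\<close>; a pair \<open>(v, c)\<close> is the term \<open>v + c\<close>.
\<close>

datatype fm =
    FSym nat nat nat
  | FLess nat nat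
  | FRel nat "(nat \<times> nat) list"
  | FNot fm
  | FAnd fm fm
  | FAll nat fm

definition symb :: "bool list \<Rightarrow> nat \<Rightarrow> nat" where
  "symb x p = fst (word_tape x) (int p)"

fun sat :: "bool list \<Rightarrow> (nat \<Rightarrow> nat list \<Rightarrow> bool) \<Rightarrow> (nat \<Rightarrow> nat) \<Rightarrow> fm \<Rightarrow> bool" where
  "sat x R e (FSym s v c) \<longleftrightarrow> symb x (e v + c) = s"
| "sat x R e (FLess v w) \<longleftrightarrow> e v < e w"
| "sat x R e (FRel r ts) \<longleftrightarrow> R r (map (\<lambda>(v, c). e v + c) ts)"
| "sat x R e (FNot \<phi>) \<longleftrightarrow> \<not> sat x R e \<phi>"
| "sat x R e (FAnd \<phi> \<psi>) \<longleftrightarrow> sat x R e \<phi> \<and> sat x R e \<psi>"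
| "sat x R e (FAll v \<phi>) \<longleftrightarrow> (\<forall>a \<le> length x. sat x R (e(v := a)) \<phi>)"

fun vars :: "fm \<Rightarrow> nat set" where
  "vars (FSym s v c) = {v}"
| "vars (FLess v w) = {v, w}"
| "vars (FRel r ts) = fst ` set ts"
| "vars (FNot \<phi>) = vars \<phi>"
| "vars (FAnd \<phi> \<psi>) = vars \<phi> \<union> vars \<psi>"
| "vars (FAll v \<phi>) = insert v (vars \<phi>)"

fun bound_vars :: "fm \<Rightarrow> nat set" where
  "bound_vars (FNot \<phi>) = bound_vars \<phi>"
| "bound_vars (FAnd \<phi> \<psi>) = bound_vars \<phi> \<union> bound_vars \<psi>"
| "bound_vars (FAll v \<phi>) = insert v (bound_vars \<phi>)"
| "bound_vars _ = {}"

fun rels :: "fm \<Rightarrow> nat set" where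
  "rels (FRel r ts) = {r}"
| "rels (FNot \<phi>) = rels \<phi>"
| "rels (FAnd \<phi> \<psi>) = rels \<phi> \<union> rels \<psi>"
| "rels (FAll v \<phi>) = rels \<phi>"
| "rels _ = {}"

text \<open>What the evaluator needs: four arguments of at most \<open>N + 7\<close>, so that they
  are digits in base \<open>N + 8\<close> and the address of a relation atom is unambiguous; and no
  quantifier inside another one for the same variable, since each variable has a single
  tape.\<close>

fun wf_fm :: "fm \<Rightarrow> bool" where
  "wf_fm (FRel r ts) \<longleftrightarrow> length ts = 4 \<and> (\<forall>t \<in> set ts. snd t < 8)"
| "wf_fm (FNot \<phi>) \<longleftrightarrow> wf_fm \<phi>"
| "wf_fm (FAnd \<phi> \<psi>) \<longleftrightarrow> wf_fm \<phi> \<and> wf_fm \<psi>"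
| "wf_fm (FAll v \<phi>) \<longleftrightarrow> v \<notin> bound_vars \<phi> \<and> wf_fm \<phi>"
| "wf_fm _ \<longleftrightarrow> True"

lemma finite_vars: "finite (vars \<phi>)"
  by (induction \<phi>) auto

lemma finite_rels: "finite (rels \<phi>)"
  by (induction \<phi>) auto

section \<open>Evaluation of a formula on the tapes\<close>

text \<open>Tape 2 holds the truth value of the last evaluated subformula; variable \<open>v\<close> is on tape \<open>7 + v\<close>.\<close>

definition flag :: "nat \<Rightarrow> tape" where
  "flag s = ((\<lambda>p. 0)(0 := s), 0)"

definition seek :: "nat \<Rightarrow> prog" where
  "seek j = While j {1} (Move j Right)"

definition reset :: "nat \<Rightarrow> prog" where
  "reset j = Move j Left ;; While j {1, 2} (Write j 2 ;; Move j Left) ;; Move j Right"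

text \<open>Atoms follow one scheme: move a head to the relevant cell, set the flag from what it
  reads, undo the move. For \<open>FLess\<close> the head on the tape of \<open>w\<close> moves
  \<open>e v\<close> cells and sees a 1 exactly if \<open>e v < e w\<close>; this loop needs two
  different tapes, hence the special case. A quantifier uses the counter of its variable as the
  loop: value 0 is tested before the loop, and each iteration turns one more 2 into a 1.\<close>

fun compile :: "fm \<Rightarrow> prog" where
  "compile (FSym s v c) = term_prog 0 Right (v, c) ;; Branch 0 {s} (Write 2 2) (Write 2 1) ;; term_prog 0 Left (v, c)"
| "compile (FLess v w) = (if v = w then Write 2 1 else
    For (7 + v) (Move (7 + w) Right) ;; Branch (7 + w) {1} (Write 2 2) (Write 2 1) ;; For (7 + v) (Move (7 + w) Left))"
| "compile (FRel r ts) = (rep 4 (iter r (Move 1 Right)) ;; address_prog 1 Right ts) ;;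
    Branch 1 {2} (Write 2 2) (Write 2 1) ;; rep 4 (iter r (Move 1 Left)) ;; address_prog 1 Left ts"
| "compile (FNot \<phi>) = compile \<phi> ;; Branch 2 {2} (Write 2 1) (Write 2 2)"
| "compile (FAnd \<phi> \<psi>) = compile \<phi> ;; Branch 2 {2} (compile \<psi>) Skip"
| "compile (FAll v \<phi>) = Write 2 2 ;; Branch 2 {2} (compile \<phi>) Skip ;; seek (7 + v) ;;
    While (7 + v) {2} (Write (7 + v) 1 ;; go_home (7 + v) ;; Branch 2 {2} (compile \<phi>) Skip ;; seek (7 + v)) ;;
    reset (7 + v)"

definition truth :: "bool \<Rightarrow> tape" where
  "truth b = flag (if b then 2 else 1)"

lemma exec_Write_truth:
  "T 2 = flag s \<Longrightarrow> exec (Write 2 (if b then 2 else 1)) T 1 (T(2 := truth b))"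
  by (rule exec_Write) (simp add: flag_def truth_def)

lemma exec_probe:
  assumes P: "shifter h A P k" and Q: "shifter h A Q (\<lambda>N W. - k N W)" and h: "h \<notin> A" "h \<noteq> 2" "2 \<notin> A"
  shows "\<exists>f. polyb f \<and> (\<forall>N W T s. (\<forall>j \<in> {3..<7}. W j = N) \<longrightarrow> ready N W A T \<longrightarrow> T 2 = flag s \<longrightarrow>
    exec (P ;; Branch h S (Write 2 2) (Write 2 1) ;; Q) T (f N)
      (T(2 := truth (fst (T h) (snd (T h) + k N W) \<in> S))))"
proof -
  from P Q obtain f g where f: "polyb f" "\<And>N W T. (\<forall>j \<in> {3..<7}. W j = N) \<Longrightarrow> ready N W A T \<Longrightarrow>
     exec P T (f N) (shift h (k N W) T)"
    and g: "polyb g" "\<And>N W T. (\<forall>j \<in> {3..<7}. W j = N) \<Longrightarrow> ready N W A T \<Longrightarrow>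
     exec Q T (g N) (shift h (- k N W) T)" unfolding shifter_def by metis
  show ?thesis
  proof (intro exI[of _ "\<lambda>N. f N + (1 + 1 + g N + 1) + 1"] conjI allI impI)
    show "polyb (\<lambda>N. f N + (1 + 1 + g N + 1) + 1)" by (intro polyb_intros f g)
    fix N W T s assume *: "\<forall>j \<in> {3..<7}. W j = N" "ready N W A T" and T: "T 2 = flag s"
    let ?b = "fst (T h) (snd (T h) + k N W) \<in> S"
    let ?T = "shift h (k N W) T"
    have 2: "?T 2 = flag s" using T h by (simp add: shift_def)
    have "exec (Branch h S (Write 2 2) (Write 2 1)) ?T (1 + 1) (?T(2 := truth ?b))"
    proof (rule exec_Branch)
      assume "read_tape (?T h) \<in> S"
      then show "exec (Write 2 2) ?T 1 (?T(2 := truth ?b))"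
        using exec_Write_truth[where T = ?T and b = ?b, OF 2] by (simp add: shift_def)
    next
      assume "read_tape (?T h) \<notin> S"
      then show "exec (Write 2 1) ?T 1 (?T(2 := truth ?b))"
        using exec_Write_truth[where T = ?T and b = ?b, OF 2] by (simp add: shift_def)
    qed
    moreover have "ready N W A (?T(2 := truth ?b))"
      unfolding shift_def using * h by (intro ready_upd)
    then have "exec Q (?T(2 := truth ?b)) (g N) (shift h (- k N W) (?T(2 := truth ?b)))"
      by (rule g(2)[OF *(1)])
    moreover have "shift h (- k N W) (?T(2 := truth ?b)) = T(2 := truth ?b)"
      using h by (auto simp: shift_def)
    ultimately show "exec (P ;; Branch h S (Write 2 2) (Write 2 1) ;; Q) T (f N + (1 + 1 + g N + 1) + 1)
      (T(2 := truth ?b))"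
      using f(2)[OF *] by (metis exec_Seq)
  qed
qed

text \<open>A certificate shorter than the table is padded with false, in agreement with the blank
  cells behind it, which differ from the symbol 2 that the machine tests for.\<close>

definition rel_of :: "bool list \<Rightarrow> nat \<Rightarrow> nat \<Rightarrow> nat list \<Rightarrow> bool" where
  "rel_of u N r as \<longleftrightarrow> address (N + 8) (r # as) < length u \<and> u ! address (N + 8) (r # as)"

definition val :: "nat \<Rightarrow> (nat \<Rightarrow> nat) \<Rightarrow> nat \<Rightarrow> nat" where
  "val N e j = (if j < 7 then N else e (j - 7))"

definition represents :: "nat \<Rightarrow> bool list \<Rightarrow> bool list \<Rightarrow> (nat \<Rightarrow> nat) \<Rightarrow> (nat \<Rightarrow> tape) \<Rightarrow> bool" where
  "represents V x u e T \<longleftrightarrow> T 0 = word_tape x \<and> T 1 = word_tape u \<and> (\<exists>s. T 2 = flag s) \<and>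
     ready (length x) (val (length x) e) {3..<7 + V} T"

lemma represents_truth: "represents V x u e T \<Longrightarrow> represents V x u e (T(2 := truth b))"
  unfolding represents_def truth_def using ready_upd by auto

lemma represents_var:
  assumes "represents V x u e T" "v < V"
  shows "T (7 + v) = (unary (length x) (e v), 0)" "e v \<le> length x"
proof -
  have "7 + v \<in> {3..<7 + V}" using assms(2) by auto
  then have "T (7 + v) = (unary (length x) (val (length x) e (7 + v)), 0) \<and> val (length x) e (7 + v) \<le> length x"
    using assms(1) unfolding represents_def ready_def by blast
  then show "T (7 + v) = (unary (length x) (e v), 0)" "e v \<le> length x"
    by (auto simp: val_def)
qed

lemma represents_upd:
  assumes "represents V x u e T" "v < V" "a \<le> length x"
  shows "represents V x u (e(v := a)) (T(7 + v := (unary (length x) a, 0)))"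
proof -
  have "ready (length x) (val (length x) (e(v := a))) {3..<7 + V} (T(7 + v := (unary (length x) a, 0)))"
    unfolding ready_def
  proof
    fix j assume j: "j \<in> {3..<7 + V}"
    show "(T(7 + v := (unary (length x) a, 0))) j = (unary (length x) (val (length x) (e(v := a)) j), 0) \<and>
        val (length x) (e(v := a)) j \<le> length x"
    proof (cases "j = 7 + v")
      case False
      then have "val (length x) (e(v := a)) j = val (length x) e j" using j by (auto simp: val_def)
      then show ?thesis using False assms(1) j by (simp add: represents_def ready_def)
    qed (use assms in \<open>simp add: val_def\<close>)
  qed
  then show ?thesis using assms(1) by (auto simp: represents_def)
qed

lemma exec_seek:
  assumes "T j = (unary N a, 0)" "a \<le> N"
  shows "exec (seek j) T (2 * N + 1) (T(j := (unary N a, int a)))"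
proof -
  have "exec (seek j) T (2 * q + 1) (T(j := (unary N a, int a)))"
    if "T j = (unary N a, int (a - q))" "q \<le> a" for q T
    using that
  proof (induction q arbitrary: T)
    case 0
    show ?case unfolding seek_def by (rule exec_mono, rule exec_WhileF) (use 0 in \<open>auto simp: unary_def\<close>)
  next
    case (Suc q)
    let ?T = "T(j := (unary N a, int (a - q)))"
    have "read_tape (T j) \<in> {1}" using Suc.prems assms(2) by (auto simp: unary_def)
    moreover have "exec (Move j Right) T 1 ?T" by (rule exec_Move) (use Suc.prems in simp)
    moreover have "exec (seek j) ?T (2 * q + 1) (?T(j := (unary N a, int a)))"
      by (rule Suc.IH) (use Suc.prems in auto)
    ultimately have "exec (seek j) T (1 + (2 * q + 1) + 1) (?T(j := (unary N a, int a)))"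
      unfolding seek_def by (rule exec_WhileT)
    then show ?case by (simp del: fun_upd_apply)
  qed
  from this[of T a] assms show ?thesis by (auto intro: exec_mono simp del: fun_upd_apply)
qed

lemma exec_reset:
  assumes "T j = (unary N N, int N)"
  shows "exec (reset j) T (4 * N + 10) (T(j := (unary N 0, 0)))"
proof -
  let ?W = "While j {1, 2} (Write j 2 ;; Move j Left)"
  have "exec ?W T (4 * q + 1) (T(j := (unary N 0, -1)))"
    if "T j = (unary N q, int q - 1)" "q \<le> N" for q T
    using that
  proof (induction q arbitrary: T)
    case 0
    show ?case by (rule exec_mono, rule exec_WhileF) (use 0 in \<open>auto simp: unary_def\<close>)
  next
    case (Suc q)
    let ?T = "T(j := (unary N q, int q - 1))"
    have "read_tape (T j) \<in> {1, 2}" using Suc.prems by (auto simp: unary_def)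
    moreover have "(unary N (Suc q))(int q := 2) = unary N q"
      using Suc.prems by (auto simp: unary_def)
    then have "exec (Write j 2 ;; Move j Left) T (1 + 1 + 1) ?T"
      by (intro exec_Seq[OF exec_Write exec_Move]) (use Suc.prems in auto)
    moreover have "exec ?W ?T (4 * q + 1) (?T(j := (unary N 0, -1)))"
      by (rule Suc.IH) (use Suc.prems in auto)
    ultimately have "exec ?W T (1 + 1 + 1 + (4 * q + 1) + 1) (?T(j := (unary N 0, -1)))"
      by (rule exec_WhileT)
    then show ?case by (simp add: eval_nat_numeral del: fun_upd_apply)
  qed
  from this[of "T(j := (unary N N, int N - 1))" N]
  have "exec ?W (T(j := (unary N N, int N - 1))) (4 * N + 1) (T(j := (unary N 0, -1)))"
    by (simp del: fun_upd_apply add: fun_upd_same)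
  moreover have "exec (Move j Left) T 1 (T(j := (unary N N, int N - 1)))"
    by (rule exec_Move) (use assms in simp)
  moreover have "exec (Move j Right) (T(j := (unary N 0, -1))) 1 (T(j := (unary N 0, 0)))"
    by (rule exec_Move) simp
  ultimately have "exec (reset j) T (1 + (4 * N + 1 + 1 + 1) + 1) (T(j := (unary N 0, 0)))"
    unfolding reset_def by (intro exec_Seq)
  then show ?thesis by (rule exec_mono) simp
qed

lemma unary_Suc: "a < N \<Longrightarrow> (unary N a)(int a := 1) = unary N (Suc a)"
  by (auto simp: unary_def fun_eq_iff)

text \<open>Invariant: with the counter at \<open>a\<close>, the flag is the conjunction of
  \<open>g\<close> below \<open>a\<close>, and \<open>P\<close> is skipped once the flag is false.
  Since \<open>P\<close> overwrites the flag, running it on a true flag turns the conjunction below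
  \<open>a\<close> into the one up to \<open>a\<close>.\<close>

lemma exec_All:
  assumes IH: "\<And>a s. a \<le> N \<Longrightarrow> exec P (T(j := (unary N a, 0), 2 := flag s)) B
      (T(j := (unary N a, 0), 2 := truth (g a)))"
    and T: "T j = (unary N 0, 0)" "T 2 = flag s" and j: "j \<noteq> 2"
  shows "exec (Write 2 2 ;; Branch 2 {2} P Skip ;; seek j ;;
    While j {2} (Write j 1 ;; go_home j ;; Branch 2 {2} P Skip ;; seek j) ;; reset j)
    T (N * (B + 5 * N + 100) + B + 6 * N + 100) (T(2 := truth (\<forall>a \<le> N. g a)))"
proof -
  let ?U = "\<lambda>a h b. T(j := (unary N a, h), 2 := truth b)"
  let ?G = "\<lambda>a. \<forall>a' < a. g a'"
  let ?body = "Branch 2 {2} P Skip ;; seek j"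
  let ?W = "While j {2} (Write j 1 ;; go_home j ;; ?body)"
  have body1: "exec (Branch 2 {2} P Skip) (?U a 0 (?G a)) (B + 1 + 1) (?U a 0 (?G (Suc a)))"
    if a: "a \<le> N" for a
  proof -
    have *: "?G (Suc a) \<longleftrightarrow> ?G a \<and> g a" using less_Suc_eq by auto
    show ?thesis
    proof (cases "?G a")
      case True
      then have G: "?G a = True" "?G (Suc a) = g a" using * by simp_all
      have "exec P (?U a 0 True) (B + 1) (?U a 0 (g a))"
        using IH[OF a, of 2] by (auto simp: truth_def intro: exec_mono simp del: fun_upd_apply)
      then show ?thesis unfolding G
        by (intro exec_Branch) (simp_all add: truth_def flag_def)
    next
      case False
      then have G: "?G a = False" "?G (Suc a) = False" using * by simp_all
      show ?thesis unfolding G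
        by (intro exec_Branch exec_mono[OF exec_Skip]) (simp_all add: truth_def flag_def)
    qed
  qed
  have body2: "exec (seek j) (?U a 0 b) (2 * N + 1) (?U a (int a) b)" if a: "a \<le> N" for a b
  proof -
    have "exec (seek j) (?U a 0 b) (2 * N + 1) ((?U a 0 b)(j := (unary N a, int a)))"
      by (rule exec_seek) (use j a in auto)
    moreover have "(?U a 0 b)(j := (unary N a, int a)) = ?U a (int a) b"
      using j by (auto simp: fun_eq_iff)
    ultimately show ?thesis by simp
  qed
  have body: "exec ?body (?U a 0 (?G a)) (B + 1 + 1 + (2 * N + 1) + 1) (?U a (int a) (?G (Suc a)))"
    if a: "a \<le> N" for a
    by (rule exec_Seq[OF body1[OF a] body2[OF a]])
  have loop: "exec ?W (?U (N - q) (int (N - q)) (?G (Suc (N - q)))) (q * (B + 5 * N + 40) + 1)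
      (?U N (int N) (?G (Suc N)))" if "q \<le> N" for q
    using that
  proof (induction q)
    case 0
    show ?case by (rule exec_mono, rule exec_WhileF) (use j in \<open>auto simp: unary_def\<close>)
  next
    case (Suc q)
    define a where "a = N - Suc q"
    have a: "N - q = Suc a" "Suc a \<le> N" "N - Suc q = a" using Suc.prems by (auto simp: a_def)
    have w: "exec (Write j 1) (?U a (int a) (?G (Suc a))) 1 (?U (Suc a) (int a) (?G (Suc a)))"
    proof (rule exec_Write)
      have "(unary N a)(int a := 1) = unary N (Suc a)" by (rule unary_Suc) (use a in simp)
      then show "?U (Suc a) (int a) (?G (Suc a)) = (?U a (int a) (?G (Suc a)))
        (j := ((fst (?U a (int a) (?G (Suc a)) j))(snd (?U a (int a) (?G (Suc a)) j) := 1),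
           snd (?U a (int a) (?G (Suc a)) j)))"
        using j by (auto simp: fun_eq_iff)
    qed
    have "exec (go_home j) (?U (Suc a) (int a) (?G (Suc a))) (3 * a + 10)
       ((?U (Suc a) (int a) (?G (Suc a)))(j := (unary N (Suc a), 0)))"
      by (rule exec_go_home) (use j a in \<open>auto simp: unary_def\<close>)
    moreover have "(?U (Suc a) (int a) (?G (Suc a)))(j := (unary N (Suc a), 0)) = ?U (Suc a) 0 (?G (Suc a))"
      using j by (auto simp: fun_eq_iff)
    ultimately have h: "exec (go_home j) (?U (Suc a) (int a) (?G (Suc a))) (3 * a + 10)
       (?U (Suc a) 0 (?G (Suc a)))" by (simp only:)
    have "exec ?W (?U (Suc a) (int (Suc a)) (?G (Suc (Suc a)))) (q * (B + 5 * N + 40) + 1)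
      (?U N (int N) (?G (Suc N)))" using Suc.IH Suc.prems unfolding a by (simp del: fun_upd_apply)
    moreover have "read_tape (?U a (int a) (?G (Suc a)) j) \<in> {2}"
      using j a by (auto simp: unary_def)
    ultimately have "exec ?W (?U a (int a) (?G (Suc a)))
       (1 + (3 * a + 10 + (B + 1 + 1 + (2 * N + 1) + 1) + 1) + 1 + (q * (B + 5 * N + 40) + 1) + 1)
       (?U N (int N) (?G (Suc N)))"
      using exec_WhileT[OF _ exec_Seq[OF w exec_Seq[OF h body[OF a(2)]]]] by blast
    then show ?case unfolding a(3) by (rule exec_mono) (use a in simp)
  qed
  have w: "exec (Write 2 2) T 1 (?U 0 0 (?G 0))"
    by (rule exec_Write) (use T j in \<open>auto simp: truth_def flag_def fun_eq_iff\<close>)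
  have l: "exec ?W (?U 0 (int 0) (?G (Suc 0))) (N * (B + 5 * N + 40) + 1) (?U N (int N) (?G (Suc N)))"
    using loop[of N] by (simp del: fun_upd_apply)
  have "exec (reset j) (?U N (int N) (?G (Suc N))) (4 * N + 10)
      ((?U N (int N) (?G (Suc N)))(j := (unary N 0, 0)))"
    by (rule exec_reset) (use j in auto)
  moreover have "(?U N (int N) (?G (Suc N)))(j := (unary N 0, 0)) = T(2 := truth (\<forall>a \<le> N. g a))"
    using j T by (auto simp: fun_eq_iff less_Suc_eq_le)
  ultimately have r: "exec (reset j) (?U N (int N) (?G (Suc N))) (4 * N + 10)
      (T(2 := truth (\<forall>a \<le> N. g a)))" by (simp only:)
  have "exec (Write 2 2 ;; Branch 2 {2} P Skip ;; seek j ;; ?W ;; reset j) T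
      (1 + (B + 1 + 1 + (2 * N + 1 + (N * (B + 5 * N + 40) + 1 + (4 * N + 10) + 1) + 1) + 1) + 1)
      (T(2 := truth (\<forall>a \<le> N. g a)))"
    by (rule exec_Seq[OF w exec_Seq[OF body1 exec_Seq[OF body2 exec_Seq[OF l r]]]]) simp_all
  then show ?thesis by (rule exec_mono) (simp add: algebra_simps)
qed

text \<open>The counters of bound variables must be 0 on entry, because a quantifier counts upwards
  from there; it resets them on exit, so the requirement survives the enclosing loops.\<close>

definition decides :: "nat \<Rightarrow> fm \<Rightarrow> bool" where
  "decides V \<phi> \<longleftrightarrow> (\<exists>f. polyb f \<and> (\<forall>x u e T. represents V x u e T \<longrightarrow> (\<forall>v \<in> bound_vars \<phi>. e v = 0) \<longrightarrow>
     exec (compile \<phi>) T (f (length x)) (T(2 := truth (sat x (rel_of u (length x)) e \<phi>)))))"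

lemma decidesI:
  assumes "polyb f" "\<And>x u e T s. represents V x u e T \<Longrightarrow> T 2 = flag s \<Longrightarrow> (\<forall>v \<in> bound_vars \<phi>. e v = 0) \<Longrightarrow>
     exec (compile \<phi>) T (f (length x)) (T(2 := truth (sat x (rel_of u (length x)) e \<phi>)))"
  shows "decides V \<phi>"
  unfolding decides_def using assms by (metis represents_def)

lemma val_const: "\<forall>j \<in> {3..<7}. val N e j = N"
  by (simp add: val_def)

lemma decides_probe:
  assumes P: "shifter h A P k" and Q: "shifter h A Q (\<lambda>N W. - k N W)" and h: "h \<notin> A" "h \<noteq> 2"
    and A: "A \<subseteq> {3..<7 + V}"
    and comp: "compile \<phi> = P ;; Branch h S (Write 2 2) (Write 2 1) ;; Q"
    and sat: "\<And>x u e T. represents V x u e T \<Longrightarrow>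
      fst (T h) (snd (T h) + k (length x) (val (length x) e)) \<in> S \<longleftrightarrow> sat x (rel_of u (length x)) e \<phi>"
  shows "decides V \<phi>"
proof -
  have "2 \<notin> A" using A by auto
  from exec_probe[OF P Q h this, of S] obtain f where f: "polyb f"
    "\<And>N W T s. (\<forall>j \<in> {3..<7}. W j = N) \<Longrightarrow> ready N W A T \<Longrightarrow> T 2 = flag s \<Longrightarrow>
    exec (compile \<phi>) T (f N) (T(2 := truth (fst (T h) (snd (T h) + k N W) \<in> S)))"
    unfolding comp by blast
  show ?thesis
  proof (rule decidesI[OF f(1)])
    fix x u e T s assume T: "represents V x u e T" "T 2 = flag s"
    show "exec (compile \<phi>) T (f (length x)) (T(2 := truth (sat x (rel_of u (length x)) e \<phi>)))"
      unfolding sat[OF T(1), symmetric]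
      using f(2)[of "val (length x) e" "length x" T s] val_const T A
      by (auto simp: represents_def intro: ready_mono)
  qed
qed

lemma compile_decides:
  assumes "wf_fm \<phi>" "vars \<phi> \<subseteq> {..<V}"
  shows "decides V \<phi>"
  using assms
proof (induction \<phi>)
  case (FSym s v c)
  have k: "shifter 0 {7 + v} (term_prog 0 d (v, c)) (\<lambda>N W. int (W (7 + v) + c) * sgd d)" for d
    by (rule shifter_term_prog) simp
  show ?case
  proof (rule decides_probe[OF k[of Right] _ _ _ _ compile.simps(1)])
    show "shifter 0 {7 + v} (term_prog 0 Left (v, c)) (\<lambda>N W. - (int (W (7 + v) + c) * sgd Right))"
      using k[of Left] by (rule shifter_cong) (simp add: sgd_def)
    fix x u e T assume "represents V x u e T"
    then have "T 0 = (fst (word_tape x), 0)" by (simp add: represents_def word_tape_def)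
    then show "fst (T 0) (snd (T 0) + int (val (length x) e (7 + v) + c) * sgd Right) \<in> {s}
       \<longleftrightarrow> sat x (rel_of u (length x)) e (FSym s v c)"
      by (simp add: symb_def sgd_def val_def)
  qed (use FSym in auto)
next
  case (FLess v w)
  show ?case
  proof (cases "v = w")
    case True
    show ?thesis
      by (rule decidesI[where f = "\<lambda>_. 1"])
         (use True exec_Write_truth[where b = False] in \<open>auto intro: polyb_intros simp del: fun_upd_apply\<close>)
  next
    case False
    have k: "shifter (7 + w) {7 + v} (For (7 + v) (Move (7 + w) d)) (\<lambda>N W. int (W (7 + v)) * sgd d)" for d
      using shifter_For[OF shifter_Move, of "7 + v" "7 + w" d] False by simp
    show ?thesis
    proof (rule decides_probe[OF k[of Right]])
      show "shifter (7 + w) {7 + v} (For (7 + v) (Move (7 + w) Left)) (\<lambda>N W. - (int (W (7 + v)) * sgd Right))"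
        using k[of Left] by (rule shifter_cong) (simp add: sgd_def)
      fix x u e T assume T: "represents V x u e T"
      show "fst (T (7 + w)) (snd (T (7 + w)) + int (val (length x) e (7 + v)) * sgd Right) \<in> {1}
         \<longleftrightarrow> sat x (rel_of u (length x)) e (FLess v w)"
        using represents_var[OF T, of w] represents_var[OF T, of v] FLess.prems
        by (simp add: unary_def sgd_def val_def)
    qed (use FLess False in auto)
  qed
next
  case (FRel r ts)
  let ?A = "{3..<7} \<union> (\<lambda>t. 7 + fst t) ` set ts"
  let ?k = "\<lambda>N W. int (address (N + 8) (r # map (\<lambda>(v, c). W (7 + v) + c) ts))"
  have k: "shifter 1 ?A (rep 4 (iter r (Move 1 d)) ;; address_prog 1 d ts) (\<lambda>N W. ?k N W * sgd d)" for d
  proof -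
    have "shifter 1 ({3..<3 + 4} \<union> {}) (rep 4 (iter r (Move 1 d)))
        (\<lambda>N W. int ((N + 8) ^ 4) * (int r * sgd d))"
      by (intro shifter_rep shifter_iter shifter_Move) auto
    then have "shifter 1 ?A (rep 4 (iter r (Move 1 d))) (\<lambda>N W. int ((N + 8) ^ 4) * (int r * sgd d))"
      by (rule shifter_mono) auto
    moreover have "shifter 1 ?A (address_prog 1 d ts)
        (\<lambda>N W. int (address (N + 8) (map (\<lambda>(v, c). W (7 + v) + c) ts)) * sgd d)"
      by (rule shifter_address_prog) (use FRel in auto)
    ultimately have "shifter 1 ?A (rep 4 (iter r (Move 1 d)) ;; address_prog 1 d ts)
        (\<lambda>N W. int ((N + 8) ^ 4) * (int r * sgd d)
          + int (address (N + 8) (map (\<lambda>(v, c). W (7 + v) + c) ts)) * sgd d)"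
      by (rule shifter_Seq) auto
    then show ?thesis
      by (rule shifter_cong) (use FRel in \<open>simp add: algebra_simps\<close>)
  qed
  show ?case
  proof (rule decides_probe[OF k[of Right] _ _ _ _ compile.simps(3)])
    show "shifter 1 ?A (rep 4 (iter r (Move 1 Left)) ;; address_prog 1 Left ts) (\<lambda>N W. - (?k N W * sgd Right))"
      using k[of Left] by (rule shifter_cong) (simp add: sgd_def)
    fix x u e T assume "represents V x u e T"
    then have "T 1 = (fst (word_tape u), 0)" by (simp add: represents_def word_tape_def)
    then show "fst (T 1) (snd (T 1) + ?k (length x) (val (length x) e) * sgd Right) \<in> {2}
       \<longleftrightarrow> sat x (rel_of u (length x)) e (FRel r ts)"
      by (simp add: rel_of_def sgd_def val_def word_tape_def del: address.simps)
  qed (use FRel.prems in auto)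
next
  case (FNot \<phi>)
  then have "decides V \<phi>" by simp
  then obtain f where f: "polyb f" "\<And>x u e T. represents V x u e T \<Longrightarrow> (\<forall>v \<in> bound_vars \<phi>. e v = 0) \<Longrightarrow>
     exec (compile \<phi>) T (f (length x)) (T(2 := truth (sat x (rel_of u (length x)) e \<phi>)))"
    unfolding decides_def by blast
  show ?case
  proof (rule decidesI)
    show "polyb (\<lambda>n. f n + (1 + 1) + 1)" by (intro polyb_intros f)
    fix x u e T s assume T: "represents V x u e T" "\<forall>v \<in> bound_vars (FNot \<phi>). e v = 0"
    let ?b = "sat x (rel_of u (length x)) e \<phi>"
    have "exec (Branch 2 {2} (Write 2 1) (Write 2 2)) (T(2 := truth ?b)) (1 + 1) (T(2 := truth (\<not> ?b)))"
      by (intro exec_Branch exec_Write) (auto simp: truth_def flag_def split: if_splits)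
    moreover have "exec (compile \<phi>) T (f (length x)) (T(2 := truth ?b))"
      using f(2)[OF T(1)] T(2) by simp
    ultimately show "exec (compile (FNot \<phi>)) T (f (length x) + (1 + 1) + 1)
       (T(2 := truth (sat x (rel_of u (length x)) e (FNot \<phi>))))"
      unfolding compile.simps sat.simps by (intro exec_Seq)
  qed
next
  case (FAnd \<phi> \<psi>)
  then have "decides V \<phi>" "decides V \<psi>" by simp_all
  then obtain f g where f: "polyb f" "\<And>x u e T. represents V x u e T \<Longrightarrow> (\<forall>v \<in> bound_vars \<phi>. e v = 0) \<Longrightarrow>
     exec (compile \<phi>) T (f (length x)) (T(2 := truth (sat x (rel_of u (length x)) e \<phi>)))"
    and g: "polyb g" "\<And>x u e T. represents V x u e T \<Longrightarrow> (\<forall>v \<in> bound_vars \<psi>. e v = 0) \<Longrightarrow>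
     exec (compile \<psi>) T (g (length x)) (T(2 := truth (sat x (rel_of u (length x)) e \<psi>)))"
    unfolding decides_def by metis
  show ?case
  proof (rule decidesI)
    show "polyb (\<lambda>n. f n + (g n + 1 + 1) + 1)" by (intro polyb_intros f g)
    fix x u e T s assume T: "represents V x u e T" "\<forall>v \<in> bound_vars (FAnd \<phi> \<psi>). e v = 0"
    let ?b = "sat x (rel_of u (length x)) e \<phi>" and ?c = "sat x (rel_of u (length x)) e \<psi>"
    have "exec (compile \<psi>) (T(2 := truth ?b)) (g (length x)) ((T(2 := truth ?b))(2 := truth ?c))"
      by (rule g(2)[OF represents_truth[OF T(1)]]) (use T(2) in auto)
    then have c: "exec (compile \<psi>) (T(2 := truth ?b)) (g (length x) + 1) (T(2 := truth ?c))"
      by (simp add: exec_mono del: fun_upd_apply)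
    have "exec (Branch 2 {2} (compile \<psi>) Skip) (T(2 := truth ?b)) (g (length x) + 1 + 1) (T(2 := truth (?b \<and> ?c)))"
    proof (cases ?b)
      case True
      then have "(?b \<and> ?c) = ?c" by simp
      then show ?thesis using True c
        by (intro exec_Branch) (simp_all add: truth_def flag_def del: fun_upd_apply add: fun_upd_same)
    next
      case False
      then show ?thesis
        by (intro exec_Branch exec_mono[OF exec_Skip]) (simp_all add: truth_def flag_def)
    qed
    moreover have "exec (compile \<phi>) T (f (length x)) (T(2 := truth ?b))"
      using f(2)[OF T(1)] T(2) by simp
    ultimately show "exec (compile (FAnd \<phi> \<psi>)) T (f (length x) + (g (length x) + 1 + 1) + 1)
       (T(2 := truth (sat x (rel_of u (length x)) e (FAnd \<phi> \<psi>))))"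
      unfolding compile.simps sat.simps by (intro exec_Seq)
  qed
next
  case (FAll v \<phi>)
  then have "decides V \<phi>" by simp
  then obtain f where f: "polyb f" "\<And>x u e T. represents V x u e T \<Longrightarrow> (\<forall>v \<in> bound_vars \<phi>. e v = 0) \<Longrightarrow>
     exec (compile \<phi>) T (f (length x)) (T(2 := truth (sat x (rel_of u (length x)) e \<phi>)))"
    unfolding decides_def by blast
  show ?case
  proof (rule decidesI)
    show "polyb (\<lambda>n. n * (f n + 5 * n + 100) + f n + 6 * n + 100)" by (intro polyb_intros f)
    fix x u e T s assume T: "represents V x u e T" "T 2 = flag s" "\<forall>v \<in> bound_vars (FAll v \<phi>). e v = 0"
    let ?j = "7 + v" and ?N = "length x"
    have v: "v < V" using FAll.prems by simp
    have "exec (compile (FAll v \<phi>)) T (?N * (f ?N + 5 * ?N + 100) + f ?N + 6 * ?N + 100)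
       (T(2 := truth (\<forall>a \<le> ?N. sat x (rel_of u ?N) (e(v := a)) \<phi>)))"
      unfolding compile.simps
    proof (rule exec_All)
      fix a s assume a: "a \<le> ?N"
      have "represents V x u (e(v := a)) (T(?j := (unary ?N a, 0), 2 := flag s))"
        using represents_upd[OF T(1) v a] ready_upd[of _ _ "{3..<7 + V}" _ 2] by (auto simp: represents_def)
      \<comment> \<open>Giving \<open>v\<close> the value \<open>a\<close> leaves the bound
        variables of \<open>\<phi>\<close> at 0, since \<open>wf_fm\<close> forbids rebinding
        \<open>v\<close>.\<close>
      from f(2)[OF this] T(3) FAll.prems(1)
      show "exec (compile \<phi>) (T(?j := (unary ?N a, 0), 2 := flag s)) (f ?N)
          (T(?j := (unary ?N a, 0), 2 := truth (sat x (rel_of u ?N) (e(v := a)) \<phi>)))"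
        by (auto simp del: fun_upd_apply simp add: fun_upd_other fun_upd_def[of e])
    next
      show "T ?j = (unary ?N 0, 0)" using represents_var(1)[OF T(1) v] T(3) by simp
    qed (use T in auto)
    then show "exec (compile (FAll v \<phi>)) T (?N * (f ?N + 5 * ?N + 100) + f ?N + 6 * ?N + 100)
       (T(2 := truth (sat x (rel_of u ?N) e (FAll v \<phi>))))" by simp
  qed
qed

text \<open>The input tape serves as the measure: one cell of tape \<open>j\<close> is written per
  input symbol. Filling with 1 yields a counter of value \<open>N\<close>, filling with 2 one of
  value 0.\<close>

definition init_prog :: "nat \<Rightarrow> nat \<Rightarrow> prog" where
  "init_prog j s = While 0 {1, 2} (Write j s ;; Move j Right ;; Move 0 Right) ;; go_home 0 ;; go_home j"

lemma exec_init_prog: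
  assumes T: "T 0 = word_tape x" "T j = word_tape []" and j: "j \<noteq> 0" and s: "s \<in> {1, 2}"
    and v: "v = (if s = 1 then length x else 0)"
  shows "exec (init_prog j s) T (12 * length x + 30) (T(j := (unary (length x) v, 0)))"
proof -
  let ?N = "length x" and ?t = "fst (word_tape x)"
  let ?c = "\<lambda>q :: nat. \<lambda>p :: int. if 0 \<le> p \<and> p < int q then s else 0"
  let ?W = "While 0 {1, 2} (Write j s ;; Move j Right ;; Move 0 Right)"
  let ?E = "T(0 := (?t, int ?N), j := (?c ?N, int ?N))"
  have t: "?t q \<in> {1, 2}" if "0 \<le> q" "q < int ?N" for q using that by (auto simp: word_tape_def)
  have t0: "?t q = 0" if "q < 0 \<or> q \<ge> int ?N" for q using that by (auto simp: word_tape_def)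
  have loop: "exec ?W (T(0 := (?t, int (?N - q)), j := (?c (?N - q), int (?N - q)))) (6 * q + 1) ?E"
    if "q \<le> ?N" for q
    using that
  proof (induction q)
    case 0
    show ?case by (rule exec_mono, rule exec_WhileF) (use j t0 in auto)
  next
    case (Suc q)
    define a where "a = ?N - Suc q"
    have a: "?N - Suc q = a" "?N - q = Suc a" "a < ?N" using Suc.prems by (auto simp: a_def)
    have "(?c a)(int a := s) = ?c (Suc a)" by (auto simp: fun_eq_iff)
    then have w: "exec (Write j s) (T(0 := (?t, int a), j := (?c a, int a))) 1
        (T(0 := (?t, int a), j := (?c (Suc a), int a)))"
      by (intro exec_Write) simp
    have m: "exec (Move j Right) (T(0 := (?t, int a), j := (?c (Suc a), int a))) 1
        (T(0 := (?t, int a), j := (?c (Suc a), int (Suc a))))"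
      by (rule exec_Move) (simp add: add.commute)
    have m': "exec (Move 0 Right) (T(0 := (?t, int a), j := (?c (Suc a), int (Suc a)))) 1
        (T(0 := (?t, int (Suc a)), j := (?c (Suc a), int (Suc a))))"
      by (rule exec_Move) (use j in \<open>auto simp: fun_eq_iff\<close>)
    have r: "read_tape ((T(0 := (?t, int a), j := (?c a, int a))) 0) \<in> {1, 2}"
      using t[of "int a"] a(3) j by simp
    have "exec ?W (T(0 := (?t, int a), j := (?c a, int a))) (1 + (1 + 1 + 1) + 1 + (6 * q + 1) + 1) ?E"
      by (rule exec_WhileT[OF r exec_Seq[OF w exec_Seq[OF m m']]]) (use Suc.IH Suc.prems in \<open>simp only: a\<close>)
    then show ?case unfolding a(1) by (rule exec_mono) simp
  qed
  have "T(0 := (?t, int 0), j := (?c 0, int 0)) = T"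
    using T by (auto simp: fun_eq_iff word_tape_def)
  then have l: "exec ?W T (6 * ?N + 1) ?E" using loop[of ?N] by (simp only: le_refl diff_self_eq_0)
  have h: "exec (go_home 0) ?E (3 * ?N + 10) (?E(0 := (?t, 0)))"
    by (rule exec_go_home) (use t t0 j in auto)
  have h': "exec (go_home j) (?E(0 := (?t, 0))) (3 * ?N + 10) (?E(0 := (?t, 0), j := (?c ?N, 0)))"
    by (rule exec_go_home) (use s j in auto)
  have "?c ?N = unary ?N v" using s v by (auto simp: unary_def fun_eq_iff)
  then have "?E(0 := (?t, 0), j := (?c ?N, 0)) = T(j := (unary ?N v, 0))"
    using T j by (auto simp: fun_eq_iff word_tape_def)
  then have "exec (init_prog j s) T (6 * ?N + 1 + (3 * ?N + 10 + (3 * ?N + 10) + 1) + 1) (T(j := (unary ?N v, 0)))"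
    unfolding init_prog_def using exec_Seq[OF l exec_Seq[OF h h']] by (simp only:)
  then show ?thesis by (rule exec_mono) simp
qed

definition init_all :: "nat list \<Rightarrow> prog" where
  "init_all js = foldr (\<lambda>j P. init_prog j (if j < 7 then 1 else 2) ;; P) js (Write 2 1)"

lemma exec_init_all:
  assumes "T 0 = word_tape x" "T 2 = word_tape []" "\<forall>j \<in> set js. T j = word_tape []" "distinct js" "set js \<subseteq> {3..}"
  shows "exec (init_all js) T (length js * (12 * length x + 31) + 1)
    (\<lambda>j. if j \<in> set js then (unary (length x) (val (length x) (\<lambda>_. 0) j), 0)
         else if j = 2 then flag 1 else T j)"
  using assms
proof (induction js arbitrary: T)
  case Nil
  show ?case unfolding init_all_def
    by (simp, rule exec_Write[simplified]) (use Nil in \<open>auto simp: flag_def word_tape_def fun_eq_iff\<close>)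
next
  case (Cons j js)
  let ?s = "if j < 7 then 1 else 2 :: nat" and ?v = "val (length x) (\<lambda>_. 0) j"
  let ?T = "T(j := (unary (length x) ?v, 0))"
  let ?F = "\<lambda>js T j. if j \<in> set js then (unary (length x) (val (length x) (\<lambda>_. 0) j), 0)
         else if j = 2 then flag 1 else T j"
  have i: "exec (init_prog j ?s) T (12 * length x + 30) ?T"
    by (rule exec_init_prog) (use Cons.prems in \<open>auto simp: val_def\<close>)
  have "exec (init_all js) ?T (length js * (12 * length x + 31) + 1) (?F js ?T)"
    by (rule Cons.IH) (use Cons.prems in auto)
  moreover have "?F js ?T = ?F (j # js) T" using Cons.prems by (auto simp: fun_eq_iff)
  ultimately have "exec (init_all js) ?T (length js * (12 * length x + 31) + 1) (?F (j # js) T)" by (simp only:)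
  with i have "exec (init_prog j ?s ;; init_all js) T
      (12 * length x + 30 + (length js * (12 * length x + 31) + 1) + 1) (?F (j # js) T)" by (rule exec_Seq)
  then show ?case unfolding init_all_def by (auto intro: exec_mono)
qed

lemma wf_prog_iter: "wf_prog m P \<Longrightarrow> wf_prog m (iter n P)"
  by (induction n) auto

lemma wf_prog_go_home: "i < m \<Longrightarrow> wf_prog m (go_home i)"
  by (simp add: go_home_def)

lemma wf_prog_For: "i < m \<Longrightarrow> wf_prog m P \<Longrightarrow> wf_prog m (For i P)"
  by (simp add: For_def wf_prog_go_home)

lemma wf_prog_rep: "3 + e \<le> m \<Longrightarrow> wf_prog m P \<Longrightarrow> wf_prog m (rep e P)"
proof (induction e)
  case (Suc e)
  then have "wf_prog m (rep e P)" by simp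
  then show ?case using wf_prog_For[of "3 + e" m "rep e P"] wf_prog_iter[of m "rep e P" 8] Suc.prems by simp
qed simp

lemma wf_prog_term_prog: "h < m \<Longrightarrow> 7 + fst t < m \<Longrightarrow> wf_prog m (term_prog h d t)"
  by (cases t) (simp add: term_prog_def wf_prog_For wf_prog_iter)

lemma wf_prog_address_prog:
  "h < m \<Longrightarrow> length ts \<le> 4 \<Longrightarrow> 7 \<le> m \<Longrightarrow> \<forall>t \<in> set ts. 7 + fst t < m \<Longrightarrow> wf_prog m (address_prog h d ts)"
  by (induction ts) (simp_all add: wf_prog_rep wf_prog_term_prog)

lemma wf_prog_compile: "wf_fm \<phi> \<Longrightarrow> vars \<phi> \<subseteq> {..<V} \<Longrightarrow> wf_prog (7 + V) (compile \<phi>)"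
proof (induction \<phi>)
  case (FRel r ts)
  then show ?case
    by (auto intro!: wf_prog_rep wf_prog_iter wf_prog_address_prog)
qed (auto simp: seek_def reset_def wf_prog_go_home wf_prog_For wf_prog_term_prog)

lemma wf_prog_init_all: "\<forall>j \<in> set js. j < m \<Longrightarrow> 3 \<le> m \<Longrightarrow> wf_prog m (init_all js)"
  unfolding init_all_def by (induction js) (auto simp: init_prog_def wf_prog_go_home)

section \<open>Certificates as tables of relations\<close>

lemma address_less: "\<forall>a \<in> set as. a < b \<Longrightarrow> address b as < b ^ length as"
proof (induction as)
  case (Cons a as)
  then have "a * b ^ length as + address b as < a * b ^ length as + b ^ length as" by simp
  also have "\<dots> = (a + 1) * b ^ length as" by simp
  also have "\<dots> \<le> b * b ^ length as" using Cons.prems by (intro mult_right_mono) auto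
  finally show ?case by simp
qed simp

text \<open>The leading digit may be arbitrary: it is the quotient once all others are below
  \<open>b\<close>. It carries the number of the relation, which is not tied to
  \<open>N + 8\<close>.\<close>

lemma address_inj:
  "length as = length bs \<Longrightarrow> \<forall>a \<in> set (tl as). a < b \<Longrightarrow> \<forall>a \<in> set (tl bs). a < b \<Longrightarrow>
   address b as = address b bs \<Longrightarrow> as = bs"
proof (induction as bs rule: list_induct2)
  case (Cons a as c cs)
  have less: "address b as < b ^ length as" "address b cs < b ^ length as"
    using Cons.prems Cons.hyps address_less[of as b] address_less[of cs b] by auto
  have "(a * b ^ length as + address b as) div b ^ length as = (c * b ^ length as + address b cs) div b ^ length as"
    using Cons.prems(3) Cons.hyps by simp
  moreover have "b ^ length as \<noteq> 0" using less(1) by (metis not_less_zero)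
  ultimately have "a = c" using less by (simp add: div_mult_self3)
  moreover have tl: "a \<in> set (tl xs) \<Longrightarrow> a \<in> set xs" for a and xs :: "nat list"
    by (cases xs) auto
  have "as = cs"
    by (rule Cons.IH) (use Cons.prems Cons.hyps \<open>a = c\<close> in \<open>auto dest: tl\<close>)
  ultimately show ?case by simp
qed simp

text \<open>Evaluation never leaves the domain extended by the offsets below 8, which allows an
  arbitrary \<open>R\<close> to be replaced by a tabulated one.\<close>

lemma sat_cong:
  assumes "\<And>r as. r \<in> rels \<phi> \<Longrightarrow> length as = 4 \<Longrightarrow> \<forall>a \<in> set as. a < length x + 8 \<Longrightarrow> R r as = R' r as"
    and "\<forall>v. e v \<le> length x" "wf_fm \<phi>"
  shows "sat x R e \<phi> = sat x R' e \<phi>"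
  using assms
proof (induction \<phi> arbitrary: e)
  case (FRel r ts)
  have "R r (map (\<lambda>(v, c). e v + c) ts) = R' r (map (\<lambda>(v, c). e v + c) ts)"
    by (rule FRel(1)) (use FRel(2,3) in \<open>force intro: add_le_less_mono\<close>)+
  then show ?case by simp
next
  case (FAll v \<phi>)
  have "sat x R (e(v := a)) \<phi> = sat x R' (e(v := a)) \<phi>" if "a \<le> length x" for a
    by (rule FAll.IH) (use FAll.prems that in auto)
  then show ?case by simp
qed auto

lemma rel_of_surj:
  fixes x :: "bool list"
  defines "b \<equiv> length x + 8"
  obtains u where "length u = n * b ^ 4"
    "\<And>r as. r < n \<Longrightarrow> length as = 4 \<Longrightarrow> \<forall>a \<in> set as. a < b \<Longrightarrow> rel_of u (length x) r as = R r as"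
proof
  define u where "u = map (\<lambda>i. \<exists>r as. length as = 4 \<and> (\<forall>a \<in> set as. a < b) \<and> address b (r # as) = i \<and> R r as)
    [0..<n * b ^ 4]"
  show "length u = n * b ^ 4" by (simp add: u_def)
  fix r as assume r: "r < n" and as: "length as = (4 :: nat)" "\<forall>a \<in> set as. a < b"
  have "address b (r # as) < r * b ^ 4 + b ^ 4" using address_less[OF as(2)] as(1) by simp
  also have "\<dots> = (r + 1) * b ^ 4" by simp
  also have "\<dots> \<le> n * b ^ 4" using r by (intro mult_right_mono) auto
  finally have less: "address b (r # as) < n * b ^ 4" .
  have "(\<exists>r' as'. length as' = 4 \<and> (\<forall>a \<in> set as'. a < b) \<and> address b (r' # as') = address b (r # as) \<and> R r' as')
    \<longleftrightarrow> R r as" (is "?L \<longleftrightarrow> _")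
  proof
    assume ?L
    then obtain r' as' where *: "length as' = 4" "\<forall>a \<in> set as'. a < b" "address b (r' # as') = address b (r # as)" "R r' as'"
      by blast
    have "r' # as' = r # as" by (rule address_inj[of _ _ b]) (use * as in \<open>auto simp del: address.simps\<close>)
    then show "R r as" using *(4) by simp
  next
    assume "R r as"
    then show ?L using as by blast
  qed
  then show "rel_of u (length x) r as = R r as"
    unfolding rel_of_def b_def[symmetric] using less by (simp add: u_def del: address.simps)
qed

theorem second_order_NP:
  assumes wf: "wf_fm \<phi>"
  shows "{x. \<exists>R. sat x R (\<lambda>_. 0) \<phi>} \<in> NP"
proof -
  obtain V where V: "vars \<phi> \<subseteq> {..<V}"
    using finite_nat_set_iff_bounded[THEN iffD1, OF finite_vars[of \<phi>]] by auto
  obtain n where n: "rels \<phi> \<subseteq> {..<n}"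
    using finite_nat_set_iff_bounded[THEN iffD1, OF finite_rels[of \<phi>]] by auto
  let ?m = "7 + V"
  define P where "P = init_all [3..<?m] ;; compile \<phi>"
  define M where "M = machine ?m P"
  obtain f where f: "polyb f" "\<And>x u e T. represents V x u e T \<Longrightarrow> (\<forall>v \<in> bound_vars \<phi>. e v = 0) \<Longrightarrow>
     exec (compile \<phi>) T (f (length x)) (T(2 := truth (sat x (rel_of u (length x)) e \<phi>)))"
    using compile_decides[OF wf V] unfolding decides_def by blast
  have wfP: "wf_prog ?m P"
    unfolding P_def using wf_prog_compile[OF wf V] by (simp add: wf_prog_init_all)
  define time where "time = (\<lambda>N. (4 + V) * (12 * N + 31) + 1 + f N + 1)"
  have run: "(\<forall>i>time (length x). halted M (tm_run M x u i)) \<and>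
      (tm_accepts M x u \<longleftrightarrow> sat x (rel_of u (length x)) (\<lambda>_. 0) \<phi>)" for x u
  proof -
    let ?N = "length x"
    define T where "T = (\<lambda>j :: nat. if j = 0 then word_tape x else if j = 1 then word_tape u else word_tape [])"
    let ?T = "\<lambda>j. if j \<in> set [3..<?m] then (unary ?N (val ?N (\<lambda>_. 0) j), 0)
         else if j = 2 then flag 1 else T j"
    have "exec (init_all [3..<?m]) T (length [3..<?m] * (12 * ?N + 31) + 1) ?T"
      by (rule exec_init_all) (auto simp: T_def)
    moreover have "represents V x u (\<lambda>_. 0) ?T"
      by (auto simp: represents_def ready_def T_def val_def)
    from f(2)[OF this] have "exec (compile \<phi>) ?T (f ?N) (?T(2 := truth (sat x (rel_of u ?N) (\<lambda>_. 0) \<phi>)))"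
      by simp
    ultimately have "exec P T (length [3..<?m] * (12 * ?N + 31) + 1 + f ?N + 1)
        (?T(2 := truth (sat x (rel_of u ?N) (\<lambda>_. 0) \<phi>)))"
      unfolding P_def by (rule exec_Seq)
    then have ex: "exec P T (time ?N) (?T(2 := truth (sat x (rel_of u ?N) (\<lambda>_. 0) \<phi>)))"
      by (rule exec_mono) (simp add: time_def)
    have "map T [0..<?m] = word_tape x # word_tape u # replicate (?m - 2) (word_tape [])"
      by (rule nth_equalityI) (auto simp: T_def nth_Cons split: nat.splits)
    then have init: "tm_init M x u = (enc P [P], map T [0..<?m])"
      by (simp add: tm_init_def M_def machine_def)
    from machine_run[OF _ wfP init[unfolded M_def] ex] show ?thesis
      unfolding M_def by (auto simp: truth_def flag_def)
  qed
  \<comment> \<open>The extra unit accounts for \<open>run\<close>, which guarantees halting only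
    strictly after \<open>time\<close>.\<close>
  obtain p :: "nat poly" where p: "\<And>N. time N + 1 = poly p N"
  proof -
    have "polyb (\<lambda>N. time N + 1)" unfolding time_def by (intro polyb_intros f)
    then show ?thesis using that unfolding polyb_def by auto
  qed
  obtain q :: "nat poly" where q: "\<And>N. n * ((N + 8) * (N + 8) * (N + 8) * (N + 8)) = poly q N"
  proof -
    have "polyb (\<lambda>N. n * ((N + 8) * (N + 8) * (N + 8) * (N + 8)))" by (intro polyb_intros)
    then show ?thesis using that unfolding polyb_def by auto
  qed
  have "wf_tm M" unfolding M_def by (rule wf_machine) (use wfP in auto)
  moreover have "polynomial_time M"
    unfolding polynomial_time_def
  proof (intro exI[of _ p] allI)
    fix x u :: "bool list"
    have "time (length x) < poly p (length x)" using p[of "length x"] by simp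
    also have "\<dots> \<le> poly p (length x + length u)" by (rule poly_nat_mono) simp
    finally show "halted M (tm_run M x u (poly p (length x + length u)))" using run by blast
  qed
  moreover have "x \<in> {x. \<exists>R. sat x R (\<lambda>_. 0) \<phi>} \<longleftrightarrow>
      (\<exists>u. length u \<le> poly q (length x) \<and> tm_accepts M x u)" for x
  proof
    assume "x \<in> {x. \<exists>R. sat x R (\<lambda>_. 0) \<phi>}"
    then obtain R where R: "sat x R (\<lambda>_. 0) \<phi>" by blast
    obtain u where u: "length u = n * (length x + 8) ^ 4"
      "\<And>r as. r < n \<Longrightarrow> length as = 4 \<Longrightarrow> \<forall>a \<in> set as. a < length x + 8 \<Longrightarrow> rel_of u (length x) r as = R r as"
      using rel_of_surj by blast
    have "sat x (rel_of u (length x)) (\<lambda>_. 0) \<phi> = sat x R (\<lambda>_. 0) \<phi>"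
      by (rule sat_cong) (use u(2) n wf in auto)
    moreover have "length u = poly q (length x)"
      unfolding u(1) q[symmetric] by (simp only: power4_eq_xxxx mult.assoc)
    ultimately show "\<exists>u. length u \<le> poly q (length x) \<and> tm_accepts M x u"
      using R run by (intro exI[of _ u]) simp
  next
    assume "\<exists>u. length u \<le> poly q (length x) \<and> tm_accepts M x u"
    then show "x \<in> {x. \<exists>R. sat x R (\<lambda>_. 0) \<phi>}" using run by blast
  qed
  ultimately show ?thesis unfolding NP_def by blast
qed

section \<open>A certificate for positivity\<close>

text \<open>The value \<open>v^T D C w\<close> for the diagonal matrix \<open>D\<close> with entries
  \<open>d\<close>. Vectors and matrices are functions of which only the indices below
  \<open>n\<close> are read, so that passing to leading blocks needs no change of carrier.\<close>

definition bform :: "nat \<Rightarrow> (nat \<Rightarrow> real) \<Rightarrow> (nat \<Rightarrow> nat \<Rightarrow> int) \<Rightarrow> (nat \<Rightarrow> real) \<Rightarrow> (nat \<Rightarrow> real) \<Rightarrow> real" where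
  "bform n d c v w = (\<Sum>i<n. v i * d i * (\<Sum>j<n. of_int (c i j) * w j))"

definition pos_form :: "nat \<Rightarrow> (nat \<Rightarrow> real) \<Rightarrow> (nat \<Rightarrow> nat \<Rightarrow> int) \<Rightarrow> bool" where
  "pos_form n d c \<longleftrightarrow> (\<forall>v. (\<exists>i<n. v i \<noteq> 0) \<longrightarrow> bform n d c v v > 0)"

definition symm_by :: "nat \<Rightarrow> (nat \<Rightarrow> real) \<Rightarrow> (nat \<Rightarrow> nat \<Rightarrow> int) \<Rightarrow> bool" where
  "symm_by n d c \<longleftrightarrow> (\<forall>i<n. d i > 0) \<and> (\<forall>i<n. \<forall>j<n. d i * of_int (c i j) = d j * of_int (c j i))"

lemma bform_add_left: "bform n d c (\<lambda>i. v i + t * w i) z = bform n d c v z + t * bform n d c w z"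
  unfolding bform_def by (simp add: algebra_simps sum.distrib sum_distrib_left)

lemma bform_sym:
  assumes "symm_by n d c"
  shows "bform n d c v w = bform n d c w v"
proof -
  have "bform n d c v w = (\<Sum>i<n. \<Sum>j<n. v i * w j * (d i * of_int (c i j)))"
    unfolding bform_def by (simp add: sum_distrib_left algebra_simps)
  also have "\<dots> = (\<Sum>i<n. \<Sum>j<n. v i * w j * (d j * of_int (c j i)))"
    using assms by (intro sum.cong refl) (simp add: symm_by_def)
  also have "\<dots> = (\<Sum>j<n. \<Sum>i<n. v i * w j * (d j * of_int (c j i)))"
    by (rule sum.swap)
  also have "\<dots> = bform n d c w v"
    unfolding bform_def by (simp add: sum_distrib_left algebra_simps)
  finally show ?thesis .
qed

lemma bform_expand:
  assumes "symm_by n d c"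
  shows "bform n d c (\<lambda>i. v i + t * w i) (\<lambda>i. v i + t * w i)
    = bform n d c v v + 2 * t * bform n d c v w + t\<^sup>2 * bform n d c w w"
  using bform_sym[OF assms, of _ "\<lambda>i. v i + t * w i"] bform_sym[OF assms, of w v]
  by (simp add: bform_add_left algebra_simps power2_eq_square)

text \<open>
  The vectors \<open>u k\<close> form an orthogonal basis adapted to the flag of coordinate subspaces;
  row scaling by the symmetrizer does not change the conditions on them, so it does not occur.
\<close>

definition pos_witness :: "nat \<Rightarrow> (nat \<Rightarrow> nat \<Rightarrow> int) \<Rightarrow> (nat \<Rightarrow> nat \<Rightarrow> int) \<Rightarrow> bool" where
  "pos_witness n c u \<longleftrightarrow> (\<forall>k<n. u k k > 0 \<and> (\<Sum>i<Suc k. c k i * u k i) > 0 \<and>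
     (\<forall>j<k. (\<Sum>i<Suc k. c j i * u k i) = 0))"

text \<open>Induction on the length \<open>m\<close> of the support: subtracting the multiple
  \<open>t\<close> of \<open>U\<close> that clears the last coordinate leaves a shorter vector
  \<open>w\<close> orthogonal to \<open>U\<close>, so the form of \<open>v\<close> is that of
  \<open>w\<close> plus \<open>t^2\<close> times a positive number.\<close>

lemma pos_witness_sound:
  assumes sym: "symm_by n d c" and u: "pos_witness n c u"
  shows "pos_form n d c"
proof -
  have "bform n d c v v > 0" if "m \<le> n" "\<forall>i. m \<le> i \<longrightarrow> v i = 0" "\<exists>i<n. v i \<noteq> 0" for m v
    using that
  proof (induction m arbitrary: v)
    case 0
    then show ?case by simp
  next
    case (Suc m)
    define U where "U = (\<lambda>i. if i \<le> m then real_of_int (u m i) else 0)"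
    define t where "t = v m / U m"
    define w where "w = (\<lambda>i. v i - t * U i)"
    have m: "m < n" using Suc.prems by simp
    have dpos: "d m > 0" using sym m by (simp add: symm_by_def)
    have Um: "U m > 0" using u m by (simp add: U_def pos_witness_def)
    have cU: "(\<Sum>i<n. of_int (c j i) * U i) = of_int (\<Sum>i<Suc m. c j i * u m i)" for j
    proof -
      have "(\<Sum>i<n. of_int (c j i) * U i) = (\<Sum>i<Suc m. of_int (c j i) * U i)"
        using m by (intro sum.mono_neutral_right) (auto simp: U_def)
      also have "\<dots> = (\<Sum>i<Suc m. of_int (c j i * u m i))"
        by (intro sum.cong refl) (simp add: U_def)
      finally show ?thesis by simp
    qed
    have U0: "(\<Sum>i<n. of_int (c j i) * U i) = 0" if "j < m" for j
      unfolding cU using u m that by (simp add: pos_witness_def del: sum.lessThan_Suc)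
    have Upos: "(\<Sum>i<n. of_int (c m i) * U i) > 0"
      unfolding cU of_int_0_less_iff using u m by (simp add: pos_witness_def del: sum.lessThan_Suc)
    have w0: "w i = 0" if "m \<le> i" for i
      using that Suc.prems(2) Um by (cases "i = m") (auto simp: w_def t_def U_def)
    \<comment> \<open>Where \<open>w\<close> can be nonzero, that is below \<open>m\<close>, the
      vector \<open>C U\<close> vanishes.\<close>
    have wU: "bform n d c w U = 0"
      unfolding bform_def
    proof (rule sum.neutral, rule ballI)
      fix i assume "i \<in> {..<n}"
      show "w i * d i * (\<Sum>j<n. of_int (c i j) * U j) = 0"
        using w0[of i] U0[of i] by (cases "i < m") auto
    qed
    have "bform n d c U U = (\<Sum>i\<in>{m}. U i * d i * (\<Sum>j<n. of_int (c i j) * U j))"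
      unfolding bform_def
    proof (rule sum.mono_neutral_right)
      show "\<forall>i\<in>{..<n} - {m}. U i * d i * (\<Sum>j<n. of_int (c i j) * U j) = 0"
      proof
        fix i assume "i \<in> {..<n} - {m}"
        then show "U i * d i * (\<Sum>j<n. of_int (c i j) * U j) = 0"
          using U0[of i] by (cases "i < m") (auto simp: U_def)
      qed
    qed (use m in auto)
    then have UU: "bform n d c U U > 0" using Um dpos Upos by simp
    have v: "v = (\<lambda>i. w i + t * U i)" by (simp add: w_def)
    have vv: "bform n d c v v = bform n d c w w + t\<^sup>2 * bform n d c U U"
      unfolding v using bform_expand[OF sym, of w t U] wU by simp
    show ?case
    proof (cases "\<exists>i<n. w i \<noteq> 0")
      case True
      then have "bform n d c w w > 0" using Suc.IH[of w] Suc.prems w0 by simp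
      then show ?thesis unfolding vv using UU by (simp add: add_pos_nonneg)
    next
      case False
      then have ww: "bform n d c w w = 0" by (simp add: bform_def)
      have "t \<noteq> 0"
      proof
        assume "t = 0"
        then have "v = w" by (simp add: v)
        then show False using Suc.prems(3) False by blast
      qed
      then show ?thesis unfolding vv ww using UU by simp
    qed
  qed
  then show ?thesis
    unfolding pos_form_def
  proof (intro allI impI)
    fix v :: "nat \<Rightarrow> real" assume v: "\<exists>i<n. v i \<noteq> 0"
    \<comment> \<open>The form reads only the indices below \<open>n\<close>, so cutting
      \<open>v\<close> off there makes it fit the induction without changing its value.\<close>
    let ?v = "\<lambda>i. if i < n then v i else 0"
    assume *: "\<And>m v. m \<le> n \<Longrightarrow> \<forall>i\<ge>m. v i = 0 \<Longrightarrow> \<exists>i<n. v i \<noteq> 0 \<Longrightarrow> 0 < bform n d c v v"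
    have "0 < bform n d c ?v ?v" by (rule *[of n]) (use v in auto)
    then show "0 < bform n d c v v" by (simp add: bform_def)
  qed
qed

section \<open>Small witnesses from Cramer's rule\<close>

lemma abs_det_le:
  fixes A :: "int mat"
  assumes A: "A \<in> carrier_mat k k" and b: "\<And>i j. i < k \<Longrightarrow> j < k \<Longrightarrow> \<bar>A $$ (i, j)\<bar> \<le> B"
  shows "\<bar>det A\<bar> \<le> fact k * B ^ k"
proof -
  have "\<bar>det A\<bar> \<le> (\<Sum>p \<in> {p. p permutes {0..<k}}. \<bar>signof p * (\<Prod>i = 0..<k. A $$ (i, p i))\<bar>)"
    unfolding det_def'[OF A] by (rule sum_abs)
  also have "\<dots> \<le> (\<Sum>p \<in> {p. p permutes {0..<k}}. B ^ k)"
  proof (rule sum_mono)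
    fix p assume "p \<in> {p. p permutes {0..<k}}"
    then have p: "p i < k" if "i < k" for i using that permutes_in_image[of p "{0..<k}" i] by auto
    have "\<bar>signof p * (\<Prod>i = 0..<k. A $$ (i, p i))\<bar> = (\<Prod>i = 0..<k. \<bar>A $$ (i, p i)\<bar>)"
      by (simp add: abs_mult abs_prod sign_def)
    also have "\<dots> \<le> (\<Prod>i = 0..<k. B)" using b p by (intro prod_mono) auto
    finally show "\<bar>signof p * (\<Prod>i = 0..<k. A $$ (i, p i))\<bar> \<le> B ^ k" by simp
  qed
  also have "\<dots> = fact k * B ^ k" by (simp add: card_permutations)
  finally show ?thesis .
qed

lemma pos_formD: "pos_form n d c \<Longrightarrow> i < n \<Longrightarrow> v i \<noteq> 0 \<Longrightarrow> 0 < bform n d c v v"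
  unfolding pos_form_def by auto

text \<open>Extension by zeros: leading principal blocks of a positive form are positive.\<close>

lemma pos_form_null:
  assumes pos: "pos_form n d c" and k: "k \<le> n" and v: "\<exists>i<k. v i \<noteq> 0"
  shows "(\<Sum>i<k. v i * d i * (\<Sum>j<k. of_int (c i j) * v j)) > 0"
proof -
  let ?v = "\<lambda>i. if i < k then v i else 0"
  obtain i where i: "i < k" "v i \<noteq> 0" using v by blast
  then have "0 < bform n d c ?v ?v" using pos_formD[OF pos, of i ?v] k by simp
  also have "bform n d c ?v ?v = (\<Sum>i<k. ?v i * d i * (\<Sum>j<n. of_int (c i j) * ?v j))"
    unfolding bform_def using k by (intro sum.mono_neutral_right) auto
  also have "\<dots> = (\<Sum>i<k. ?v i * d i * (\<Sum>j<k. of_int (c i j) * ?v j))"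
    using k by (intro sum.cong refl arg_cong2[of _ _ _ _ "(*)"] sum.mono_neutral_right) auto
  also have "\<dots> = (\<Sum>i<k. v i * d i * (\<Sum>j<k. of_int (c i j) * v j))" by simp
  finally show ?thesis .
qed

text \<open>The vector is the last column of the adjugate of the leading block \<open>A\<close> of
  size \<open>k + 1\<close>, multiplied by the sign of \<open>det A\<close>. By
  \<open>A adj(A) = det(A) I\<close> its image under \<open>A\<close> is \<open>|det A|\<close> in
  position \<open>k\<close> and 0 elsewhere; up to sign its entries are minors of size
  \<open>k\<close>, hence the bound.\<close>

lemma pos_witness_column:
  assumes sym: "symm_by n d c" and pos: "pos_form n d c" and k: "k < n"
    and b: "\<And>i j. i < n \<Longrightarrow> j < n \<Longrightarrow> \<bar>c i j\<bar> \<le> B"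
  shows "\<exists>u. u k > 0 \<and> (\<Sum>i<Suc k. c k i * u i) > 0 \<and> (\<forall>j<k. (\<Sum>i<Suc k. c j i * u i) = 0) \<and>
    (\<forall>i<Suc k. \<bar>u i\<bar> \<le> fact k * B ^ k)"
proof -
  define A where "A = mat (Suc k) (Suc k) (\<lambda>(i, j). c i j)"
  have A: "A \<in> carrier_mat (Suc k) (Suc k)" by (simp add: A_def)
  \<comment> \<open>A nonzero kernel vector of the block would make the form vanish at its extension
    by zeros.\<close>
  have "det A \<noteq> 0"
  proof
    assume "det A = 0"
    then have "det (map_mat real_of_int A) = 0" by (simp add: of_int_hom.hom_det)
    then obtain v where v: "v \<in> carrier_vec (Suc k)" "v \<noteq> 0\<^sub>v (Suc k)"
      "map_mat real_of_int A *\<^sub>v v = 0\<^sub>v (Suc k)"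
      using det_0_iff_vec_prod_zero_field[of "map_mat real_of_int A" "Suc k"] A by auto
    have "(\<Sum>j<Suc k. of_int (c i j) * v $ j) = 0" if "i < Suc k" for i
    proof -
      have "(\<Sum>j<Suc k. of_int (c i j) * v $ j) = (map_mat real_of_int A *\<^sub>v v) $ i"
        using that v(1) A by (simp add: scalar_prod_def A_def atLeast0LessThan)
      then show ?thesis using v(3) that by simp
    qed
    then have "(\<Sum>i<Suc k. v $ i * d i * (\<Sum>j<Suc k. of_int (c i j) * v $ j)) = 0"
      by (intro sum.neutral) simp
    moreover have "\<exists>i<Suc k. v $ i \<noteq> 0"
      using v(1,2) by (metis carrier_vecD eq_vecI index_zero_vec(1,2))
    ultimately show False using pos_form_null[OF pos, of "Suc k" "\<lambda>i. v $ i"] k by simp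
  qed
  define u where "u = (\<lambda>i. sgn (det A) * adj_mat A $$ (i, k))"
  have cu: "(\<Sum>i<Suc k. c j i * u i) = (if j = k then \<bar>det A\<bar> else 0)" if "j < Suc k" for j
  proof -
    have "(\<Sum>i<Suc k. c j i * adj_mat A $$ (i, k)) = (A * adj_mat A) $$ (j, k)"
      using that A adj_mat(1)[OF A] by (simp add: scalar_prod_def A_def atLeast0LessThan)
    also have "\<dots> = (if j = k then det A else 0)" using that adj_mat(2)[OF A] by simp
    finally have "(\<Sum>i<Suc k. c j i * adj_mat A $$ (i, k)) = (if j = k then det A else 0)" .
    moreover have "(\<Sum>i<Suc k. c j i * u i) = sgn (det A) * (\<Sum>i<Suc k. c j i * adj_mat A $$ (i, k))"
      unfolding u_def sum_distrib_left by (simp only: mult.left_commute)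
    ultimately show ?thesis by (simp add: abs_sgn[symmetric] mult.commute del: sum.lessThan_Suc)
  qed
  have "\<exists>i<Suc k. real_of_int (u i) \<noteq> 0"
  proof (rule ccontr)
    assume "\<not> ?thesis"
    then have "(\<Sum>i<Suc k. c k i * u i) = 0" by (intro sum.neutral) simp
    then show False using cu[of k] \<open>det A \<noteq> 0\<close> by simp
  qed
  \<comment> \<open>The form at \<open>u\<close> collapses to \<open>u_k d_k |det A|\<close>, so its
    positivity decides the sign of \<open>u_k\<close>.\<close>
  then have "0 < (\<Sum>i<Suc k. of_int (u i) * d i * (\<Sum>j<Suc k. of_int (c i j) * of_int (u j)))"
    using pos_form_null[OF pos, of "Suc k" "\<lambda>i. of_int (u i)"] k by simp
  also have "\<dots> = (\<Sum>i<Suc k. of_int (u i) * d i * of_int (if i = k then \<bar>det A\<bar> else 0))"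
  proof (intro sum.cong refl)
    fix i assume "i \<in> {..<Suc k}"
    then have "i < Suc k" by simp
    have "(\<Sum>j<Suc k. real_of_int (c i j) * of_int (u j)) = of_int (\<Sum>j<Suc k. c i j * u j)"
      by (simp del: sum.lessThan_Suc)
    then show "of_int (u i) * d i * (\<Sum>j<Suc k. of_int (c i j) * of_int (u j))
      = of_int (u i) * d i * of_int (if i = k then \<bar>det A\<bar> else 0)"
      unfolding cu[OF \<open>i < Suc k\<close>] by (simp only:)
  qed
  also have "\<dots> = of_int (u k) * d k * of_int \<bar>det A\<bar>" by simp
  finally have "0 < of_int (u k) * d k * of_int \<bar>det A\<bar>" .
  moreover have "d k > 0" using sym k by (simp add: symm_by_def)
  ultimately have "u k > 0" by (simp add: zero_less_mult_iff)
  moreover have "\<bar>u i\<bar> \<le> fact k * B ^ k" if "i < Suc k" for i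
  proof -
    have "\<bar>u i\<bar> \<le> \<bar>det (mat_delete A k i)\<bar>"
      using that A by (simp add: u_def adj_mat_def cofactor_def abs_mult abs_sgn_eq)
    also have "\<dots> \<le> fact k * B ^ k"
    proof (rule abs_det_le)
      show "mat_delete A k i \<in> carrier_mat k k" using mat_delete_carrier[OF A] by simp
      fix a e assume "a < k" "e < k"
      then show "\<bar>mat_delete A k i $$ (a, e)\<bar> \<le> B"
        using b k by (auto simp: mat_delete_def A_def)
    qed
    finally show ?thesis .
  qed
  ultimately show ?thesis
    using cu[of k] cu \<open>det A \<noteq> 0\<close> by (intro exI[of _ u]) (simp del: sum.lessThan_Suc)
qed

lemma pos_witness_complete:
  assumes "symm_by n d c" "pos_form n d c" "\<And>i j. i < n \<Longrightarrow> j < n \<Longrightarrow> \<bar>c i j\<bar> \<le> B"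
  obtains u where "pos_witness n c u" "\<And>k i. k < n \<Longrightarrow> i < Suc k \<Longrightarrow> \<bar>u k i\<bar> \<le> fact k * B ^ k"
proof -
  have "\<forall>k\<in>{..<n}. \<exists>u. u k > 0 \<and> (\<Sum>i<Suc k. c k i * u i) > 0 \<and> (\<forall>j<k. (\<Sum>i<Suc k. c j i * u i) = 0) \<and>
    (\<forall>i<Suc k. \<bar>u i\<bar> \<le> fact k * B ^ k)"
    using pos_witness_column[OF assms(1,2) _ assms(3)] by simp
  from bchoice[OF this] obtain u where u: "\<forall>k\<in>{..<n}. u k k > 0 \<and> (\<Sum>i<Suc k. c k i * u k i) > 0 \<and>
    (\<forall>j<k. (\<Sum>i<Suc k. c j i * u k i) = 0) \<and> (\<forall>i<Suc k. \<bar>u k i\<bar> \<le> fact k * B ^ k)"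
    by (elim exE)
  show ?thesis
    by (rule that[of u]) (use u in \<open>auto simp: pos_witness_def simp del: sum.lessThan_Suc\<close>)
qed

text \<open>The test vector \<open>2 e_j - c_ij e_i\<close> is chosen so that row \<open>i\<close>
  contributes 0; row \<open>j\<close> then gives \<open>2 d_j (4 - c_ij c_ji)\<close>.\<close>

lemma pos_form_rank2:
  assumes sym: "symm_by n d c" and pos: "pos_form n d c" and ij: "i < n" "j < n" "i \<noteq> j"
    and diag: "c i i = 2" "c j j = 2"
  shows "c i j * c j i < 4"
proof -
  have d: "d i > 0" "d j > 0" "d i * of_int (c i j) = d j * of_int (c j i)"
    using sym ij by (auto simp: symm_by_def)
  let ?v = "\<lambda>k. if k = i then - real_of_int (c i j) else if k = j then 2 else 0"
  have two: "(\<Sum>k<n. f k) = f i + f j" if "\<And>k. k \<noteq> i \<Longrightarrow> k \<noteq> j \<Longrightarrow> f k = 0" for f :: "nat \<Rightarrow> real"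
  proof -
    have "(\<Sum>k<n. f k) = (\<Sum>k\<in>{i, j}. f k)"
      using ij that by (intro sum.mono_neutral_right) auto
    then show ?thesis using ij by simp
  qed
  have "0 < bform n d c ?v ?v" using pos_formD[OF pos, of j ?v] ij by simp
  also have "bform n d c ?v ?v =
      - real_of_int (c i j) * d i * (2 * - real_of_int (c i j) + real_of_int (c i j) * 2)
      + 2 * d j * (of_int (c j i) * - real_of_int (c i j) + 2 * 2)"
    unfolding bform_def using ij diag by (simp add: two)
  finally have "0 < 2 * d j * (of_int (c j i) * - real_of_int (c i j) + 2 * 2)" by simp
  then have "of_int (c j i) * - real_of_int (c i j) + 2 * 2 > 0"
    using d by (simp add: zero_less_mult_iff)
  then have "real_of_int (c i j * c j i) < 4" by (simp add: algebra_simps)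
  then show ?thesis by linarith
qed

lemma symm_by_sign:
  assumes "symm_by n d c" "i < n" "j < n"
  shows "c i j > 0 \<longleftrightarrow> c j i > 0" "c i j = 0 \<longleftrightarrow> c j i = 0"
proof -
  have d: "d i > 0" "d j > 0" "d i * of_int (c i j) = d j * of_int (c j i)"
    using assms by (auto simp: symm_by_def)
  show "c i j > 0 \<longleftrightarrow> c j i > 0"
    using d by (metis of_int_0_less_iff zero_less_mult_pos mult_pos_pos)
  show "c i j = 0 \<longleftrightarrow> c j i = 0"
    using d by (metis less_irrefl mult_eq_0_iff of_int_eq_0_iff)
qed

section \<open>Potentials for symmetrizers\<close>

lemma pow_2_3_inj:
  assumes "(2 :: nat) ^ p * 3 ^ q = 2 ^ p' * 3 ^ q'"
  shows "p = p' \<and> q = q'"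
proof -
  have less: False if "(2 :: nat) ^ p * 3 ^ q = 2 ^ p' * 3 ^ q'" "p < p'" for p q p' q' :: nat
  proof -
    have "2 ^ p' = (2 :: nat) ^ p * 2 ^ (p' - p)" using that(2) by (simp flip: power_add)
    then have "(3 :: nat) ^ q = 2 ^ (p' - p) * 3 ^ q'" using that(1) by simp
    moreover have "even ((2 :: nat) ^ (p' - p) * 3 ^ q')" using that(2) by simp
    ultimately show False by (metis even_power odd_numeral)
  qed
  have "p = p'" using less[OF assms] less[OF assms[symmetric]] by (metis nat_neq_iff)
  then show ?thesis using assms by simp
qed

text \<open>The exponents of 2 and 3 in a magnitude between 1 and 3.\<close>

definition ex2 :: "nat \<Rightarrow> nat" where "ex2 w = of_bool (w = 2)"
definition ex3 :: "nat \<Rightarrow> nat" where "ex3 w = of_bool (w = 3)"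

lemma ex23: "w = 0 \<or> 3 < w \<or> w = 2 ^ ex2 w * 3 ^ ex3 w"
  by (auto simp: ex2_def ex3_def)

text \<open>Across an edge of the graph of nonzero weights the ratio of \<open>d\<close> is one of
  1, 2, 1/2, 3, 1/3, because the two weights have product below 4. Following a path from a fixed
  root of each component expresses \<open>d i\<close> as \<open>d\<close> of the root times powers
  of 2 and 3 whose exponents change by at most one per edge. Unique factorization then turns the
  symmetry of the weights into equations between exponents.\<close>

lemma potentials:
  fixes w :: "nat \<Rightarrow> nat \<Rightarrow> nat" and d :: "nat \<Rightarrow> real"
  assumes d: "\<And>i. i < n \<Longrightarrow> d i > 0"
    and sym: "\<And>i j. i < n \<Longrightarrow> j < n \<Longrightarrow> i \<noteq> j \<Longrightarrow> d i * w i j = d j * w j i"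
    and less4: "\<And>i j. i < n \<Longrightarrow> j < n \<Longrightarrow> i \<noteq> j \<Longrightarrow> w i j * w j i < 4"
  obtains \<alpha> \<beta> :: "nat \<Rightarrow> nat" where "\<And>i. i < n \<Longrightarrow> \<alpha> i \<le> 2 * (n * n)" "\<And>i. i < n \<Longrightarrow> \<beta> i \<le> 2 * (n * n)"
    "\<And>i j. i < n \<Longrightarrow> j < n \<Longrightarrow> i \<noteq> j \<Longrightarrow> w i j \<noteq> 0 \<Longrightarrow>
      \<alpha> i + ex2 (w i j) = \<alpha> j + ex2 (w j i) \<and> \<beta> i + ex3 (w i j) = \<beta> j + ex3 (w j i)"
proof -
  define E where "E = {(i, j). i < n \<and> j < n \<and> i \<noteq> j \<and> w i j \<noteq> 0}"
  \<comment> \<open>A bound on the number of edges and so on the length of a shortest walk. Starting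
    both exponents at \<open>K\<close> in the root keeps them natural along all such walks, and at
    most \<open>2 * K\<close>.\<close>
  define K where "K = n * n"
  have nz: "w j i \<noteq> 0" if "(i, j) \<in> E" for i j
  proof
    assume "w j i = 0"
    then have "d i * w i j = 0" using that sym[of i j] by (auto simp: E_def)
    then show False using that d[of i] by (auto simp: E_def)
  qed
  have symE: "(j, i) \<in> E" if "(i, j) \<in> E" for i j
    using that nz[OF that] by (auto simp: E_def)
  have "E \<subseteq> {..<n} \<times> {..<n}" by (auto simp: E_def)
  then have finE: "finite E" by (rule finite_subset) simp
  have "card E \<le> card ({..<n} \<times> {..<n})"
    using \<open>E \<subseteq> {..<n} \<times> {..<n}\<close> by (intro card_mono) auto
  then have cardE: "card E \<le> K" by (simp add: K_def)
  have cases: "(w i j, w j i) \<in> {(1, 1), (1, 2), (2, 1), (1, 3), (3, 1)}" if "(i, j) \<in> E" for i j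
  proof -
    have *: "w i j * w j i < 4" "w i j \<noteq> 0" "w j i \<noteq> 0" using that nz[OF that] less4 by (auto simp: E_def)
    have "w i j * 1 \<le> w i j * w j i" "1 * w j i \<le> w i j * w j i" using * by (intro mult_mono; simp)+
    then have "w i j \<le> 3" "w j i \<le> 3" using * by linarith+
    then have "w i j \<in> {1, 2, 3}" "w j i \<in> {1, 2, 3}" using *(2,3) by auto
    then show ?thesis using *(1) by auto
  qed
  have walk: "\<exists>a b. K \<le> a + m \<and> a \<le> K + m \<and> K \<le> b + m \<and> b \<le> K + m \<and>
      d i * (2 ^ K * 3 ^ K) = d r * (2 ^ a * 3 ^ b)" if "(r, i) \<in> E ^^ m" "m \<le> K" for r i m
    using that
  proof (induction m arbitrary: i)
    case 0
    then show ?case by auto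
  next
    case (Suc m)
    then obtain j where j: "(r, j) \<in> E ^^ m" "(j, i) \<in> E" by auto
    obtain a b where ab: "K \<le> a + m" "a \<le> K + m" "K \<le> b + m" "b \<le> K + m"
      "d j * (2 ^ K * 3 ^ K) = d r * (2 ^ a * 3 ^ b)" using Suc.IH[OF j(1)] Suc.prems(2) by auto
    have pos: "a > 0" "b > 0" using ab Suc.prems(2) by auto
    obtain a' where a': "a = Suc a'" using pos by (cases a) auto
    obtain b' where b': "b = Suc b'" using pos by (cases b) auto
    have s: "d j * w j i = d i * w i j" using sym j(2) by (auto simp: E_def)
    from cases[OF j(2)] consider "w j i = 1" "w i j = 1" | "w j i = 1" "w i j = 2" | "w j i = 2" "w i j = 1"
      | "w j i = 1" "w i j = 3" | "w j i = 3" "w i j = 1" by auto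
    then obtain a' b' q where q: "Suc (K + m) \<ge> a'" "Suc (K + m) \<ge> b'" "K \<le> Suc (a' + m)" "K \<le> Suc (b' + m)"
      "d i = q * d j" "q * (2 ^ a * 3 ^ b) = (2 ^ a' * 3 ^ b' :: real)"
    proof cases
      case 1
      show ?thesis by (rule that[of a b 1]) (use 1 s ab in auto)
    next
      case 2
      show ?thesis by (rule that[of a' b "1 / 2"]) (use 2 s ab a' in auto)
    next
      case 3
      show ?thesis by (rule that[of "Suc a" b 2]) (use 3 s ab in auto)
    next
      case 4
      show ?thesis by (rule that[of a b' "1 / 3"]) (use 4 s ab b' in auto)
    next
      case 5
      show ?thesis by (rule that[of a "Suc b" 3]) (use 5 s ab in auto)
    qed
    have "d i * (2 ^ K * 3 ^ K) = q * (d j * (2 ^ K * 3 ^ K))" using q(5) by simp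
    also have "\<dots> = d r * (q * (2 ^ a * 3 ^ b))" unfolding ab(5) by simp
    also have "\<dots> = d r * (2 ^ a' * 3 ^ b')" unfolding q(6) ..
    finally have "d i * (2 ^ K * 3 ^ K) = d r * (2 ^ a' * 3 ^ b')" .
    then show ?case using q by - (rule exI[of _ a'], rule exI[of _ b'], simp)
  qed
  \<comment> \<open>Vertices joined by an edge are reached from the same set of vertices, so the
    choice operator selects the same root for them.\<close>
  define \<rho> where "\<rho> i = (SOME r. (r, i) \<in> E\<^sup>*)" for i
  have \<rho>: "(\<rho> i, i) \<in> E\<^sup>*" for i unfolding \<rho>_def by (rule someI[of _ i]) simp
  have \<rho>_eq: "\<rho> i = \<rho> j" if "(i, j) \<in> E" for i j
  proof -
    have "(r, i) \<in> E\<^sup>* \<longleftrightarrow> (r, j) \<in> E\<^sup>*" for r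
      using that symE[OF that] by (meson rtrancl.rtrancl_into_rtrancl)
    then show ?thesis by (simp add: \<rho>_def)
  qed
  have "\<exists>a b. a \<le> 2 * K \<and> b \<le> 2 * K \<and> d i * (2 ^ K * 3 ^ K) = d (\<rho> i) * (2 ^ a * 3 ^ b)" for i
  proof -
    obtain m where m: "m \<le> card E" "(\<rho> i, i) \<in> E ^^ m"
      using \<rho>[of i] rtrancl_finite_eq_relpow[OF finE] by auto
    then have "m \<le> K" using cardE by simp
    from walk[OF m(2) this] obtain a b where ab: "a \<le> K + m" "b \<le> K + m"
      "d i * (2 ^ K * 3 ^ K) = d (\<rho> i) * (2 ^ a * 3 ^ b)" by blast
    show ?thesis by (rule exI[of _ a], rule exI[of _ b]) (use ab \<open>m \<le> K\<close> in auto)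
  qed
  then obtain \<alpha> \<beta> where ab: "\<And>i. \<alpha> i \<le> 2 * K" "\<And>i. \<beta> i \<le> 2 * K"
    "\<And>i. d i * (2 ^ K * 3 ^ K) = d (\<rho> i) * (2 ^ \<alpha> i * 3 ^ \<beta> i)" by metis
  show ?thesis
  proof (rule that[of \<alpha> \<beta>])
    fix i j assume ij: "i < n" "j < n" "i \<noteq> j" "w i j \<noteq> 0"
    then have E: "(i, j) \<in> E" by (simp add: E_def)
    \<comment> \<open>Either the root is \<open>i\<close> itself or an edge starts at it, so it is a
      valid index.\<close>
    have "\<rho> i < n"
      using \<rho>[of i] ij(1) by (cases rule: converse_rtranclE) (auto simp: E_def)
    then have dr: "d (\<rho> i) \<noteq> 0" using d[of "\<rho> i"] by simp
    have w: "w i j = 2 ^ ex2 (w i j) * 3 ^ ex3 (w i j)" "w j i = 2 ^ ex2 (w j i) * 3 ^ ex3 (w j i)"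
      using cases[OF E] by (auto simp: ex2_def ex3_def)
    have "d (\<rho> i) * (2 ^ \<alpha> i * 3 ^ \<beta> i) * w i j = d i * w i j * (2 ^ K * 3 ^ K)"
      using arg_cong[OF ab(3)[of i, symmetric], of "\<lambda>t. t * real (w i j)"] by (simp add: mult_ac)
    also have "\<dots> = d j * w j i * (2 ^ K * 3 ^ K)" using sym[OF ij(1,2,3)] by simp
    also have "\<dots> = d (\<rho> i) * (2 ^ \<alpha> j * 3 ^ \<beta> j) * w j i"
      using arg_cong[OF ab(3)[of j], of "\<lambda>t. t * real (w j i)"] \<rho>_eq[OF E] by (simp add: mult_ac)
    finally have "(2 ^ \<alpha> i * 3 ^ \<beta> i) * real (w i j) = (2 ^ \<alpha> j * 3 ^ \<beta> j) * real (w j i)"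
      using dr by (simp only: mult.assoc mult_cancel_left) simp
    then have "real ((2 ^ \<alpha> i * 3 ^ \<beta> i) * w i j) = real ((2 ^ \<alpha> j * 3 ^ \<beta> j) * w j i)" by simp
    then have "(2 ^ \<alpha> i * 3 ^ \<beta> i) * w i j = (2 ^ \<alpha> j * 3 ^ \<beta> j) * w j i" by (simp only: of_nat_eq_iff)
    then have "2 ^ (\<alpha> i + ex2 (w i j)) * 3 ^ (\<beta> i + ex3 (w i j))
      = (2 :: nat) ^ (\<alpha> j + ex2 (w j i)) * 3 ^ (\<beta> j + ex3 (w j i))"
      by (subst (asm) w(1), subst (asm) w(2)) (simp only: power_add mult_ac)
    then show "\<alpha> i + ex2 (w i j) = \<alpha> j + ex2 (w j i) \<and> \<beta> i + ex3 (w i j) = \<beta> j + ex3 (w j i)"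
      by (rule pow_2_3_inj)
  qed (use ab in \<open>simp_all add: K_def\<close>)
qed

section \<open>Binary addition with bounded carries\<close>

definition nval :: "nat \<Rightarrow> (nat \<Rightarrow> bool) \<Rightarrow> nat" where
  "nval M f = (\<Sum>b<M. of_bool (f b) * 2 ^ b)"

text \<open>The digit equations, weighted by \<open>2^b\<close>, telescope: every carry cancels
  except the outgoing one, which has weight \<open>2^M\<close>.\<close>

lemma adder_sound:
  assumes "\<And>b. b < M \<Longrightarrow> of_bool (z b) + 2 * c (Suc b) = of_bool (x b) + m * of_bool (y b) + c b"
    and "c 0 = (0 :: nat)"
  shows "nval M z + 2 ^ M * c M = nval M x + m * nval M y"
  using assms(1)
proof (induction M)
  case (Suc M)
  have "nval (Suc M) z + 2 ^ Suc M * c (Suc M) = nval M z + 2 ^ M * (of_bool (z M) + 2 * c (Suc M))"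
    by (simp add: nval_def algebra_simps)
  also have "\<dots> = nval M z + 2 ^ M * c M + 2 ^ M * (of_bool (x M) + m * of_bool (y M))"
    using Suc.prems[of M] by (simp add: algebra_simps)
  also have "\<dots> = nval (Suc M) x + m * nval (Suc M) y"
    using Suc by (simp add: nval_def algebra_simps)
  finally show ?case .
qed (use assms(2) in \<open>simp add: nval_def\<close>)

text \<open>What remains above position \<open>b\<close> when the low \<open>b\<close> bits of
  \<open>x\<close> are added to \<open>m\<close> times the low \<open>b\<close> bits of
  \<open>y\<close>. The multiplication by \<open>m\<close> happens inside the adder, so carries can
  exceed 1.\<close>

definition carry :: "nat \<Rightarrow> nat \<Rightarrow> nat \<Rightarrow> nat \<Rightarrow> nat" where
  "carry x m y b = (x mod 2 ^ b + m * (y mod 2 ^ b)) div 2 ^ b"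

lemma mod_pow_Suc: "(x :: nat) mod 2 ^ Suc b = x mod 2 ^ b + 2 ^ b * of_bool (bit x b)"
  by (simp add: mod_mult2_eq' mod2_eq_if bit_iff_odd power_Suc2 del: power_Suc)
     (simp add: mod_mult2_eq mod2_eq_if)

text \<open>The sum of the low parts is \<open>2^b\<close> times the carry plus the low bits of the
  result; comparing this for \<open>b\<close> and \<open>b + 1\<close> and cancelling
  \<open>2^b\<close> gives the digit equation.\<close>

lemma carry_step:
  "of_bool (bit (x + m * y) b) + 2 * carry x m y (Suc b)
    = of_bool (bit x b) + m * of_bool (bit y b) + carry x m y b"
proof -
  let ?z = "x + m * y" and ?s = "\<lambda>b. x mod 2 ^ b + m * (y mod 2 ^ b)"
  have s: "?s b = 2 ^ b * carry x m y b + ?z mod 2 ^ b" for b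
  proof -
    have "?s b mod 2 ^ b = ?z mod 2 ^ b" by (intro mod_add_cong) (simp_all add: mod_mult_right_eq)
    then show ?thesis unfolding carry_def by (metis mult_div_mod_eq)
  qed
  have "2 ^ Suc b * carry x m y (Suc b) + (?z mod 2 ^ b + 2 ^ b * of_bool (bit ?z b)) = ?s (Suc b)"
    using s[of "Suc b"] unfolding mod_pow_Suc[of ?z] by simp
  also have "\<dots> = ?s b + 2 ^ b * (of_bool (bit x b) + m * of_bool (bit y b))"
    unfolding mod_pow_Suc by (simp add: algebra_simps)
  finally have "2 ^ b * (2 * carry x m y (Suc b) + of_bool (bit ?z b))
      = 2 ^ b * (carry x m y b + (of_bool (bit x b) + m * of_bool (bit y b)))"
    unfolding s[of b] by (simp add: algebra_simps)
  then show ?thesis by simp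
qed

lemma carry_0: "carry x m y 0 = 0"
  by (simp add: carry_def)

text \<open>Two low parts below \<open>2^b\<close>, one of them taken at most three times, sum to
  less than \<open>4 * 2^b\<close>; this is why two relations suffice for the bits of a
  carry.\<close>

lemma carry_less: "m \<le> 3 \<Longrightarrow> carry x m y b < 4"
proof -
  assume m: "m \<le> 3"
  have "x mod 2 ^ b < 2 ^ b" "y mod 2 ^ b < 2 ^ b" by simp_all
  moreover have "m * (y mod 2 ^ b) \<le> 3 * (y mod 2 ^ b)" using m by (rule mult_right_mono) simp
  ultimately have "x mod 2 ^ b + m * (y mod 2 ^ b) < 4 * 2 ^ b" by linarith
  then show ?thesis unfolding carry_def by (simp add: less_mult_imp_div_less)
qed

lemma carry_top: "x + m * y < 2 ^ M \<Longrightarrow> carry x m y M = 0"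
proof -
  assume *: "x + m * y < 2 ^ M"
  have "x mod 2 ^ M + m * (y mod 2 ^ M) \<le> x + m * y" by (intro add_mono mult_left_mono) auto
  then show ?thesis unfolding carry_def using * by (intro div_less) linarith
qed

section \<open>Matrices with a diagonal factor\<close>

lemma diagonal_mult_index:
  assumes "D \<in> carrier_mat n n" "diagonal_mat D" "A \<in> carrier_mat n n" "i < n" "j < n"
  shows "(D * A) $$ (i, j) = D $$ (i, i) * (A $$ (i, j) :: real)"
proof -
  have "(D * A) $$ (i, j) = (\<Sum>k<n. D $$ (i, k) * A $$ (k, j))"
    using assms by (simp add: scalar_prod_def atLeast0LessThan)
  also have "\<dots> = (\<Sum>k\<in>{i}. D $$ (i, k) * A $$ (k, j))"
    using assms by (intro sum.mono_neutral_right) (auto simp: diagonal_mat_def)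
  finally show ?thesis by simp
qed

lemma transpose_eq_iff:
  assumes G: "G \<in> carrier_mat n n"
  shows "transpose_mat G = G \<longleftrightarrow> (\<forall>i<n. \<forall>j<n. G $$ (j, i) = G $$ (i, j))"
proof
  assume *: "transpose_mat G = G"
  show "\<forall>i<n. \<forall>j<n. G $$ (j, i) = G $$ (i, j)"
  proof (intro allI impI)
    fix i j assume ij: "i < n" "j < n"
    then have "G $$ (j, i) = transpose_mat G $$ (i, j)" using G by simp
    then show "G $$ (j, i) = G $$ (i, j)" using * by simp
  qed
qed (use G in \<open>auto intro!: eq_matI\<close>)

lemma transpose_eq_uminus_iff:
  fixes G :: "real mat"
  assumes G: "G \<in> carrier_mat n n"
  shows "transpose_mat G = - G \<longleftrightarrow> (\<forall>i<n. \<forall>j<n. G $$ (j, i) = - G $$ (i, j))"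
proof
  assume *: "transpose_mat G = - G"
  show "\<forall>i<n. \<forall>j<n. G $$ (j, i) = - G $$ (i, j)"
  proof (intro allI impI)
    fix i j assume ij: "i < n" "j < n"
    then have "G $$ (j, i) = transpose_mat G $$ (i, j)" using G by simp
    then show "G $$ (j, i) = - G $$ (i, j)" using * G ij by simp
  qed
next
  assume *: "\<forall>i<n. \<forall>j<n. G $$ (j, i) = - G $$ (i, j)"
  show "transpose_mat G = - G"
  proof (rule eq_matI)
    fix i j assume "i < dim_row (- G)" "j < dim_col (- G)"
    then have ij: "i < n" "j < n" using G by auto
    then have "transpose_mat G $$ (i, j) = G $$ (j, i)" "(- G) $$ (i, j) = - G $$ (i, j)" using G by auto
    then show "transpose_mat G $$ (i, j) = (- G) $$ (i, j)" using * ij by metis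
  qed (use G in auto)
qed

lemma quadratic_form_index:
  fixes G :: "real mat"
  assumes "G \<in> carrier_mat n n" "v \<in> carrier_vec n"
  shows "v \<bullet> (G *\<^sub>v v) = (\<Sum>i<n. v $ i * (\<Sum>j<n. G $$ (i, j) * v $ j))"
  using assms by (auto simp: scalar_prod_def atLeast0LessThan intro!: sum.cong)

definition diag_of :: "nat \<Rightarrow> (nat \<Rightarrow> real) \<Rightarrow> real mat" where
  "diag_of n d = mat n n (\<lambda>(i, j). if i = j then d i else 0)"

lemma positive_diag_of: "positive_diagonal_mat n (diag_of n d) \<longleftrightarrow> (\<forall>i<n. d i > 0)"
  by (auto simp: positive_diagonal_mat_def diag_of_def diagonal_mat_def)

lemma symmetrizer_iff:
  assumes "C \<in> carrier_mat n n"
  shows "symmetrizer D C \<longleftrightarrow> positive_diagonal_mat n D \<and> symm_by n (\<lambda>i. D $$ (i, i)) (\<lambda>i j. C $$ (i, j))"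
proof (cases "positive_diagonal_mat n D")
  case True
  let ?G = "D * map_mat real_of_int C"
  have D: "D \<in> carrier_mat n n" "diagonal_mat D" using True by (auto simp: positive_diagonal_mat_def)
  have G: "?G \<in> carrier_mat n n" using D assms by auto
  have ix: "?G $$ (i, j) = D $$ (i, i) * of_int (C $$ (i, j))" if "i < n" "j < n" for i j
    using diagonal_mult_index[OF D _ that, of "map_mat real_of_int C"] assms that by auto
  have "transpose_mat ?G = ?G \<longleftrightarrow> (\<forall>i<n. \<forall>j<n. ?G $$ (j, i) = ?G $$ (i, j))"
    by (rule transpose_eq_iff[OF G])
  then show ?thesis
    using True assms ix by (auto simp: symmetrizer_def symmetric_mat_def symm_by_def positive_diagonal_mat_def)
qed (use assms in \<open>auto simp: symmetrizer_def\<close>)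

lemma positive_definite_iff:
  assumes C: "C \<in> carrier_mat n n" and D: "symmetrizer D C"
  shows "positive_definite_mat (D * map_mat real_of_int C)
    \<longleftrightarrow> pos_form n (\<lambda>i. D $$ (i, i)) (\<lambda>i j. C $$ (i, j))"
proof -
  let ?G = "D * map_mat real_of_int C" and ?q = "bform n (\<lambda>i. D $$ (i, i)) (\<lambda>i j. C $$ (i, j))"
  have D': "D \<in> carrier_mat n n" "diagonal_mat D"
    using D C by (auto simp: symmetrizer_def positive_diagonal_mat_def)
  have G: "?G \<in> carrier_mat n n" using D' C by auto
  have ix: "?G $$ (i, j) = D $$ (i, i) * of_int (C $$ (i, j))" if "i < n" "j < n" for i j
    using diagonal_mult_index[OF D' _ that, of "map_mat real_of_int C"] C that by auto
  have q: "v \<bullet> (?G *\<^sub>v v) = ?q (($) v) (($) v)" if v: "v \<in> carrier_vec n" for v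
  proof -
    have "v \<bullet> (?G *\<^sub>v v) = (\<Sum>i<n. v $ i * (\<Sum>j<n. ?G $$ (i, j) * v $ j))"
      by (rule quadratic_form_index[OF G v])
    also have "\<dots> = (\<Sum>i<n. v $ i * (\<Sum>j<n. D $$ (i, i) * of_int (C $$ (i, j)) * v $ j))"
      using ix by (intro sum.cong refl arg_cong2[of _ _ _ _ "(*)"]) auto
    also have "\<dots> = ?q (($) v) (($) v)"
      unfolding bform_def by (simp add: sum_distrib_left algebra_simps)
    finally show ?thesis .
  qed
  have dim: "dim_row ?G = n" using D'(1) by simp
  show ?thesis
  proof
    assume *: "positive_definite_mat ?G"
    show "pos_form n (\<lambda>i. D $$ (i, i)) (\<lambda>i j. C $$ (i, j))"
      unfolding pos_form_def
    proof (intro allI impI, elim exE conjE)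
      fix v :: "nat \<Rightarrow> real" and i assume i: "i < n" "v i \<noteq> 0"
      let ?v = "vec n v"
      have "?v \<noteq> 0\<^sub>v n" using i by (metis index_vec index_zero_vec(1))
      then have "?v \<bullet> (?G *\<^sub>v ?v) > 0"
        using * unfolding positive_definite_mat_def dim by simp
      then have "0 < ?q (($) ?v) (($) ?v)" using q[of ?v] by simp
      also have "?q (($) ?v) (($) ?v) = ?q v v" by (simp add: bform_def)
      finally show "0 < ?q v v" .
    qed
  next
    assume *: "pos_form n (\<lambda>i. D $$ (i, i)) (\<lambda>i j. C $$ (i, j))"
    have "0 < v \<bullet> (?G *\<^sub>v v)" if v: "v \<in> carrier_vec n" "v \<noteq> 0\<^sub>v n" for v
    proof -
      obtain i where "i < n" "v $ i \<noteq> 0"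
        using v by (metis carrier_vecD eq_vecI index_zero_vec(1,2))
      then show ?thesis unfolding q[OF v(1)] by (rule pos_formD[OF *])
    qed
    then show "positive_definite_mat ?G"
      using D unfolding positive_definite_mat_def dim symmetrizer_def by simp
  qed
qed

lemma positive_quasi_Cartan_iff:
  assumes C: "C \<in> carrier_mat n n"
  shows "positive_quasi_Cartan C \<longleftrightarrow> (\<forall>i<n. C $$ (i, i) = 2) \<and>
    (\<exists>d. symm_by n d (\<lambda>i j. C $$ (i, j)) \<and> pos_form n d (\<lambda>i j. C $$ (i, j)))"
proof
  assume *: "positive_quasi_Cartan C"
  then obtain D where "symmetrizer D C" "positive_definite_mat (D * map_mat real_of_int C)"
    by (auto simp: positive_quasi_Cartan_def)
  then show "(\<forall>i<n. C $$ (i, i) = 2) \<and>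
    (\<exists>d. symm_by n d (\<lambda>i j. C $$ (i, j)) \<and> pos_form n d (\<lambda>i j. C $$ (i, j)))"
    using * C symmetrizer_iff[OF C] positive_definite_iff[OF C]
    by (auto simp: positive_quasi_Cartan_def quasi_Cartan_def)
next
  assume *: "(\<forall>i<n. C $$ (i, i) = 2) \<and>
    (\<exists>d. symm_by n d (\<lambda>i j. C $$ (i, j)) \<and> pos_form n d (\<lambda>i j. C $$ (i, j)))"
  then obtain d where d: "symm_by n d (\<lambda>i j. C $$ (i, j))" "pos_form n d (\<lambda>i j. C $$ (i, j))" by blast
  let ?D = "diag_of n d"
  have "symm_by n (\<lambda>i. ?D $$ (i, i)) (\<lambda>i j. C $$ (i, j))"
    using d(1) by (simp add: symm_by_def diag_of_def)
  moreover have "positive_diagonal_mat n ?D" using d(1) by (simp add: positive_diag_of symm_by_def)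
  ultimately have D: "symmetrizer ?D C" unfolding symmetrizer_iff[OF C] by simp
  have "pos_form n (\<lambda>i. ?D $$ (i, i)) (\<lambda>i j. C $$ (i, j))"
    using d(2) by (simp add: pos_form_def bform_def diag_of_def)
  then have "positive_definite_mat (?D * map_mat real_of_int C)" using positive_definite_iff[OF C D] by simp
  then show "positive_quasi_Cartan C"
    using D * C by (auto simp: positive_quasi_Cartan_def quasi_Cartan_def symmetrizable_def)
qed

lemma skew_symmetrizable_iff:
  assumes B: "B \<in> carrier_mat n n"
  shows "skew_symmetrizable B \<longleftrightarrow> (\<exists>d :: nat \<Rightarrow> real. (\<forall>i<n. d i > 0) \<and>
    (\<forall>i<n. \<forall>j<n. d i * of_int (B $$ (i, j)) = - (d j * of_int (B $$ (j, i)))))"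
proof -
  have skew: "skew_symmetric_mat (D * map_mat real_of_int B) \<longleftrightarrow>
      (\<forall>i<n. \<forall>j<n. D $$ (i, i) * of_int (B $$ (i, j)) = - (D $$ (j, j) * of_int (B $$ (j, i))))"
    if "positive_diagonal_mat n D" for D
  proof -
    let ?G = "D * map_mat real_of_int B"
    have D: "D \<in> carrier_mat n n" "diagonal_mat D" using that by (auto simp: positive_diagonal_mat_def)
    have G: "?G \<in> carrier_mat n n" using D B by auto
    have ix: "?G $$ (i, j) = D $$ (i, i) * of_int (B $$ (i, j))" if "i < n" "j < n" for i j
      using diagonal_mult_index[OF D _ that, of "map_mat real_of_int B"] B that by auto
    have "transpose_mat ?G = - ?G \<longleftrightarrow> (\<forall>i<n. \<forall>j<n. ?G $$ (j, i) = - ?G $$ (i, j))"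
      by (rule transpose_eq_uminus_iff[OF G])
    then show ?thesis using ix by (auto simp: skew_symmetric_mat_def)
  qed
  show ?thesis
  proof
    assume "skew_symmetrizable B"
    then obtain D where D: "positive_diagonal_mat n D" "skew_symmetric_mat (D * map_mat real_of_int B)"
      using B by (auto simp: skew_symmetrizable_def)
    show "\<exists>d :: nat \<Rightarrow> real. (\<forall>i<n. d i > 0) \<and>
      (\<forall>i<n. \<forall>j<n. d i * of_int (B $$ (i, j)) = - (d j * of_int (B $$ (j, i))))"
    proof (intro exI conjI)
      show "\<forall>i<n. D $$ (i, i) > 0" using D(1) by (simp add: positive_diagonal_mat_def)
      show "\<forall>i<n. \<forall>j<n. D $$ (i, i) * of_int (B $$ (i, j)) = - (D $$ (j, j) * of_int (B $$ (j, i)))"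
        using skew[OF D(1)] D(2) by blast
    qed
  next
    assume "\<exists>d :: nat \<Rightarrow> real. (\<forall>i<n. d i > 0) \<and>
      (\<forall>i<n. \<forall>j<n. d i * of_int (B $$ (i, j)) = - (d j * of_int (B $$ (j, i))))"
    then obtain d :: "nat \<Rightarrow> real" where d: "\<forall>i<n. d i > 0"
      "\<forall>i<n. \<forall>j<n. d i * of_int (B $$ (i, j)) = - (d j * of_int (B $$ (j, i)))" by blast
    let ?D = "diag_of n d"
    have pd: "positive_diagonal_mat n ?D" using d(1) by (simp add: positive_diag_of)
    have "\<forall>i<n. \<forall>j<n. ?D $$ (i, i) * of_int (B $$ (i, j)) = - (?D $$ (j, j) * of_int (B $$ (j, i)))"
    proof (intro allI impI)
      fix i j assume ij: "i < n" "j < n"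
      have D: "?D $$ (i, i) = d i" "?D $$ (j, j) = d j" using ij by (simp_all add: diag_of_def)
      show "?D $$ (i, i) * of_int (B $$ (i, j)) = - (?D $$ (j, j) * of_int (B $$ (j, i)))"
        unfolding D using d(2) ij by blast
    qed
    then have "skew_symmetric_mat (?D * map_mat real_of_int B)" using skew[OF pd] by blast
    then show "skew_symmetrizable B" using pd B unfolding skew_symmetrizable_def by auto
  qed
qed

section \<open>Derived connectives\<close>

definition FImp :: "fm \<Rightarrow> fm \<Rightarrow> fm" where "FImp \<phi> \<psi> = FNot (FAnd \<phi> (FNot \<psi>))"
definition FOr :: "fm \<Rightarrow> fm \<Rightarrow> fm" where "FOr \<phi> \<psi> = FNot (FAnd (FNot \<phi>) (FNot \<psi>))"
definition FEx :: "nat \<Rightarrow> fm \<Rightarrow> fm" where "FEx v \<phi> = FNot (FAll v (FNot \<phi>))"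
definition FTrue :: fm where "FTrue = FNot (FLess 0 0)"
definition FEq :: "nat \<Rightarrow> nat \<Rightarrow> fm" where "FEq v w = FAnd (FNot (FLess v w)) (FNot (FLess w v))"
definition FConj :: "fm list \<Rightarrow> fm" where "FConj \<phi>s = foldr FAnd \<phi>s FTrue"
definition FDisj :: "fm list \<Rightarrow> fm" where "FDisj \<phi>s = foldr FOr \<phi>s (FNot FTrue)"

text \<open>Variable 8 is reserved as the auxiliary variable of \<open>FSuc\<close>.\<close>

definition FSuc :: "nat \<Rightarrow> nat \<Rightarrow> fm" where
  "FSuc v w = FAnd (FLess v w) (FAll 8 (FNot (FAnd (FLess v 8) (FLess 8 w))))"

definition FAllLess :: "nat \<Rightarrow> nat \<Rightarrow> fm \<Rightarrow> fm" where
  "FAllLess v w \<phi> = FAll v (FImp (FLess v w) \<phi>)"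

definition FAllLeq :: "nat \<Rightarrow> nat \<Rightarrow> fm \<Rightarrow> fm" where
  "FAllLeq v w \<phi> = FAll v (FImp (FNot (FLess w v)) \<phi>)"

text \<open>A truth table: \<open>f\<close> is an arbitrary Boolean function of the listed formulas,
  so conditions on digits can be given as computations on integers. The resulting formula is
  exponential in the length of the list, but the lists are fixed; later it is handled only through
  its characteristic rules.\<close>

fun FTab :: "fm list \<Rightarrow> (bool list \<Rightarrow> bool) \<Rightarrow> fm" where
  "FTab [] f = (if f [] then FTrue else FNot FTrue)"
| "FTab (\<phi> # \<phi>s) f = FOr (FAnd \<phi> (FTab \<phi>s (\<lambda>bs. f (True # bs)))) (FAnd (FNot \<phi>) (FTab \<phi>s (\<lambda>bs. f (False # bs))))"

lemma sat_derived [simp]: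
  "sat x R e (FImp \<phi> \<psi>) \<longleftrightarrow> (sat x R e \<phi> \<longrightarrow> sat x R e \<psi>)"
  "sat x R e (FOr \<phi> \<psi>) \<longleftrightarrow> sat x R e \<phi> \<or> sat x R e \<psi>"
  "sat x R e (FEx v \<phi>) \<longleftrightarrow> (\<exists>a \<le> length x. sat x R (e(v := a)) \<phi>)"
  "sat x R e FTrue"
  "sat x R e (FEq v w) \<longleftrightarrow> e v = e w"
  by (auto simp: FImp_def FOr_def FEx_def FTrue_def FEq_def)

lemma sat_FConj [simp]: "sat x R e (FConj \<phi>s) \<longleftrightarrow> (\<forall>\<phi> \<in> set \<phi>s. sat x R e \<phi>)"
  unfolding FConj_def by (induction \<phi>s) auto

lemma sat_FDisj [simp]: "sat x R e (FDisj \<phi>s) \<longleftrightarrow> (\<exists>\<phi> \<in> set \<phi>s. sat x R e \<phi>)"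
  unfolding FDisj_def by (induction \<phi>s) auto

lemma sat_FTab [simp]: "sat x R e (FTab \<phi>s f) \<longleftrightarrow> f (map (sat x R e) \<phi>s)"
proof (induction \<phi>s arbitrary: f)
  case (Cons \<phi> \<phi>s)
  show ?case
    unfolding FTab.simps sat_derived sat.simps
      Cons.IH[of "\<lambda>bs. f (True # bs)"] Cons.IH[of "\<lambda>bs. f (False # bs)"]
    by (cases "sat x R e \<phi>") simp_all
qed simp

lemma sat_FSuc [simp]:
  assumes "e w \<le> length x" "v \<noteq> 8" "w \<noteq> 8"
  shows "sat x R e (FSuc v w) \<longleftrightarrow> e w = Suc (e v)"
proof
  assume *: "sat x R e (FSuc v w)"
  show "e w = Suc (e v)"
  proof (rule ccontr)
    assume "e w \<noteq> Suc (e v)"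
    then have less: "Suc (e v) < e w" using * by (simp add: FSuc_def)
    then have "Suc (e v) \<le> length x" using assms(1) by simp
    moreover have "\<forall>a\<le>length x. e v < a \<longrightarrow> \<not> a < e w" using * assms by (simp add: FSuc_def)
    ultimately show False using less by blast
  qed
qed (use assms in \<open>auto simp: FSuc_def\<close>)

lemma sat_bounded [simp]:
  assumes "e w \<le> length x" "v \<noteq> w"
  shows "sat x R e (FAllLess v w \<phi>) \<longleftrightarrow> (\<forall>a < e w. sat x R (e(v := a)) \<phi>)"
    "sat x R e (FAllLeq v w \<phi>) \<longleftrightarrow> (\<forall>a \<le> e w. sat x R (e(v := a)) \<phi>)"
  using assms by (auto simp: FAllLess_def FAllLeq_def)

lemma wf_derived [simp]:
  "wf_fm (FImp \<phi> \<psi>) \<longleftrightarrow> wf_fm \<phi> \<and> wf_fm \<psi>"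
  "wf_fm (FOr \<phi> \<psi>) \<longleftrightarrow> wf_fm \<phi> \<and> wf_fm \<psi>"
  "wf_fm (FEx v \<phi>) \<longleftrightarrow> v \<notin> bound_vars \<phi> \<and> wf_fm \<phi>"
  "wf_fm FTrue" "wf_fm (FEq v w)" "wf_fm (FSuc v w)"
  "wf_fm (FAllLess v w \<phi>) \<longleftrightarrow> v \<notin> bound_vars \<phi> \<and> wf_fm \<phi>"
  "wf_fm (FAllLeq v w \<phi>) \<longleftrightarrow> v \<notin> bound_vars \<phi> \<and> wf_fm \<phi>"
  by (auto simp: FImp_def FOr_def FEx_def FTrue_def FEq_def FSuc_def FAllLess_def FAllLeq_def)

lemma bound_vars_derived [simp]:
  "bound_vars (FImp \<phi> \<psi>) = bound_vars \<phi> \<union> bound_vars \<psi>"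
  "bound_vars (FOr \<phi> \<psi>) = bound_vars \<phi> \<union> bound_vars \<psi>"
  "bound_vars (FEx v \<phi>) = insert v (bound_vars \<phi>)"
  "bound_vars FTrue = {}" "bound_vars (FEq v w) = {}" "bound_vars (FSuc v w) = {8}"
  "bound_vars (FAllLess v w \<phi>) = insert v (bound_vars \<phi>)"
  "bound_vars (FAllLeq v w \<phi>) = insert v (bound_vars \<phi>)"
  by (auto simp: FImp_def FOr_def FEx_def FTrue_def FEq_def FSuc_def FAllLess_def FAllLeq_def)

lemma wf_FConj [simp]: "wf_fm (FConj \<phi>s) \<longleftrightarrow> (\<forall>\<phi> \<in> set \<phi>s. wf_fm \<phi>)"
  unfolding FConj_def by (induction \<phi>s) auto

lemma wf_FDisj [simp]: "wf_fm (FDisj \<phi>s) \<longleftrightarrow> (\<forall>\<phi> \<in> set \<phi>s. wf_fm \<phi>)"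
  unfolding FDisj_def by (induction \<phi>s) auto

lemma wf_FTab [simp]: "wf_fm (FTab \<phi>s f) \<longleftrightarrow> (\<forall>\<phi> \<in> set \<phi>s. wf_fm \<phi>)"
  by (induction \<phi>s arbitrary: f) auto

lemma bound_vars_FConj [simp]: "bound_vars (FConj \<phi>s) = (\<Union>\<phi> \<in> set \<phi>s. bound_vars \<phi>)"
  unfolding FConj_def by (induction \<phi>s) auto

lemma bound_vars_FDisj [simp]: "bound_vars (FDisj \<phi>s) = (\<Union>\<phi> \<in> set \<phi>s. bound_vars \<phi>)"
  unfolding FDisj_def by (induction \<phi>s) auto

lemma bound_vars_FTab [simp]: "bound_vars (FTab \<phi>s f) = (\<Union>\<phi> \<in> set \<phi>s. bound_vars \<phi>)"
  by (induction \<phi>s arbitrary: f) auto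

declare FTab.simps [simp del]

section \<open>The formula\<close>

text \<open>
  Variables: 0 the number 0, 1 the number \<open>N = length x\<close>, 2 the dimension \<open>n\<close>; the others are bound locally.
  Relations (always of arity 4, padded with 0):
  0: the code of entry \<open>(i, j)\<close> starts at position \<open>p\<close> of the input;
  1, 2, 3: sign, low bit and high bit of \<open>b\<^bsub>ij\<^esub>\<close>;
  4: \<open>c\<^bsub>ij\<^esub>\<close> is negative;
  5, 6: the symmetrizing weight of \<open>i\<close> is \<open>2\<^sup>v\<close> (respectively \<open>3\<^sup>v\<close>) times a power of 3 (of 2);
  7, 8: sign and bits of \<open>u\<^bsub>ki\<^esub>\<close>;
  9: bits of \<open>2\<^sup>N\<close> plus the sum of \<open>c\<^bsub>ji'\<^esub> u\<^bsub>ki'\<^esub>\<close> over \<open>i' < i\<close>;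
  10, 11: low and high bit of the carries in the computation of these sums.
\<close>

definition entry :: "bool \<Rightarrow> bool \<Rightarrow> bool \<Rightarrow> int" where
  "entry s a b = (if s then -1 else 1) * (of_bool a + 2 * of_bool b)"

definition centry :: "bool \<Rightarrow> bool \<Rightarrow> int \<Rightarrow> int" where
  "centry diag neg b = (if diag then 2 else if neg then - \<bar>b\<bar> else \<bar>b\<bar>)"

text \<open>Read for both \<open>(i, j)\<close> and \<open>(j, i)\<close>, it gives \<open>B\<close>
  opposite and \<open>C\<close> equal signs across the diagonal. Up to the weights, which the
  potentials supply, this is skew-symmetrizability of \<open>B\<close> and symmetrizability of
  \<open>C\<close>.\<close>

definition sym_cond :: "bool \<Rightarrow> int \<Rightarrow> int \<Rightarrow> bool \<Rightarrow> bool \<Rightarrow> bool" where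
  "sym_cond diag b b' c c' \<longleftrightarrow> (if diag then b = 0 else
     (b = 0 \<longleftrightarrow> b' = 0) \<and> (b < 0 \<longleftrightarrow> b' > 0) \<and> c = c' \<and> \<bar>b\<bar> * \<bar>b'\<bar> < 4)"

text \<open>The equation \<open>v + ex |b| = w + ex |b'|\<close> without addition: as
  \<open>ex\<close> takes only the values 0 and 1, it says that \<open>v\<close> and
  \<open>w\<close> are equal or neighbours, which formulas can express.\<close>

definition pot_cond :: "(nat \<Rightarrow> nat) \<Rightarrow> int \<Rightarrow> int \<Rightarrow> bool \<Rightarrow> bool \<Rightarrow> bool \<Rightarrow> bool" where
  "pot_cond ex b b' same nxt prv \<longleftrightarrow> (b \<noteq> 0 \<longrightarrow>
     (if ex (nat \<bar>b\<bar>) = ex (nat \<bar>b'\<bar>) then same else if ex (nat \<bar>b'\<bar>) < ex (nat \<bar>b\<bar>) then nxt else prv))"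

text \<open>One column of the addition \<open>s' = s + c u\<close>. For \<open>c\<close> and
  \<open>u\<close> of opposite sign it is rearranged to \<open>s = s' + |c| |u|\<close>, so that
  only natural numbers are added; \<open>c0, c1\<close> are the bits of the incoming and
  \<open>d0, d1\<close> those of the outgoing carry.\<close>

definition add_cond :: "int \<Rightarrow> bool \<Rightarrow> bool \<Rightarrow> bool \<Rightarrow> bool \<Rightarrow> bool \<Rightarrow> bool \<Rightarrow> bool \<Rightarrow> bool \<Rightarrow> bool" where
  "add_cond c us s s' u c0 c1 d0 d1 \<longleftrightarrow> (let opp = ((c < 0) \<noteq> us) in
     of_bool (if opp then s else s') + 2 * (of_bool d0 + 2 * of_bool d1)
     = of_bool (if opp then s' else s) + nat \<bar>c\<bar> * of_bool u + (of_bool c0 + 2 * of_bool c1))"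

definition F2 :: "nat \<Rightarrow> nat \<Rightarrow> nat \<Rightarrow> fm" where
  "F2 r v w = FRel r [(v, 0), (w, 0), (0, 0), (0, 0)]"

definition F_dim :: fm where
  "F_dim = FAnd (FAllLess 3 2 (FSym 2 3 0)) (FSym 1 2 0)"

text \<open>With entries from -3 to 3 only seven codes occur, and each can be compared symbol by
  symbol. Their lengths are below 8, within the offsets allowed by \<open>wf_fm\<close>.\<close>

definition F_code :: "int \<Rightarrow> fm" where
  "F_code w = FConj ([FTab [F2 1 3 4, F2 2 3 4, F2 3 3 4] (\<lambda>bs. entry (bs ! 0) (bs ! 1) (bs ! 2) = w),
     FRel 0 [(3, 0), (4, 1), (5, length (encode_int w)), (0, 0)]] @
     map (\<lambda>t. FSym (if encode_int w ! t then 2 else 1) 5 t) [0..<length (encode_int w)])"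

definition F_codes :: fm where
  "F_codes = FDisj (map F_code [-3..3])"

definition F_parse :: fm where
  "F_parse = FConj [FRel 0 [(0, 0), (0, 0), (2, 1), (0, 0)],
     FAllLess 3 2 (FAllLess 4 2 (FAll 5 (FImp (FRel 0 [(3, 0), (4, 0), (5, 0), (0, 0)])
       F_codes))),
     FAllLess 3 2 (FAll 5 (FImp (FRel 0 [(3, 0), (2, 0), (5, 0), (0, 0)])
       (FRel 0 [(3, 1), (0, 0), (5, 0), (0, 0)]))),
     FAll 5 (FImp (FRel 0 [(2, 0), (0, 0), (5, 0), (0, 0)]) (FEq 5 1))]"

definition F_sym :: fm where
  "F_sym = FAllLess 3 2 (FAllLess 4 2 (FTab
     [FEq 3 4, F2 1 3 4, F2 2 3 4, F2 3 3 4, F2 1 4 3, F2 2 4 3, F2 3 4 3, F2 4 3 4, F2 4 4 3]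
     (\<lambda>bs. sym_cond (bs ! 0) (entry (bs ! 1) (bs ! 2) (bs ! 3)) (entry (bs ! 4) (bs ! 5) (bs ! 6)) (bs ! 7) (bs ! 8))))"

definition F_pot :: "nat \<Rightarrow> (nat \<Rightarrow> nat) \<Rightarrow> fm" where
  "F_pot r ex = FAnd (FAllLess 3 2 (FEx 5 (F2 r 3 5)))
     (FAllLess 3 2 (FAllLess 4 2 (FAll 5 (FAll 6 (FImp (FConj [FNot (FEq 3 4), F2 r 3 5, F2 r 4 6]) (FTab
       [F2 1 3 4, F2 2 3 4, F2 3 3 4, F2 1 4 3, F2 2 4 3, F2 3 4 3, FEq 5 6, FSuc 5 6, FSuc 6 5]
       (\<lambda>bs. pot_cond ex (entry (bs ! 0) (bs ! 1) (bs ! 2)) (entry (bs ! 3) (bs ! 4) (bs ! 5)) (bs ! 6) (bs ! 7) (bs ! 8))))))))"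

text \<open>Variable 6 is \<open>k\<close>, 4 is \<open>j\<close>, 3 the summation index and 7 the
  bit position. The number \<open>2^N\<close> has bit \<open>N\<close> alone, so a sum is 0 when its
  shifted value shows this pattern and positive when bit \<open>N\<close> and some lower bit are
  set. Vanishing carries at position \<open>N + 1\<close> exclude overflow.\<close>

definition F_lin :: fm where
  "F_lin = FAllLess 6 2 (FConj [FNot (F2 7 6 6), FEx 7 (FRel 8 [(6, 0), (6, 0), (7, 0), (0, 0)]),
     FAllLeq 4 6 (FConj [
       FAll 7 (FTab [FRel 9 [(6, 0), (4, 0), (0, 0), (7, 0)], FEq 7 1] (\<lambda>bs. bs ! 0 = bs ! 1)),
       FAllLeq 3 6 (FConj [
         FNot (FRel 10 [(6, 0), (4, 0), (3, 0), (0, 0)]), FNot (FRel 11 [(6, 0), (4, 0), (3, 0), (0, 0)]),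
         FNot (FRel 10 [(6, 0), (4, 0), (3, 0), (1, 1)]), FNot (FRel 11 [(6, 0), (4, 0), (3, 0), (1, 1)]),
         FAll 7 (FTab [FEq 4 3, F2 4 4 3, F2 1 4 3, F2 2 4 3, F2 3 4 3, F2 7 6 3,
           FRel 9 [(6, 0), (4, 0), (3, 0), (7, 0)], FRel 9 [(6, 0), (4, 0), (3, 1), (7, 0)],
           FRel 8 [(6, 0), (3, 0), (7, 0), (0, 0)],
           FRel 10 [(6, 0), (4, 0), (3, 0), (7, 0)], FRel 11 [(6, 0), (4, 0), (3, 0), (7, 0)],
           FRel 10 [(6, 0), (4, 0), (3, 0), (7, 1)], FRel 11 [(6, 0), (4, 0), (3, 0), (7, 1)]]
           (\<lambda>bs. add_cond (centry (bs ! 0) (bs ! 1) (entry (bs ! 2) (bs ! 3) (bs ! 4))) (bs ! 5)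
             (bs ! 6) (bs ! 7) (bs ! 8) (bs ! 9) (bs ! 10) (bs ! 11) (bs ! 12)))]),
       FImp (FLess 4 6) (FAll 7 (FTab [FRel 9 [(6, 0), (4, 0), (6, 1), (7, 0)], FEq 7 1] (\<lambda>bs. bs ! 0 = bs ! 1))),
       FImp (FEq 4 6) (FAnd (FRel 9 [(6, 0), (4, 0), (6, 1), (1, 0)])
         (FEx 7 (FAnd (FLess 7 1) (FRel 9 [(6, 0), (4, 0), (6, 1), (7, 0)]))))])])"

text \<open>Evaluation starts with all variables 0, so the greatest element has to be found by a
  quantifier; the two conditions on variable 8 pin variables 0 and 1 to 0 and
  \<open>N\<close>.\<close>

definition F_main :: fm where
  "F_main = FEx 0 (FEx 1 (FEx 2 (FConj [FAll 8 (FNot (FLess 8 0)), FAll 8 (FNot (FLess 1 8)),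
     F_dim, F_parse, F_sym, F_pot 5 ex2, F_pot 6 ex3, F_lin])))"

lemma length_encode_small: "w \<in> {-3..3} \<Longrightarrow> length (encode_int w) < 8"
proof -
  assume "w \<in> {-3..3}"
  then consider "w = -3" | "w = -2" | "w = -1" | "w = 0" | "w = 1" | "w = 2" | "w = 3" by force
  then show ?thesis by cases (simp_all add: encode_int_def nat_bits.simps)
qed

lemma F2_syntax [simp]: "wf_fm (F2 r v w)" "bound_vars (F2 r v w) = {}"
  by (simp_all add: F2_def)

lemma F_code_syntax: "bound_vars (F_code w) = {}" "w \<in> {-3..3} \<Longrightarrow> wf_fm (F_code w)"
  using length_encode_small[of w] by (auto simp: F_code_def)

lemma F_codes_syntax [simp]: "wf_fm F_codes" "bound_vars F_codes = {}"
  unfolding F_codes_def wf_FDisj bound_vars_FDisj set_map set_upto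
  using F_code_syntax by auto

lemma F_dim_syntax: "wf_fm F_dim" "bound_vars F_dim = {3}"
  by (simp_all add: F_dim_def)

lemma F_parse_syntax: "wf_fm F_parse" "bound_vars F_parse = {3, 4, 5}"
  by (auto simp: F_parse_def)

lemma F_sym_syntax: "wf_fm F_sym" "bound_vars F_sym = {3, 4}"
  by (simp_all add: F_sym_def)

lemma F_pot_syntax: "wf_fm (F_pot r ex)" "bound_vars (F_pot r ex) \<subseteq> {3..8}"
  by (simp_all add: F_pot_def)

lemma F_lin_syntax: "wf_fm F_lin" "bound_vars F_lin \<subseteq> {3..8}"
  by (simp_all add: F_lin_def)

lemma wf_F_main: "wf_fm F_main"
  unfolding F_main_def using F_pot_syntax F_lin_syntax(2)
  by (fastforce simp: F_dim_syntax F_parse_syntax F_sym_syntax F_lin_syntax(1))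

section \<open>The meaning of the formula\<close>

definition ent :: "(nat \<Rightarrow> nat list \<Rightarrow> bool) \<Rightarrow> nat \<Rightarrow> nat \<Rightarrow> int" where
  "ent R i j = entry (R 1 [i, j, 0, 0]) (R 2 [i, j, 0, 0]) (R 3 [i, j, 0, 0])"

definition cent :: "(nat \<Rightarrow> nat list \<Rightarrow> bool) \<Rightarrow> nat \<Rightarrow> nat \<Rightarrow> int" where
  "cent R i j = centry (i = j) (R 4 [i, j, 0, 0]) (ent R i j)"

definition parse_ok :: "bool list \<Rightarrow> nat \<Rightarrow> (nat \<Rightarrow> nat list \<Rightarrow> bool) \<Rightarrow> bool" where
  "parse_ok x n R \<longleftrightarrow> R 0 [0, 0, Suc n, 0] \<and>
     (\<forall>i<n. \<forall>j<n. \<forall>p\<le>length x. R 0 [i, j, p, 0] \<longrightarrow> (\<exists>w\<in>{-3..3}. ent R i j = w \<and>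
        R 0 [i, Suc j, p + length (encode_int w), 0] \<and>
        (\<forall>t<length (encode_int w). symb x (p + t) = (if encode_int w ! t then 2 else 1)))) \<and>
     (\<forall>i<n. \<forall>p\<le>length x. R 0 [i, n, p, 0] \<longrightarrow> R 0 [Suc i, 0, p, 0]) \<and>
     (\<forall>p\<le>length x. R 0 [n, 0, p, 0] \<longrightarrow> p = length x)"

definition sym_ok :: "nat \<Rightarrow> (nat \<Rightarrow> nat list \<Rightarrow> bool) \<Rightarrow> bool" where
  "sym_ok n R \<longleftrightarrow> (\<forall>i<n. \<forall>j<n. sym_cond (i = j) (ent R i j) (ent R j i) (R 4 [i, j, 0, 0]) (R 4 [j, i, 0, 0]))"

definition pot_ok :: "nat \<Rightarrow> nat \<Rightarrow> (nat \<Rightarrow> nat list \<Rightarrow> bool) \<Rightarrow> nat \<Rightarrow> (nat \<Rightarrow> nat) \<Rightarrow> bool" where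
  "pot_ok N n R r ex \<longleftrightarrow> (\<forall>i<n. \<exists>v\<le>N. R r [i, v, 0, 0]) \<and>
     (\<forall>i<n. \<forall>j<n. \<forall>v\<le>N. \<forall>w\<le>N. i \<noteq> j \<and> R r [i, v, 0, 0] \<and> R r [j, w, 0, 0] \<longrightarrow>
        pot_cond ex (ent R i j) (ent R j i) (v = w) (w = Suc v) (v = Suc w))"

definition lin_ok :: "nat \<Rightarrow> nat \<Rightarrow> (nat \<Rightarrow> nat list \<Rightarrow> bool) \<Rightarrow> bool" where
  "lin_ok N n R \<longleftrightarrow> (\<forall>k<n. \<not> R 7 [k, k, 0, 0] \<and> (\<exists>b\<le>N. R 8 [k, k, b, 0]) \<and>
     (\<forall>j\<le>k. (\<forall>b\<le>N. R 9 [k, j, 0, b] = (b = N)) \<and>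
       (\<forall>i\<le>k. \<not> R 10 [k, j, i, 0] \<and> \<not> R 11 [k, j, i, 0] \<and> \<not> R 10 [k, j, i, Suc N] \<and> \<not> R 11 [k, j, i, Suc N] \<and>
         (\<forall>b\<le>N. add_cond (cent R j i) (R 7 [k, i, 0, 0]) (R 9 [k, j, i, b]) (R 9 [k, j, Suc i, b]) (R 8 [k, i, b, 0])
            (R 10 [k, j, i, b]) (R 11 [k, j, i, b]) (R 10 [k, j, i, Suc b]) (R 11 [k, j, i, Suc b]))) \<and>
       (j < k \<longrightarrow> (\<forall>b\<le>N. R 9 [k, j, Suc k, b] = (b = N))) \<and>
       (j = k \<longrightarrow> R 9 [k, j, Suc k, N] \<and> (\<exists>b<N. R 9 [k, j, Suc k, b]))))"

lemma sat_F_code: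
  assumes "e 0 = 0"
  shows "sat x R e (F_code w) \<longleftrightarrow> ent R (e 3) (e 4) = w \<and>
        R 0 [e 3, Suc (e 4), e 5 + length (encode_int w), 0] \<and>
        (\<forall>t<length (encode_int w). symb x (e 5 + t) = (if encode_int w ! t then 2 else 1))"
  unfolding F_code_def using assms by (auto simp: F2_def ent_def)

lemma ex_less_leq: "(\<exists>b<N :: nat. b \<le> N \<and> P b) \<longleftrightarrow> (\<exists>b<N. P b)"
  by auto

lemma sat_F_codes: "sat x R e F_codes \<longleftrightarrow> (\<exists>w\<in>{-3..3}. sat x R e (F_code w))"
  unfolding F_codes_def sat_FDisj set_map set_upto by blast

context
  fixes x :: "bool list" and R :: "nat \<Rightarrow> nat list \<Rightarrow> bool" and e :: "nat \<Rightarrow> nat" and n :: nat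
  assumes e: "e 0 = 0" "e 1 = length x" "e 2 = n" and n: "n \<le> length x"
begin

lemma sat_F_dim: "sat x R e F_dim \<longleftrightarrow> (\<forall>i<n. symb x i = 2) \<and> symb x n = 1"
  unfolding F_dim_def using e n by simp

lemma sat_F_parse: "sat x R e F_parse \<longleftrightarrow> parse_ok x n R"
  unfolding F_parse_def parse_ok_def using e n by (simp add: sat_F_codes sat_F_code)

lemma sat_F_sym: "sat x R e F_sym \<longleftrightarrow> sym_ok n R"
  unfolding F_sym_def sym_ok_def using e n by (simp add: F2_def ent_def)

lemma sat_F_pot: "sat x R e (F_pot r ex) \<longleftrightarrow> pot_ok (length x) n R r ex"
  unfolding F_pot_def pot_ok_def using e n by (simp add: F2_def ent_def)

lemma sat_F_lin: "sat x R e F_lin \<longleftrightarrow> lin_ok (length x) n R"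
  unfolding F_lin_def lin_ok_def using e n
  by (simp add: F2_def ent_def cent_def conj_ac ex_less_leq)

end

lemma sat_F_main: "sat x R e F_main \<longleftrightarrow> (\<exists>n\<le>length x. (\<forall>i<n. symb x i = 2) \<and> symb x n = 1 \<and>
   parse_ok x n R \<and> sym_ok n R \<and> pot_ok (length x) n R 5 ex2 \<and> pot_ok (length x) n R 6 ex3 \<and> lin_ok (length x) n R)"
  (is "_ \<longleftrightarrow> ?rhs")
proof
  assume "sat x R e F_main"
  then obtain z t n where *: "n \<le> length x" "t \<le> length x" "\<forall>a\<le>length x. \<not> a < z" "\<forall>a\<le>length x. \<not> t < a"
    and sat: "\<forall>\<phi> \<in> {F_dim, F_parse, F_sym, F_pot 5 ex2, F_pot 6 ex3, F_lin}. sat x R (e(0 := z, 1 := t, 2 := n)) \<phi>"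
    unfolding F_main_def by auto
  have "z = 0" "t = length x" using * by (auto simp: not_less)
  then show ?rhs
    using sat *(1) sat_F_dim sat_F_parse sat_F_sym sat_F_pot sat_F_lin
    by (intro exI[of _ n]) auto
next
  assume ?rhs
  then obtain n where n: "n \<le> length x" and *: "(\<forall>i<n. symb x i = 2) \<and> symb x n = 1 \<and>
   parse_ok x n R \<and> sym_ok n R \<and> pot_ok (length x) n R 5 ex2 \<and> pot_ok (length x) n R 6 ex3 \<and> lin_ok (length x) n R"
    by blast
  let ?e = "e(0 := 0, 1 := length x, 2 := n)"
  have "\<forall>\<phi> \<in> {F_dim, F_parse, F_sym, F_pot 5 ex2, F_pot 6 ex3, F_lin}. sat x R ?e \<phi>"
    using * n by (simp add: sat_F_dim sat_F_parse sat_F_sym sat_F_pot sat_F_lin)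
  then show "sat x R e F_main"
    unfolding F_main_def sat_derived
    by - (rule exI[of _ 0], rule conjI, simp, rule exI[of _ "length x"], rule conjI, simp,
      rule exI[of _ n], rule conjI, rule n, simp del: One_nat_def)
qed

section \<open>Soundness: from relations to an instance and a companion\<close>

lemma symb_iff: "symb x p = (if p < length x then if x ! p then 2 else 1 else 0)"
  by (auto simp: symb_def word_tape_def)

text \<open>Cells outside the word hold 0, so a match of all symbols of \<open>c\<close> cannot run
  past the end of \<open>x\<close>.\<close>

lemma symb_code_iff:
  "(\<forall>t<length c. symb x (p + t) = (if c ! t then 2 else 1)) \<longleftrightarrow> take (length c) (drop p x) = c"
  (is "?L \<longleftrightarrow> _")
proof
  assume L: ?L
  have bit: "p + t < length x \<and> x ! (p + t) = c ! t" if "t < length c" for t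
    using L[rule_format, OF that] by (auto simp: symb_iff split: if_splits)
  show "take (length c) (drop p x) = c"
  proof (cases "c = []")
    case False
    then have "p + length c \<le> length x" using bit[of "length c - 1"] by (cases c) auto
    then show ?thesis using bit by (intro nth_equalityI) auto
  qed simp
next
  assume *: "take (length c) (drop p x) = c"
  show ?L
  proof (intro allI impI)
    fix t assume t: "t < length c"
    have "length (take (length c) (drop p x)) = length c" using * by simp
    then have "p + t < length x" using t by simp
    moreover have "take (length c) (drop p x) ! t = c ! t" using * by simp
    ultimately show "symb x (p + t) = (if c ! t then 2 else 1)"
      using t by (auto simp: symb_iff)
  qed
qed

text \<open>The part of the input consumed when the parse stands in front of entry
  \<open>(i, j)\<close>.\<close>

definition prefix_code :: "nat \<Rightarrow> (nat \<Rightarrow> nat \<Rightarrow> int) \<Rightarrow> nat \<Rightarrow> nat \<Rightarrow> bool list" where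
  "prefix_code n b i j = replicate n True @ [False] @
     concat (map (\<lambda>i'. concat (map (\<lambda>j'. encode_int (b i' j')) [0..<n])) [0..<i]) @
     concat (map (\<lambda>j'. encode_int (b i j')) [0..<j])"

lemma prefix_code_Suc: "prefix_code n b i (Suc j) = prefix_code n b i j @ encode_int (b i j)"
  by (simp add: prefix_code_def)

lemma prefix_code_row: "prefix_code n b (Suc i) 0 = prefix_code n b i n"
  by (simp add: prefix_code_def)

lemma prefix_code_mat:
  assumes "B \<in> carrier_mat n n"
  shows "encode_mat B = prefix_code n (\<lambda>i j. B $$ (i, j)) n 0"
proof -
  have cc: "concat (concat xss) = concat (map concat xss)" for xss :: "bool list list list"
    by (induction xss) auto
  show ?thesis using assms by (simp add: encode_mat_def prefix_code_def cc comp_def)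
qed

text \<open>Induction over the rows and within each row, with the invariant that some position
  \<open>p\<close> in relation 0 has exactly \<open>?pre i j\<close> before it. The last condition
  of \<open>parse_ok\<close> excludes trailing symbols.\<close>

lemma parse_sound:
  assumes n: "n \<le> length x" and dim: "\<forall>i<n. symb x i = 2" "symb x n = 1" and ok: "parse_ok x n R"
  shows "x = encode_mat (mat n n (\<lambda>(i, j). ent R i j))"
proof -
  let ?pre = "prefix_code n (ent R)"
  have start: "take (Suc n) x = ?pre 0 0" "Suc n \<le> length x"
  proof -
    have "\<forall>t<length (replicate n True @ [False]). symb x (0 + t) = (if (replicate n True @ [False]) ! t then 2 else 1)"
      using dim by (auto simp: nth_append less_Suc_eq)
    then show "take (Suc n) x = ?pre 0 0" unfolding symb_code_iff by (simp add: prefix_code_def)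
    show "Suc n \<le> length x" using dim(2) by (auto simp: symb_iff split: if_splits)
  qed
  have row: "\<exists>p\<le>length x. R 0 [i, j, p, 0] \<and> take p x = ?pre i j"
    if i: "i < n" and p: "\<exists>p\<le>length x. R 0 [i, 0, p, 0] \<and> take p x = ?pre i 0" and "j \<le> n" for i j
    using that(3)
  proof (induction j)
    case (Suc j)
    then obtain p where p: "p \<le> length x" "R 0 [i, j, p, 0]" "take p x = ?pre i j" by auto
    let ?w = "encode_int (ent R i j)"
    have next_pos: "R 0 [i, Suc j, p + length ?w, 0]"
      and code: "\<forall>t<length ?w. symb x (p + t) = (if ?w ! t then 2 else 1)"
      using ok i Suc.prems p unfolding parse_ok_def by fastforce+
    have c: "take (length ?w) (drop p x) = ?w" using code unfolding symb_code_iff .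
    have "length (take (length ?w) (drop p x)) = length ?w" using c by simp
    then have "p + length ?w \<le> length x" using p(1) by simp
    moreover have "take (p + length ?w) x = ?pre i (Suc j)"
      unfolding take_add p(3) c prefix_code_Suc ..
    ultimately show ?case using next_pos by blast
  qed (use p in simp)
  have "\<exists>p\<le>length x. R 0 [i, 0, p, 0] \<and> take p x = ?pre i 0" if "i \<le> n" for i
    using that
  proof (induction i)
    case 0
    then show ?case using start ok by (intro exI[of _ "Suc n"]) (simp add: parse_ok_def)
  next
    case (Suc i)
    then obtain p where "p \<le> length x" "R 0 [i, n, p, 0]" "take p x = ?pre i n" using row[of i n] by auto
    then show ?case using ok Suc.prems unfolding parse_ok_def prefix_code_row by auto
  qed
  from this[of n] obtain p where p: "p \<le> length x" "R 0 [n, 0, p, 0]" "take p x = ?pre n 0" by auto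
  then have "p = length x" using ok unfolding parse_ok_def by blast
  then have "x = ?pre n 0" using p(3) by simp
  also have "\<dots> = prefix_code n (\<lambda>i j. mat n n (\<lambda>(i, j). ent R i j) $$ (i, j)) n 0"
    unfolding prefix_code_def by (auto intro!: arg_cong[where f = concat] map_cong)
  also have "\<dots> = encode_mat (mat n n (\<lambda>(i, j). ent R i j))"
    by (rule prefix_code_mat[symmetric]) simp
  finally show ?thesis .
qed

lemma nval_Suc: "nval (Suc M) f = nval M f + of_bool (f M) * 2 ^ M"
  by (simp add: nval_def)

lemma nval_eq_0_iff: "nval M f = 0 \<longleftrightarrow> (\<forall>b<M. \<not> f b)"
  by (auto simp: nval_def)

lemma nval_bit: "nval M (bit z) = z mod 2 ^ M"
  by (induction M) (simp_all add: nval_def mod_pow_Suc del: power_Suc)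

lemma entry_bounds: "\<bar>entry s a b\<bar> \<le> 3"
  by (simp add: entry_def)

text \<open>Zero carries at both ends turn the columns into an exact equation between numbers of
  \<open>N + 1\<close> bits. For opposite signs this is the equation solved for
  \<open>s\<close>.\<close>

lemma add_cond_sound:
  fixes s s' u c0 c1 :: "nat \<Rightarrow> bool"
  assumes add: "\<forall>b\<le>N. add_cond c us (s b) (s' b) (u b) (c0 b) (c1 b) (c0 (Suc b)) (c1 (Suc b))"
    and carries: "\<not> c0 0" "\<not> c1 0" "\<not> c0 (Suc N)" "\<not> c1 (Suc N)"
  shows "int (nval (Suc N) s') = int (nval (Suc N) s) + c * ((if us then -1 else 1) * int (nval (Suc N) u))"
proof -
  let ?c = "\<lambda>b. of_bool (c0 b) + 2 * of_bool (c1 b) :: nat"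
  have c0: "?c 0 = 0" and cN: "?c (Suc N) = 0" using carries by auto
  show ?thesis
  proof (cases "(c < 0) \<noteq> us")
    case True
    have "nval (Suc N) s + 2 ^ Suc N * ?c (Suc N) = nval (Suc N) s' + nat \<bar>c\<bar> * nval (Suc N) u"
      by (rule adder_sound[where c = ?c, OF _ c0]) (use add True in \<open>auto simp: add_cond_def\<close>)
    then have "int (nval (Suc N) s) = int (nval (Suc N) s') + \<bar>c\<bar> * int (nval (Suc N) u)"
      unfolding cN by (metis add.right_neutral mult_0_right of_nat_add of_nat_mult nat_0_le abs_ge_zero)
    then show ?thesis using True by (cases us) auto
  next
    case False
    have "nval (Suc N) s' + 2 ^ Suc N * ?c (Suc N) = nval (Suc N) s + nat \<bar>c\<bar> * nval (Suc N) u"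
      by (rule adder_sound[where c = ?c, OF _ c0]) (use add False in \<open>auto simp: add_cond_def\<close>)
    then have "int (nval (Suc N) s') = int (nval (Suc N) s) + \<bar>c\<bar> * int (nval (Suc N) u)"
      unfolding cN by (metis add.right_neutral mult_0_right of_nat_add of_nat_mult nat_0_le abs_ge_zero)
    then show ?thesis using False by (cases us) auto
  qed
qed

text \<open>The vectors are read off from relations 7 and 8, the shifted partial sums from relation
  9; each application of \<open>add_cond_sound\<close> adds one summand.\<close>

lemma lin_sound:
  assumes ok: "lin_ok N n R"
  shows "pos_witness n (cent R)
    (\<lambda>k i. (if R 7 [k, i, 0, 0] then -1 else 1) * int (nval (Suc N) (\<lambda>b. R 8 [k, i, b, 0])))"
    (is "pos_witness n _ ?u")
  unfolding pos_witness_def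
proof (intro allI impI)
  fix k assume k: "k < n"
  let ?s = "\<lambda>j i. nval (Suc N) (\<lambda>b. R 9 [k, j, i, b])"
  have top: "nval (Suc N) f = 2 ^ N" if "\<forall>b\<le>N. f b = (b = N)" for f
    using that nval_eq_0_iff[of N f] by (simp add: nval_Suc)
  have sum: "int (?s j i) = 2 ^ N + (\<Sum>i'<i. cent R j i' * ?u k i')" if j: "j \<le> k" and "i \<le> Suc k" for i j
    using that(2)
  proof (induction i)
    case 0
    have "?s j 0 = 2 ^ N" using ok k j by (intro top) (simp add: lin_ok_def)
    then show ?case by simp
  next
    case (Suc i)
    have "int (?s j (Suc i)) = int (?s j i) + cent R j i * ?u k i"
      by (rule add_cond_sound[where ?c0.0 = "\<lambda>b. R 10 [k, j, i, b]" and ?c1.0 = "\<lambda>b. R 11 [k, j, i, b]"])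
         (use ok k j Suc.prems in \<open>simp_all add: lin_ok_def\<close>)
    then show ?case using Suc by simp
  qed
  have "\<not> R 7 [k, k, 0, 0]" "\<exists>b\<le>N. R 8 [k, k, b, 0]" using ok k by (simp_all add: lin_ok_def)
  then have "nval (Suc N) (\<lambda>b. R 8 [k, k, b, 0]) \<noteq> 0" by (auto simp: nval_eq_0_iff less_Suc_eq_le)
  then have 1: "?u k k > 0" using \<open>\<not> R 7 [k, k, 0, 0]\<close> by simp
  have last: "R 9 [k, k, Suc k, N]" "\<exists>b<N. R 9 [k, k, Suc k, b]"
  proof -
    have "\<forall>j\<le>k. j = k \<longrightarrow> R 9 [k, j, Suc k, N] \<and> (\<exists>b<N. R 9 [k, j, Suc k, b])"
      using ok k unfolding lin_ok_def by blast
    then show "R 9 [k, k, Suc k, N]" "\<exists>b<N. R 9 [k, k, Suc k, b]" by auto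
  qed
  then have "nval N (\<lambda>b. R 9 [k, k, Suc k, b]) \<noteq> 0" by (auto simp: nval_eq_0_iff)
  then have "?s k (Suc k) > 2 ^ N" using last(1) by (simp add: nval_Suc)
  then have "int (?s k (Suc k)) > 2 ^ N" by (metis of_nat_less_iff of_nat_numeral of_nat_power)
  then have 2: "(\<Sum>i<Suc k. cent R k i * ?u k i) > 0" unfolding sum[OF le_refl le_refl] by linarith
  have 3: "(\<Sum>i<Suc k. cent R j i * ?u k i) = 0" if "j < k" for j
  proof -
    have "?s j (Suc k) = 2 ^ N" using ok k that by (intro top) (simp add: lin_ok_def)
    then have "int (?s j (Suc k)) = 2 ^ N" by simp
    then show ?thesis using sum[of j "Suc k"] that by linarith
  qed
  show "?u k k > 0 \<and> (\<Sum>i<Suc k. cent R k i * ?u k i) > 0 \<and> (\<forall>j<k. (\<Sum>i<Suc k. cent R j i * ?u k i) = 0)"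
    using 1 2 3 by blast
qed

lemma pot_cond_iff:
  assumes "\<And>w. ex w \<le> 1"
  shows "pot_cond ex b b' (v = w) (w = Suc v) (v = Suc w) \<longleftrightarrow>
    (b \<noteq> 0 \<longrightarrow> v + ex (nat \<bar>b\<bar>) = w + ex (nat \<bar>b'\<bar>))"
proof -
  have "ex (nat \<bar>b\<bar>) = 0 \<or> ex (nat \<bar>b\<bar>) = 1" "ex (nat \<bar>b'\<bar>) = 0 \<or> ex (nat \<bar>b'\<bar>) = 1"
    using assms[of "nat \<bar>b\<bar>"] assms[of "nat \<bar>b'\<bar>"] by linarith+
  then show ?thesis unfolding pot_cond_def by (elim disjE) (simp_all, linarith+)
qed

lemma ex_le_1: "ex2 w \<le> 1" "ex3 w \<le> 1"
  by (auto simp: ex2_def ex3_def)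

text \<open>The exponents in relations 5 and 6 define \<open>d\<close> directly. This works since a
  nonzero magnitude up to 3 is the product of powers of 2 and 3 with exponents \<open>ex2\<close>
  and \<open>ex3\<close>.\<close>

lemma pot_sound:
  assumes sym: "sym_ok n R" and pot: "pot_ok N n R 5 ex2" "pot_ok N n R 6 ex3"
  obtains d :: "nat \<Rightarrow> real" where "\<And>i. d i > 0"
    "\<And>i j. i < n \<Longrightarrow> j < n \<Longrightarrow> d i * \<bar>ent R i j\<bar> = d j * \<bar>ent R j i\<bar>"
proof -
  have "\<forall>i<n. \<exists>v\<le>N. R 5 [i, v, 0, 0]" "\<forall>i<n. \<exists>v\<le>N. R 6 [i, v, 0, 0]"
    using pot by (auto simp: pot_ok_def)
  then obtain \<alpha> \<beta> where ab: "\<And>i. i < n \<Longrightarrow> \<alpha> i \<le> N \<and> R 5 [i, \<alpha> i, 0, 0]"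
    "\<And>i. i < n \<Longrightarrow> \<beta> i \<le> N \<and> R 6 [i, \<beta> i, 0, 0]" by metis
  define d where "d = (\<lambda>i. 2 ^ \<alpha> i * 3 ^ \<beta> i :: real)"
  show ?thesis
  proof (rule that[of d])
    show "d i > 0" for i by (simp add: d_def)
    fix i j assume ij: "i < n" "j < n"
    let ?b = "ent R i j" and ?b' = "ent R j i"
    have s: "sym_cond (i = j) ?b ?b' (R 4 [i, j, 0, 0]) (R 4 [j, i, 0, 0])"
      using sym ij unfolding sym_ok_def by blast
    show "d i * \<bar>?b\<bar> = d j * \<bar>?b'\<bar>"
    proof (cases "i = j \<or> ?b = 0")
      case True
      then show ?thesis using s by (cases "i = j") (simp_all add: sym_cond_def)
    next
      case False
      then have nz: "?b \<noteq> 0" "?b' \<noteq> 0" using s by (simp_all add: sym_cond_def)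
      have "pot_cond ex2 ?b ?b' (\<alpha> i = \<alpha> j) (\<alpha> j = Suc (\<alpha> i)) (\<alpha> i = Suc (\<alpha> j))"
        "pot_cond ex3 ?b ?b' (\<beta> i = \<beta> j) (\<beta> j = Suc (\<beta> i)) (\<beta> i = Suc (\<beta> j))"
        using pot ab[of i] ab[of j] ij False by (simp_all add: pot_ok_def)
      then have e: "\<alpha> i + ex2 (nat \<bar>?b\<bar>) = \<alpha> j + ex2 (nat \<bar>?b'\<bar>)"
        "\<beta> i + ex3 (nat \<bar>?b\<bar>) = \<beta> j + ex3 (nat \<bar>?b'\<bar>)"
        unfolding pot_cond_iff[of ex2, OF ex_le_1(1)] pot_cond_iff[of ex3, OF ex_le_1(2)] using nz by blast+
      have w: "real_of_int \<bar>z\<bar> = 2 ^ ex2 (nat \<bar>z\<bar>) * 3 ^ ex3 (nat \<bar>z\<bar>)" if "z \<noteq> 0" "\<bar>z\<bar> \<le> 3" for z :: int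
      proof -
        have "nat \<bar>z\<bar> = 2 ^ ex2 (nat \<bar>z\<bar>) * 3 ^ ex3 (nat \<bar>z\<bar>)" using ex23[of "nat \<bar>z\<bar>"] that by auto
        then have "real (nat \<bar>z\<bar>) = 2 ^ ex2 (nat \<bar>z\<bar>) * 3 ^ ex3 (nat \<bar>z\<bar>)"
          by (metis of_nat_mult of_nat_numeral of_nat_power)
        then show ?thesis by simp
      qed
      have "\<bar>?b\<bar> \<le> 3" "\<bar>?b'\<bar> \<le> 3" by (simp_all only: ent_def entry_bounds)
      note w[OF nz(1) this(1)] w[OF nz(2) this(2)]
      then have "d i * \<bar>?b\<bar> = 2 ^ (\<alpha> i + ex2 (nat \<bar>?b\<bar>)) * 3 ^ (\<beta> i + ex3 (nat \<bar>?b\<bar>))"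
        "d j * \<bar>?b'\<bar> = 2 ^ (\<alpha> j + ex2 (nat \<bar>?b'\<bar>)) * 3 ^ (\<beta> j + ex3 (nat \<bar>?b'\<bar>))"
        by (simp_all only: d_def power_add mult_ac)
      then show ?thesis using e by simp
    qed
  qed
qed

text \<open>One \<open>d\<close> serves twice: off the diagonal \<open>B\<close> and
  \<open>C\<close> have the same absolute values, and \<open>sym_cond\<close> fixes the sign
  patterns.\<close>

lemma F_main_sound:
  assumes n: "n \<le> length x" and dim: "\<forall>i<n. symb x i = 2" "symb x n = 1"
    and ok: "parse_ok x n R" "sym_ok n R" "pot_ok (length x) n R 5 ex2" "pot_ok (length x) n R 6 ex3"
      "lin_ok (length x) n R"
  shows "x \<in> positive_companion_problem"
proof -
  define B where "B = mat n n (\<lambda>(i, j). ent R i j)"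
  define C where "C = mat n n (\<lambda>(i, j). cent R i j)"
  have B: "B \<in> carrier_mat n n" and C: "C \<in> carrier_mat n n" by (simp_all add: B_def C_def)
  have x: "x = encode_mat B" unfolding B_def by (rule parse_sound[OF n dim ok(1)])
  obtain d :: "nat \<Rightarrow> real" where d: "\<And>i. d i > 0"
    "\<And>i j. i < n \<Longrightarrow> j < n \<Longrightarrow> d i * \<bar>ent R i j\<bar> = d j * \<bar>ent R j i\<bar>"
    by (rule pot_sound[OF ok(2-4)]) blast
  have sym: "sym_cond (i = j) (ent R i j) (ent R j i) (R 4 [i, j, 0, 0]) (R 4 [j, i, 0, 0])"
    if "i < n" "j < n" for i j using ok(2) that by (simp add: sym_ok_def)
  have skew: "skew_symmetrizable B"
    unfolding skew_symmetrizable_iff[OF B]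
  proof (intro exI[of _ d] conjI allI impI)
    fix i j assume ij: "i < n" "j < n"
    have "d i * real_of_int (ent R i j) = - (d j * real_of_int (ent R j i))"
    proof (cases "i = j")
      case True
      then show ?thesis using sym[OF ij] by (simp add: sym_cond_def)
    next
      case False
      note s = sym[OF ij] sym[OF ij(2,1)]
      consider "ent R i j = 0" "ent R j i = 0" | "ent R i j > 0" "ent R j i < 0" | "ent R i j < 0" "ent R j i > 0"
        using s False unfolding sym_cond_def by (metis linorder_neqE)
      then show ?thesis using d(2)[OF ij] by cases (simp_all add: abs_of_pos abs_of_neg)
    qed
    then show "d i * real_of_int (B $$ (i, j)) = - (d j * real_of_int (B $$ (j, i)))"
      using ij by (simp add: B_def)
  qed (use d in simp)
  have symC: "symm_by n d (cent R)"
    unfolding symm_by_def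
  proof (intro conjI allI impI)
    fix i j assume ij: "i < n" "j < n"
    show "d i * real_of_int (cent R i j) = d j * real_of_int (cent R j i)"
      using sym[OF ij] d(2)[OF ij] by (auto simp: cent_def centry_def sym_cond_def)
  qed (use d in simp)
  have pos: "pos_form n d (cent R)" by (rule pos_witness_sound[OF symC lin_sound[OF ok(5)]])
  have "symm_by n d (\<lambda>i j. C $$ (i, j))" "pos_form n d (\<lambda>i j. C $$ (i, j))"
    using symC pos by (simp_all add: C_def symm_by_def pos_form_def bform_def)
  then have "positive_quasi_Cartan C"
    unfolding positive_quasi_Cartan_iff[OF C] by (auto simp: C_def cent_def centry_def)
  moreover from this have "quasi_Cartan_companion C B"
    by (auto simp: quasi_Cartan_companion_def positive_quasi_Cartan_def B_def C_def cent_def centry_def)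
  ultimately show ?thesis
    unfolding positive_companion_problem_def x using skew by blast
qed

section \<open>Completeness: relations for a yes-instance\<close>

definition wit :: "nat \<Rightarrow> (nat \<Rightarrow> nat \<Rightarrow> int) \<Rightarrow> (nat \<Rightarrow> nat \<Rightarrow> int) \<Rightarrow> (nat \<Rightarrow> nat) \<Rightarrow> (nat \<Rightarrow> nat) \<Rightarrow> (nat \<Rightarrow> nat \<Rightarrow> int)
    \<Rightarrow> (nat \<Rightarrow> nat \<Rightarrow> nat \<Rightarrow> nat) \<Rightarrow> (nat \<Rightarrow> nat \<Rightarrow> nat \<Rightarrow> nat \<Rightarrow> nat) \<Rightarrow> nat \<Rightarrow> nat list \<Rightarrow> bool" where
  "wit n b c \<alpha> \<beta> u S Y r as = (let i = as ! 0; j = as ! 1; k = as ! 2; l = as ! 3 in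
     if r = 0 then k = length (prefix_code n b i j)
     else if r = 1 then b i j < 0
     else if r = 2 then odd (b i j)
     else if r = 3 then \<bar>b i j\<bar> \<ge> 2
     else if r = 4 then c i j < 0
     else if r = 5 then j = \<alpha> i
     else if r = 6 then j = \<beta> i
     else if r = 7 then u i j < 0
     else if r = 8 then bit (nat \<bar>u i j\<bar>) k
     else if r = 9 then bit (S i j k) l
     else if r = 10 then odd (Y i j k l)
     else Y i j k l \<ge> 2)"

lemma wit_simps:
  "wit n b c \<alpha> \<beta> u S Y 0 [i, j, k, l] \<longleftrightarrow> k = length (prefix_code n b i j)"
  "wit n b c \<alpha> \<beta> u S Y 1 [i, j, k, l] \<longleftrightarrow> b i j < 0"
  "wit n b c \<alpha> \<beta> u S Y 2 [i, j, k, l] \<longleftrightarrow> odd (b i j)"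
  "wit n b c \<alpha> \<beta> u S Y 3 [i, j, k, l] \<longleftrightarrow> \<bar>b i j\<bar> \<ge> 2"
  "wit n b c \<alpha> \<beta> u S Y 4 [i, j, k, l] \<longleftrightarrow> c i j < 0"
  "wit n b c \<alpha> \<beta> u S Y 5 [i, j, k, l] \<longleftrightarrow> j = \<alpha> i"
  "wit n b c \<alpha> \<beta> u S Y 6 [i, j, k, l] \<longleftrightarrow> j = \<beta> i"
  "wit n b c \<alpha> \<beta> u S Y 7 [i, j, k, l] \<longleftrightarrow> u i j < 0"
  "wit n b c \<alpha> \<beta> u S Y 8 [i, j, k, l] \<longleftrightarrow> bit (nat \<bar>u i j\<bar>) k"
  "wit n b c \<alpha> \<beta> u S Y 9 [i, j, k, l] \<longleftrightarrow> bit (S i j k) l"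
  "wit n b c \<alpha> \<beta> u S Y 10 [i, j, k, l] \<longleftrightarrow> odd (Y i j k l)"
  "wit n b c \<alpha> \<beta> u S Y 11 [i, j, k, l] \<longleftrightarrow> Y i j k l \<ge> 2"
  by (simp_all add: wit_def)

lemma entry_digits: "\<bar>z\<bar> \<le> 3 \<Longrightarrow> entry (z < 0) (odd z) (\<bar>z\<bar> \<ge> 2) = z"
proof -
  assume "\<bar>z\<bar> \<le> 3"
  then consider "z = -3" | "z = -2" | "z = -1" | "z = 0" | "z = 1" | "z = 2" | "z = 3" by linarith
  then show ?thesis by cases (simp_all add: entry_def)
qed

lemma length_encode_int: "2 \<le> length (encode_int z)"
  by (simp add: encode_int_def)

text \<open>Each entry has at least a sign and an end marker. The resulting
  \<open>2 n^2 \<le> N\<close> leaves room for the exponents of the potentials and for the bits of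
  the sums.\<close>

lemma length_prefix_code: "n + 1 + 2 * (n * i) \<le> length (prefix_code n b i 0)"
proof -
  have row: "2 * m \<le> length (concat (map (\<lambda>j. encode_int (f j)) [0..<m]))" for f :: "nat \<Rightarrow> int" and m
  proof (induction m)
    case (Suc m)
    then show ?case using length_encode_int[of "f m"] by simp
  qed simp
  show ?thesis
  proof (induction i)
    case (Suc i)
    then show ?case using row[of n "b i"] by (simp add: prefix_code_def)
  qed (simp add: prefix_code_def)
qed

lemma parse_complete:
  assumes small: "\<And>i j. i < n \<Longrightarrow> j < n \<Longrightarrow> \<bar>b i j\<bar> \<le> 3" and x: "x = prefix_code n b n 0"
    and R: "R = wit n b c \<alpha> \<beta> u S Y"
  shows "parse_ok x n R" "n \<le> length x" "\<forall>i<n. symb x i = 2" "symb x n = 1"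
proof -
  have ent: "ent R i j = b i j" if "i < n" "j < n" for i j
    using entry_digits[OF small[OF that]] by (simp add: R ent_def wit_simps del: One_nat_def)
  have pre: "\<exists>ys. x = prefix_code n b i j @ ys" if "i < n" "j \<le> n" for i j
  proof -
    have "\<exists>ys. concat (map f [0..<m']) = concat (map f [0..<m]) @ ys" if "m \<le> m'" for f :: "nat \<Rightarrow> bool list" and m m'
    proof -
      have "[0..<m'] = [0..<m] @ [m..<m']" using upt_add_eq_append[of 0 m "m' - m"] that by simp
      then show ?thesis by simp
    qed
    from this[of "Suc i" n "\<lambda>i'. concat (map (\<lambda>j'. encode_int (b i' j')) [0..<n])"]
      this[of j n "\<lambda>j'. encode_int (b i j')"] that
    obtain ys zs where
      "concat (map (\<lambda>i'. concat (map (\<lambda>j'. encode_int (b i' j')) [0..<n])) [0..<n]) =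
       concat (map (\<lambda>i'. concat (map (\<lambda>j'. encode_int (b i' j')) [0..<n])) [0..<Suc i]) @ ys"
      "concat (map (\<lambda>j'. encode_int (b i j')) [0..<n]) = concat (map (\<lambda>j'. encode_int (b i j')) [0..<j]) @ zs"
      by auto
    then show ?thesis unfolding x by (simp add: prefix_code_def)
  qed
  show "parse_ok x n R"
    unfolding parse_ok_def
  proof (intro conjI allI impI)
    show "R 0 [0, 0, Suc n, 0]" by (simp add: R wit_simps prefix_code_def)
  next
    fix i j p assume ij: "i < n" "j < n" and p: "p \<le> length x" "R 0 [i, j, p, 0]"
    let ?w = "b i j"
    have p: "p = length (prefix_code n b i j)" using p by (simp add: R wit_simps)
    obtain ys where "x = prefix_code n b i (Suc j) @ ys" using pre[of i "Suc j"] ij by auto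
    then have "take (length (encode_int ?w)) (drop p x) = encode_int ?w"
      by (simp add: prefix_code_Suc p)
    then have "\<forall>t<length (encode_int ?w). symb x (p + t) = (if encode_int ?w ! t then 2 else 1)"
      unfolding symb_code_iff .
    moreover have "?w \<in> {-3..3}" using small[OF ij] by auto
    moreover have "R 0 [i, Suc j, p + length (encode_int ?w), 0]"
      by (simp add: R wit_simps p prefix_code_Suc)
    ultimately show "\<exists>w\<in>{-3..3}. ent R i j = w \<and> R 0 [i, Suc j, p + length (encode_int w), 0] \<and>
        (\<forall>t<length (encode_int w). symb x (p + t) = (if encode_int w ! t then 2 else 1))"
      using ent[OF ij] by blast
  next
    fix i p assume "i < n" "R 0 [i, n, p, 0]"
    then show "R 0 [Suc i, 0, p, 0]" by (simp add: R wit_simps prefix_code_row)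
  next
    fix p assume "R 0 [n, 0, p, 0]"
    then show "p = length x" by (simp add: R wit_simps x)
  qed
  show "n \<le> length x" using length_prefix_code[of n n b] unfolding x by linarith
  have "take (length (replicate n True @ [False])) (drop 0 x) = replicate n True @ [False]"
    by (simp add: x prefix_code_def)
  then have *: "\<forall>t<length (replicate n True @ [False]). symb x (0 + t) = (if (replicate n True @ [False]) ! t then 2 else 1)"
    unfolding symb_code_iff .
  show "symb x n = 1" using *[rule_format, of n] by (simp add: nth_append)
  show "\<forall>i<n. symb x i = 2"
  proof (intro allI impI)
    fix i assume "i < n"
    then show "symb x i = 2" using *[rule_format, of i] by (simp add: nth_append)
  qed
qed

text \<open>From \<open>m! \<le> m^m\<close> and \<open>3 m \<le> 2^(m + 1)\<close>. The exponent is
  quadratic, as is the lower bound on the input length in terms of the dimension; so the Cramer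
  bound becomes a bound on bit positions.\<close>

lemma fact_pow3_le: "fact m * 3 ^ m \<le> (2 :: int) ^ (m * m + m)"
proof -
  have three: "3 * int m \<le> 2 ^ Suc m" for m
  proof (induction m)
    case (Suc m)
    show ?case
    proof (cases "m = 0")
      case False
      then have "3 * int (Suc m) \<le> 2 * (3 * int m)" by simp
      then show ?thesis using Suc by simp
    qed simp
  qed simp
  have "fact m * 3 ^ m \<le> (int m ^ m) * 3 ^ m"
    using fact_le_power[of m, where 'a = int] by simp
  also have "\<dots> = (3 * int m) ^ m" by (simp add: power_mult_distrib mult.commute)
  also have "\<dots> \<le> (2 ^ Suc m) ^ m" using three by (intro power_mono) auto
  also have "\<dots> = 2 ^ (m * m + m)" by (simp add: power_mult[symmetric] algebra_simps del: power_Suc)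
  finally show ?thesis .
qed

lemma bit_pow2: "bit ((2 :: nat) ^ N) b \<longleftrightarrow> b = N"
  by (auto simp: bit_exp_iff)

lemma lower_bit:
  assumes "2 ^ N < z" "z < 2 ^ Suc N"
  shows "bit z N" "\<exists>b<N. bit (z :: nat) b"
proof -
  have "z = z mod 2 ^ Suc N" using assms(2) by simp
  then have z: "z = z mod 2 ^ N + 2 ^ N * of_bool (bit z N)" unfolding mod_pow_Suc .
  have "z mod 2 ^ N < 2 ^ N" by simp
  show b: "bit z N"
  proof (rule ccontr)
    assume "\<not> bit z N"
    then have "z = z mod 2 ^ N" using z by simp
    then show False using assms(1) \<open>z mod 2 ^ N < 2 ^ N\<close> by linarith
  qed
  have "z mod 2 ^ N \<noteq> 0" using z b assms(1) by auto
  then show "\<exists>b<N. bit z b" unfolding nval_bit[symmetric] nval_eq_0_iff by blast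
qed

text \<open>The carries are those of the addition that the signs select, namely to \<open>s'\<close>
  or to \<open>s\<close>. Its result is again one of the two numbers, so their common bound
  \<open>2^M\<close> makes the top carry vanish.\<close>

lemma add_cond_complete:
  assumes eq: "int s' = int s + c * v" and c: "\<bar>c\<bar> \<le> 3"
  defines "y \<equiv> \<lambda>b. if (c < 0) \<noteq> (v < 0) then carry s' (nat \<bar>c\<bar>) (nat \<bar>v\<bar>) b else carry s (nat \<bar>c\<bar>) (nat \<bar>v\<bar>) b"
  shows "add_cond c (v < 0) (bit s b) (bit s' b) (bit (nat \<bar>v\<bar>) b) (odd (y b)) (y b \<ge> 2) (odd (y (Suc b))) (y (Suc b) \<ge> 2)"
    and "y 0 = 0" and "s < 2 ^ M \<Longrightarrow> s' < 2 ^ M \<Longrightarrow> y M = 0"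
proof -
  have m: "nat \<bar>c\<bar> \<le> 3" using c by simp
  have digits: "of_bool (odd z) + 2 * of_bool (z \<ge> 2) = z" if "z < 4" for z :: nat
  proof -
    from that consider "z = 0" | "z = 1" | "z = 2" | "z = 3" by linarith
    then show ?thesis by cases simp_all
  qed
  have y4: "y b < 4" for b using carry_less[OF m] by (simp add: y_def)
  show "y 0 = 0" by (simp add: y_def carry_0)
  have cv: "int (nat \<bar>c\<bar> * nat \<bar>v\<bar>) = \<bar>c * v\<bar>" by (simp add: abs_mult)
  have opp: "s = s' + nat \<bar>c\<bar> * nat \<bar>v\<bar>" if "(c < 0) \<noteq> (v < 0)"
  proof -
    have "c * v \<le> 0" using that by (auto simp: mult_le_0_iff)
    then have "int s = int (s' + nat \<bar>c\<bar> * nat \<bar>v\<bar>)" using eq cv by simp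
    then show ?thesis by (simp only: of_nat_eq_iff)
  qed
  have same: "s' = s + nat \<bar>c\<bar> * nat \<bar>v\<bar>" if "\<not> (c < 0) \<noteq> (v < 0)"
  proof -
    have "c * v \<ge> 0" using that by (auto simp: zero_le_mult_iff)
    then have "int s' = int (s + nat \<bar>c\<bar> * nat \<bar>v\<bar>)" using eq cv by simp
    then show ?thesis by (simp only: of_nat_eq_iff)
  qed
  show "add_cond c (v < 0) (bit s b) (bit s' b) (bit (nat \<bar>v\<bar>) b) (odd (y b)) (y b \<ge> 2) (odd (y (Suc b))) (y (Suc b) \<ge> 2)"
  proof (cases "(c < 0) \<noteq> (v < 0)")
    case True
    have "of_bool (bit s b) + 2 * y (Suc b) = of_bool (bit s' b) + nat \<bar>c\<bar> * of_bool (bit (nat \<bar>v\<bar>) b) + y b"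
      using carry_step[of s' "nat \<bar>c\<bar>" "nat \<bar>v\<bar>" b] True opp[OF True] by (simp add: y_def)
    then show ?thesis using True unfolding add_cond_def Let_def digits[OF y4] by simp
  next
    case False
    have "of_bool (bit s' b) + 2 * y (Suc b) = of_bool (bit s b) + nat \<bar>c\<bar> * of_bool (bit (nat \<bar>v\<bar>) b) + y b"
      using carry_step[of s "nat \<bar>c\<bar>" "nat \<bar>v\<bar>" b] False same[OF False] by (simp add: y_def)
    then show ?thesis using False unfolding add_cond_def Let_def digits[OF y4] by simp
  qed
  assume less: "s < 2 ^ M" "s' < 2 ^ M"
  show "y M = 0"
  proof (cases "(c < 0) \<noteq> (v < 0)")
    case True
    then show ?thesis using carry_top[of s' "nat \<bar>c\<bar>" "nat \<bar>v\<bar>" M] opp[OF True] less by (simp add: y_def)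
  next
    case False
    then show ?thesis using carry_top[of s "nat \<bar>c\<bar>" "nat \<bar>v\<bar>" M] same[OF False] less by (simp add: y_def)
  qed
qed

text \<open>At most \<open>k + 1\<close> summands, each at most \<open>3 * k! * 3^k\<close>; the
  product has the shape of \<open>fact_pow3_le\<close> for \<open>m = k + 1\<close>.\<close>

lemma partial_sum_bound:
  fixes c u :: "nat \<Rightarrow> int"
  assumes "i \<le> Suc k" "\<And>i'. i' < Suc k \<Longrightarrow> \<bar>c i'\<bar> \<le> 3" "\<And>i'. i' < Suc k \<Longrightarrow> \<bar>u i'\<bar> \<le> fact k * 3 ^ k"
  shows "\<bar>\<Sum>i'<i. c i' * u i'\<bar> \<le> fact (Suc k) * 3 ^ Suc k"
proof -
  have "\<bar>\<Sum>i'<i. c i' * u i'\<bar> \<le> (\<Sum>i'<i. \<bar>c i' * u i'\<bar>)" by (rule sum_abs)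
  also have "\<dots> \<le> (\<Sum>i'<i. 3 * (fact k * 3 ^ k))"
    using assms by (intro sum_mono) (auto simp: abs_mult intro!: mult_mono)
  also have "\<dots> = int i * (3 * (fact k * 3 ^ k))" by simp
  also have "\<dots> \<le> int (Suc k) * (3 * (fact k * 3 ^ k))" using assms(1) by (intro mult_right_mono) auto
  also have "\<dots> = fact (Suc k) * 3 ^ Suc k" by (simp add: algebra_simps)
  finally show ?thesis .
qed

lemma lin_complete:
  assumes N: "n + 1 + 2 * (n * n) \<le> N"
    and u: "pos_witness n c u" "\<And>k i. k < n \<Longrightarrow> i < Suc k \<Longrightarrow> \<bar>u k i\<bar> \<le> fact k * 3 ^ k"
    and c: "\<And>i j. i < n \<Longrightarrow> j < n \<Longrightarrow> \<bar>c i j\<bar> \<le> 3"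
    and cent: "\<And>i j. i < n \<Longrightarrow> j < n \<Longrightarrow> cent R i j = c i j"
    and S: "S = (\<lambda>k j i. nat (2 ^ N + (\<Sum>i'<i. c j i' * u k i')))"
    and Y: "Y = (\<lambda>k j i b. if (c j i < 0) \<noteq> (u k i < 0) then carry (S k j (Suc i)) (nat \<bar>c j i\<bar>) (nat \<bar>u k i\<bar>) b
        else carry (S k j i) (nat \<bar>c j i\<bar>) (nat \<bar>u k i\<bar>) b)"
    and R: "R = wit n b c \<alpha> \<beta> u S Y"
  shows "lin_ok N n R"
  unfolding lin_ok_def
proof (intro allI impI)
  fix k assume k: "k < n"
  let ?B = "fact (Suc k) * 3 ^ Suc k :: int"
  have "Suc k * Suc k + Suc k \<le> n * n + n" using k by (intro add_mono mult_mono) auto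
  then have exp: "Suc k * Suc k + Suc k < N" using N by linarith
  have B: "?B < 2 ^ N"
    using fact_pow3_le[of "Suc k"] power_strict_increasing[OF exp, of "2 :: int"] by linarith
  have sum: "\<bar>\<Sum>i'<i. c j i' * u k i'\<bar> < 2 ^ N" if "j \<le> k" "i \<le> Suc k" for i j
    using partial_sum_bound[OF that(2), of "c j" "u k"] c u(2)[OF k] k that B by fastforce
  \<comment> \<open>Because the sum stays above \<open>-2^N\<close>, the truncation by
    \<open>nat\<close> in \<open>S\<close> has no effect.\<close>
  have Sint: "int (S k j i) = 2 ^ N + (\<Sum>i'<i. c j i' * u k i')" if "j \<le> k" "i \<le> Suc k" for i j
    using sum[OF that] by (simp add: S)
  have Sless: "S k j i < 2 ^ Suc N" if "j \<le> k" "i \<le> Suc k" for i j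
  proof -
    have "int (S k j i) < 2 ^ Suc N" using Sint[OF that] sum[OF that] by simp
    then show ?thesis by (metis of_nat_less_iff of_nat_numeral of_nat_power)
  qed
  have S2: "S k j i = 2 ^ N" if "(\<Sum>i'<i. c j i' * u k i') = 0" for i j
    using that by (simp add: S nat_power_eq)
  have small: "\<bar>u k i\<bar> < 2 ^ N" if "i \<le> k" for i
  proof -
    have "\<bar>u k i\<bar> \<le> fact k * 3 ^ k" using u(2)[OF k] that by simp
    also have "\<dots> \<le> ?B" by (intro mult_mono fact_mono power_increasing) auto
    finally show ?thesis using B by simp
  qed
  have ukk: "u k k > 0" and pos: "(\<Sum>i<Suc k. c k i * u k i) > 0"
    and zero: "\<And>j. j < k \<Longrightarrow> (\<Sum>i<Suc k. c j i * u k i) = 0"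
    using u(1) k unfolding pos_witness_def by blast+
  have "\<exists>b\<le>N. bit (nat \<bar>u k k\<bar>) b"
  proof -
    have "nat \<bar>u k k\<bar> < 2 ^ N" using small[of k] by (simp add: nat_less_iff)
    then have "nat \<bar>u k k\<bar> mod 2 ^ N \<noteq> 0" using ukk by simp
    then show ?thesis unfolding nval_bit[symmetric] nval_eq_0_iff by (meson less_imp_le)
  qed
  then have 1: "\<not> R 7 [k, k, 0, 0] \<and> (\<exists>b\<le>N. R 8 [k, k, b, 0])" using ukk by (simp add: R wit_simps)
  have 2: "\<forall>b\<le>N. R 9 [k, j, 0, b] = (b = N)" for j
    using S2[where i = 0] by (simp add: R wit_simps bit_pow2)
  have 3: "\<not> R 10 [k, j, i, 0] \<and> \<not> R 11 [k, j, i, 0] \<and> \<not> R 10 [k, j, i, Suc N] \<and> \<not> R 11 [k, j, i, Suc N] \<and>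
     (\<forall>b\<le>N. add_cond (cent R j i) (R 7 [k, i, 0, 0]) (R 9 [k, j, i, b]) (R 9 [k, j, Suc i, b]) (R 8 [k, i, b, 0])
            (R 10 [k, j, i, b]) (R 11 [k, j, i, b]) (R 10 [k, j, i, Suc b]) (R 11 [k, j, i, Suc b]))"
    if ji: "j \<le> k" "i \<le> k" for i j
  proof -
    have eq: "int (S k j (Suc i)) = int (S k j i) + c j i * u k i"
      using Sint[of j i] Sint[of j "Suc i"] ji by simp
    have cji: "\<bar>c j i\<bar> \<le> 3" using c ji k by simp
    have Y0: "Y k j i 0 = 0" and YN: "Y k j i (Suc N) = 0"
      and add: "\<And>b. add_cond (c j i) (u k i < 0) (bit (S k j i) b) (bit (S k j (Suc i)) b) (bit (nat \<bar>u k i\<bar>) b)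
        (odd (Y k j i b)) (Y k j i b \<ge> 2) (odd (Y k j i (Suc b))) (Y k j i (Suc b) \<ge> 2)"
      using add_cond_complete[OF eq cji] Sless[of j i] Sless[of j "Suc i"] ji unfolding Y by simp_all
    have "cent R j i = c j i" using cent ji k by simp
    then show ?thesis using Y0 YN add by (simp add: R wit_simps)
  qed
  have 4: "\<forall>b\<le>N. R 9 [k, j, Suc k, b] = (b = N)" if "j < k" for j
    using S2[OF zero[OF that]] by (simp add: R wit_simps bit_pow2)
  have 5: "R 9 [k, k, Suc k, N] \<and> (\<exists>b<N. R 9 [k, k, Suc k, b])"
  proof -
    have "int (S k k (Suc k)) > 2 ^ N" using Sint[of k "Suc k"] pos by simp
    then have "S k k (Suc k) > 2 ^ N" by (metis of_nat_less_iff of_nat_numeral of_nat_power)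
    then show ?thesis using lower_bit[of N "S k k (Suc k)"] Sless[of k "Suc k"] by (simp add: R wit_simps)
  qed
  show "\<not> R 7 [k, k, 0, 0] \<and> (\<exists>b\<le>N. R 8 [k, k, b, 0]) \<and>
     (\<forall>j\<le>k. (\<forall>b\<le>N. R 9 [k, j, 0, b] = (b = N)) \<and>
       (\<forall>i\<le>k. \<not> R 10 [k, j, i, 0] \<and> \<not> R 11 [k, j, i, 0] \<and> \<not> R 10 [k, j, i, Suc N] \<and> \<not> R 11 [k, j, i, Suc N] \<and>
         (\<forall>b\<le>N. add_cond (cent R j i) (R 7 [k, i, 0, 0]) (R 9 [k, j, i, b]) (R 9 [k, j, Suc i, b]) (R 8 [k, i, b, 0])
            (R 10 [k, j, i, b]) (R 11 [k, j, i, b]) (R 10 [k, j, i, Suc b]) (R 11 [k, j, i, Suc b]))) \<and>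
       (j < k \<longrightarrow> (\<forall>b\<le>N. R 9 [k, j, Suc k, b] = (b = N))) \<and>
       (j = k \<longrightarrow> R 9 [k, j, Suc k, N] \<and> (\<exists>b<N. R 9 [k, j, Suc k, b])))"
    using 1 2 3 4 5 by blast
qed

lemma F_main_complete:
  assumes x: "x \<in> positive_companion_problem"
  shows "\<exists>R. sat x R e F_main"
proof -
  obtain B C where BC: "skew_symmetrizable B" "quasi_Cartan_companion C B" "positive_quasi_Cartan C"
    and xB: "x = encode_mat B" using x by (auto simp: positive_companion_problem_def)
  define n where "n = dim_row B"
  have B: "B \<in> carrier_mat n n" using BC(1) by (auto simp: skew_symmetrizable_def n_def)
  have C: "C \<in> carrier_mat n n"
    using BC(2) by (auto simp: quasi_Cartan_companion_def quasi_Cartan_def symmetrizable_def n_def)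
  define b where "b = (\<lambda>i j. B $$ (i, j))"
  define c where "c = (\<lambda>i j. C $$ (i, j))"
  have xb: "x = prefix_code n b n 0" unfolding xB b_def by (rule prefix_code_mat[OF B])
  define N where "N = length x"
  have N: "n + 1 + 2 * (n * n) \<le> N" using length_prefix_code[of n n b] by (simp add: N_def xb)
  have bc: "\<bar>c i j\<bar> = \<bar>b i j\<bar>" if "i < n" "j < n" "i \<noteq> j" for i j
    using BC(2) that by (auto simp: quasi_Cartan_companion_def n_def b_def c_def)
  obtain d where diag: "\<And>i. i < n \<Longrightarrow> c i i = 2" and sym: "symm_by n d c" and pos: "pos_form n d c"
    using BC(3) unfolding positive_quasi_Cartan_iff[OF C] c_def by blast
  \<comment> \<open>The skew-symmetrizer \<open>d'\<close> yields the zero diagonal and the sign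
    pattern of \<open>B\<close>. The potentials come from the symmetrizer \<open>d\<close> of
    \<open>C\<close>, which fits because the absolute values agree off the diagonal.\<close>
  obtain d' :: "nat \<Rightarrow> real" where d': "\<forall>i<n. d' i > 0"
    "\<forall>i<n. \<forall>j<n. d' i * of_int (b i j) = - (d' j * of_int (b j i))"
    using BC(1) unfolding skew_symmetrizable_iff[OF B] b_def by blast
  have b0: "b i i = 0" if "i < n" for i
  proof -
    have "d' i * of_int (b i i) = - (d' i * of_int (b i i))" using d'(2) that by blast
    then show ?thesis using d'(1) that by auto
  qed
  have bneg: "b i j < 0 \<longleftrightarrow> b j i > 0" if "i < n" "j < n" for i j
  proof -
    have p: "d' i > 0" "d' j > 0" using d'(1) that by auto
    have "d' i * of_int (b i j) < 0 \<longleftrightarrow> d' j * of_int (b j i) > 0" using d'(2)[rule_format, OF that] by linarith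
    then show ?thesis using p by (simp add: mult_less_0_iff zero_less_mult_iff)
  qed
  have less4: "\<bar>b i j\<bar> * \<bar>b j i\<bar> < 4" if ij: "i < n" "j < n" "i \<noteq> j" for i j
  proof -
    \<comment> \<open>Symmetrizability gives \<open>c_ij\<close> and \<open>c_ji\<close> the same
      sign, so the bound on their product is one on absolute values and passes to
      \<open>B\<close>.\<close>
    have "c i j * c j i \<ge> 0" using symm_by_sign[OF sym ij(1,2)] by (auto simp: zero_le_mult_iff)
    then have "\<bar>c i j\<bar> * \<bar>c j i\<bar> = c i j * c j i" by (metis abs_mult abs_of_nonneg)
    then show ?thesis
      using pos_form_rank2[OF sym pos ij diag diag] bc[of i j] bc[of j i] ij by simp
  qed
  have bz: "b i j = 0 \<longleftrightarrow> b j i = 0" if "i < n" "j < n" for i j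
    using bneg[OF that] bneg[OF that(2,1)] neq_iff[of "b i j" 0] neq_iff[of "b j i" 0] by blast
  have b3: "\<bar>b i j\<bar> \<le> 3" if ij: "i < n" "j < n" for i j
  proof (cases "i = j \<or> b i j = 0")
    case False
    then have "b j i \<noteq> 0" using bz[OF ij] by blast
    then have "1 \<le> \<bar>b j i\<bar>" by linarith
    then have "\<bar>b i j\<bar> * 1 \<le> \<bar>b i j\<bar> * \<bar>b j i\<bar>" by (intro mult_left_mono) auto
    moreover have "i \<noteq> j" using False by simp
    ultimately show ?thesis using less4[OF ij] by linarith
  qed (use b0 ij in auto)
  have c3: "\<bar>c i j\<bar> \<le> 3" if "i < n" "j < n" for i j
    using b3[OF that] bc[OF that] diag[OF that(1)] by (cases "i = j") auto
  obtain \<alpha> \<beta> :: "nat \<Rightarrow> nat" where ab: "\<And>i. i < n \<Longrightarrow> \<alpha> i \<le> 2 * (n * n)" "\<And>i. i < n \<Longrightarrow> \<beta> i \<le> 2 * (n * n)"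
    "\<And>i j. i < n \<Longrightarrow> j < n \<Longrightarrow> i \<noteq> j \<Longrightarrow> nat \<bar>b i j\<bar> \<noteq> 0 \<Longrightarrow>
      \<alpha> i + ex2 (nat \<bar>b i j\<bar>) = \<alpha> j + ex2 (nat \<bar>b j i\<bar>) \<and> \<beta> i + ex3 (nat \<bar>b i j\<bar>) = \<beta> j + ex3 (nat \<bar>b j i\<bar>)"
  proof (rule potentials[of n d "\<lambda>i j. nat \<bar>b i j\<bar>"])
    show "0 < d i" if "i < n" for i using sym that by (simp add: symm_by_def)
    fix i j assume ij: "i < n" "j < n" "i \<noteq> j"
    have dd: "d i * of_int (c i j) = d j * of_int (c j i)" "d i > 0" "d j > 0"
      using sym ij by (auto simp: symm_by_def)
    then have "\<bar>d i * of_int (c i j)\<bar> = \<bar>d j * of_int (c j i)\<bar>" by simp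
    then have "d i * of_int \<bar>c i j\<bar> = d j * of_int \<bar>c j i\<bar>" using dd(2,3) by (simp add: abs_mult)
    then show "d i * real (nat \<bar>b i j\<bar>) = d j * real (nat \<bar>b j i\<bar>)"
      using bc[of i j] bc[of j i] ij by simp
    have "int (nat \<bar>b i j\<bar> * nat \<bar>b j i\<bar>) < int 4" using less4[OF ij] by simp
    then show "nat \<bar>b i j\<bar> * nat \<bar>b j i\<bar> < 4" by (simp only: of_nat_less_iff)
  qed blast
  obtain u where u: "pos_witness n c u" "\<And>k i. k < n \<Longrightarrow> i < Suc k \<Longrightarrow> \<bar>u k i\<bar> \<le> fact k * 3 ^ k"
    using pos_witness_complete[OF sym pos c3] by blast
  \<comment> \<open>\<open>S\<close> holds the shifted partial sums and \<open>Y\<close> the carries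
    of the additions selected in \<open>add_cond\<close>; a carry is below 4 and is recorded by its
    parity and by whether it is at least 2.\<close>
  define S where "S = (\<lambda>k j i. nat (2 ^ N + (\<Sum>i'<i. c j i' * u k i')))"
  define Y where "Y = (\<lambda>k j i b. if (c j i < 0) \<noteq> (u k i < 0) then carry (S k j (Suc i)) (nat \<bar>c j i\<bar>) (nat \<bar>u k i\<bar>) b
        else carry (S k j i) (nat \<bar>c j i\<bar>) (nat \<bar>u k i\<bar>) b)"
  define R where "R = wit n b c \<alpha> \<beta> u S Y"
  have ent: "ent R i j = b i j" if "i < n" "j < n" for i j
    using entry_digits[OF b3[OF that]] by (simp add: R_def ent_def wit_simps del: One_nat_def)
  have cent: "cent R i j = c i j" if "i < n" "j < n" for i j
    using ent[OF that] bc[OF that] diag[OF that(1)] by (auto simp: cent_def centry_def R_def wit_simps)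
  note parse = parse_complete[OF b3 xb R_def]
  have "sym_ok n R"
    unfolding sym_ok_def
  proof (intro allI impI)
    fix i j assume ij: "i < n" "j < n"
    have "c i j < 0 \<longleftrightarrow> c j i < 0"
      using symm_by_sign[OF sym ij] neq_iff[of "c i j" 0] neq_iff[of "c j i" 0] not_less_iff_gr_or_eq by blast
    then show "sym_cond (i = j) (ent R i j) (ent R j i) (R 4 [i, j, 0, 0]) (R 4 [j, i, 0, 0])"
      unfolding ent[OF ij] ent[OF ij(2,1)] using b0[OF ij(1)] b0[OF ij(2)] bz[OF ij] bneg[OF ij] less4[OF ij]
      by (simp add: sym_cond_def R_def wit_simps)
  qed
  moreover have "pot_ok N n R 5 ex2"
    unfolding pot_ok_def pot_cond_iff[of ex2, OF ex_le_1(1)]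
  proof (intro conjI allI impI)
    fix i assume i: "i < n"
    have "\<alpha> i \<le> N" using ab(1)[OF i] N by linarith
    then show "\<exists>v\<le>N. R 5 [i, v, 0, 0]" by (intro exI[of _ "\<alpha> i"]) (simp add: R_def wit_simps)
  next
    fix i j v w assume ij: "i < n" "j < n" and vw: "i \<noteq> j \<and> R 5 [i, v, 0, 0] \<and> R 5 [j, w, 0, 0]"
      and nz: "ent R i j \<noteq> 0"
    have "v = \<alpha> i" "w = \<alpha> j" using vw by (simp_all add: R_def wit_simps)
    moreover have "nat \<bar>b i j\<bar> \<noteq> 0" using nz ent[OF ij] by simp
    ultimately show "v + ex2 (nat \<bar>ent R i j\<bar>) = w + ex2 (nat \<bar>ent R j i\<bar>)"
      using ab(3)[OF ij] vw ent[OF ij] ent[OF ij(2,1)] by simp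
  qed
  moreover have "pot_ok N n R 6 ex3"
    unfolding pot_ok_def pot_cond_iff[of ex3, OF ex_le_1(2)]
  proof (intro conjI allI impI)
    fix i assume i: "i < n"
    have "\<beta> i \<le> N" using ab(2)[OF i] N by linarith
    then show "\<exists>v\<le>N. R 6 [i, v, 0, 0]" by (intro exI[of _ "\<beta> i"]) (simp add: R_def wit_simps)
  next
    fix i j v w assume ij: "i < n" "j < n" and vw: "i \<noteq> j \<and> R 6 [i, v, 0, 0] \<and> R 6 [j, w, 0, 0]"
      and nz: "ent R i j \<noteq> 0"
    have "v = \<beta> i" "w = \<beta> j" using vw by (simp_all add: R_def wit_simps)
    moreover have "nat \<bar>b i j\<bar> \<noteq> 0" using nz ent[OF ij] by simp
    ultimately show "v + ex3 (nat \<bar>ent R i j\<bar>) = w + ex3 (nat \<bar>ent R j i\<bar>)"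
      using ab(3)[OF ij] vw ent[OF ij] ent[OF ij(2,1)] by simp
  qed
  moreover have "lin_ok N n R" by (rule lin_complete[OF N u c3 cent S_def Y_def R_def])
  ultimately have "sat x R e F_main"
    unfolding sat_F_main using parse by (intro exI[of _ n]) (simp add: N_def)
  then show ?thesis by blast
qed

theorem mainTheorem3:
  shows "positive_companion_problem \<in> NP"
proof -
  have "positive_companion_problem = {x. \<exists>R. sat x R (\<lambda>_. 0) F_main}"
    using F_main_complete F_main_sound unfolding sat_F_main by blast
  then show ?thesis using second_order_NP[OF wf_F_main] by simp
qed

end
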